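(* Let $\tau\in\mathbf C$, $\tau\neq2$. Then $(\mathcal X_\tau)_Q$ is the largest open subset of $\mathcal X_\tau$ on which $\mathcal{MCG}$ acts properly discontinuously: $(\mathcal X_\tau)_Q$ is an open $\mathcal{MCG}$-invariant subset on which $\mathcal{MCG}$ acts properly discontinuously, and every open $\mathcal{MCG}$-invariant subset $U\subset\mathcal X_\tau$ on which $\mathcal{MCG}$ acts properly discontinuously is contained in $(\mathcal X_\tau)_Q$.
   Context: $\Gamma=\langle a,b\rangle$ is the free group of rank two, the fundamental group of a once-punctured torus $\mathbb T$. On $\Gamma$ let $g\sim h$ iff $g$ is conjugate to $h$ or $h^{-1}$; $\hat\Omega\subset\Gamma/\!\sim$ is the set of classes corresponding to non-trivial, non-peripheral simple closed curves on $\mathbb T$ (equivalently, classes of elements belonging to a free basis). A $\tau$-representation is a homomorphism $\rho:\Gamma\to\mathrm{SL}(2,\mathbf C)$ with $\mathrm{tr}\,\rho(aba^{-1}b^{-1})=\tau$. $\mathcal X_\tau$ is the set of $\tau$-representations modulo conjugation in $\mathrm{SL}(2,\mathbf C)$. For $\tau\neq2$, $[\rho]\mapsto(\mathrm{tr}\,\rho(a),\mathrm{tr}\,\rho(b),\mathrm{tr}\,\rho(ab))$ identifies $\mathcal X_\tau$ with $\{(x,y,z)\in\mathbf C^3: x^2+y^2+z^2-xyz=\tau+2\}$, from which $\mathcal X_\tau$ gets its topology. $(\mathcal X_\tau)_Q\subset\mathcal X_\tau$ is the subset of classes of $\rho$ satisfying the BQ-conditions: (BQ1) $\mathrm{tr}\,\rho(g)\notin[-2,2]$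 for all $[g]\in\hat\Omega$; (BQ2) $|\mathrm{tr}\,\rho(g)|\le2$ for only finitely many (possibly no) $[g]\in\hat\Omega$. $\mathcal{MCG}\cong\mathrm{SL}(2,\mathbf Z)$ is the mapping class group of $\mathbb T$; it acts on $\mathcal X_\tau$ by $H(\rho)(g)=\rho(H_*(g))$, where $H_*$ is the automorphism of $\Gamma$ (well defined up to inner automorphisms) induced by $H$. It acts properly discontinuously on an invariant subset $U$ if for every compact $K\subset U$ the set $\{H\in\mathcal{MCG}: H(K)\cap K\neq\emptyset\}$ is finite. *)

theory Defs
  imports "HOL-Analysis.Analysis" "HOL-Algebra.Algebra"
begin

section \<open>Free bases of a free group of rank two\<close>

text \<open>
  A letter \<open>(s, e)\<close> stands for the first (\<open>s = False\<close>) or second (\<open>s = True\<close>) basis element,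
  inverted iff \<open>e\<close> holds.
\<close>

type_synonym letter = "bool \<times> bool"

definition reduced_words :: "letter list set" where
  "reduced_words =
     {w. successively (\<lambda>l m. \<not> (fst l = fst m \<and> snd l \<noteq> snd m)) w}"

definition letter_value :: "('g, 'm) monoid_scheme \<Rightarrow> 'g \<Rightarrow> 'g \<Rightarrow> letter \<Rightarrow> 'g" where
  "letter_value G x y l =
     (let s = (if fst l then y else x) in if snd l then inv\<^bsub>G\<^esub> s else s)"

definition word_value :: "('g, 'm) monoid_scheme \<Rightarrow> 'g \<Rightarrow> 'g \<Rightarrow> letter list \<Rightarrow> 'g" where
  "word_value G x y w = foldr (\<lambda>l g. letter_value G x y l \<otimes>\<^bsub>G\<^esub> g) w \<one>\<^bsub>G\<^esub>"

text \<open>A group \<open>G\<close> is free of rank two on \<open>(x, y)\<close> iff every element is the value of exactly one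
  reduced word in \<open>x\<close> and \<open>y\<close>.\<close>

definition free_basis :: "('g, 'm) monoid_scheme \<Rightarrow> 'g \<Rightarrow> 'g \<Rightarrow> bool" where
  "free_basis G x y \<longleftrightarrow>
     x \<in> carrier G \<and> y \<in> carrier G \<and> bij_betw (word_value G x y) reduced_words (carrier G)"

definition commutator :: "('g, 'm) monoid_scheme \<Rightarrow> 'g \<Rightarrow> 'g \<Rightarrow> 'g" where
  "commutator G x y = x \<otimes>\<^bsub>G\<^esub> y \<otimes>\<^bsub>G\<^esub> inv\<^bsub>G\<^esub> x \<otimes>\<^bsub>G\<^esub> inv\<^bsub>G\<^esub> y"

section \<open>Free homotopy classes of unoriented simple closed curves\<close>

definition curve_rel :: "('g, 'm) monoid_scheme \<Rightarrow> ('g \<times> 'g) set" where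
  "curve_rel G =
     {(g, h). g \<in> carrier G \<and> h \<in> carrier G \<and>
        (\<exists>k\<in>carrier G. g = k \<otimes>\<^bsub>G\<^esub> h \<otimes>\<^bsub>G\<^esub> inv\<^bsub>G\<^esub> k \<or> g = k \<otimes>\<^bsub>G\<^esub> inv\<^bsub>G\<^esub> h \<otimes>\<^bsub>G\<^esub> inv\<^bsub>G\<^esub> k)}"

text \<open>On the once-punctured torus, the non-trivial non-peripheral simple closed curves are
  exactly those represented by members of free bases.\<close>

definition simple_curves :: "('g, 'm) monoid_scheme \<Rightarrow> 'g set set" where
  "simple_curves G = {C \<in> carrier G // curve_rel G. \<exists>g\<in>C. \<exists>h. free_basis G g h}"

section \<open>The character variety\<close>

definition SL2C :: "(complex^2^2) monoid" where
  "SL2C = \<lparr>carrier = {A. det A = 1}, mult = (**), one = mat 1\<rparr>"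

definition tau_reps ::
    "('g, 'm) monoid_scheme \<Rightarrow> 'g \<Rightarrow> 'g \<Rightarrow> complex \<Rightarrow> ('g \<Rightarrow> complex^2^2) set" where
  "tau_reps G a b \<tau> =
     {\<rho> \<in> hom G SL2C \<inter> extensional (carrier G). trace (\<rho> (commutator G a b)) = \<tau>}"

definition rep_conj_rel ::
    "('g, 'm) monoid_scheme \<Rightarrow> 'g \<Rightarrow> 'g \<Rightarrow> complex
      \<Rightarrow> (('g \<Rightarrow> complex^2^2) \<times> ('g \<Rightarrow> complex^2^2)) set" where
  "rep_conj_rel G a b \<tau> =
     {(\<rho>, \<sigma>). \<rho> \<in> tau_reps G a b \<tau> \<and> \<sigma> \<in> tau_reps G a b \<tau> \<and>
        (\<exists>A\<in>carrier SL2C. \<forall>g\<in>carrier G.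
           \<sigma> g = A \<otimes>\<^bsub>SL2C\<^esub> \<rho> g \<otimes>\<^bsub>SL2C\<^esub> inv\<^bsub>SL2C\<^esub> A)}"

definition char_space ::
    "('g, 'm) monoid_scheme \<Rightarrow> 'g \<Rightarrow> 'g \<Rightarrow> complex \<Rightarrow> ('g \<Rightarrow> complex^2^2) set set" where
  "char_space G a b \<tau> = tau_reps G a b \<tau> // rep_conj_rel G a b \<tau>"

definition rep_coords ::
    "('g, 'm) monoid_scheme \<Rightarrow> 'g \<Rightarrow> 'g \<Rightarrow> ('g \<Rightarrow> complex^2^2) \<Rightarrow> complex \<times> complex \<times> complex" where
  "rep_coords G a b \<rho> = (trace (\<rho> a), trace (\<rho> b), trace (\<rho> (a \<otimes>\<^bsub>G\<^esub> b)))"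

text \<open>Traces are conjugation invariant, so the image of a class under \<open>rep_coords\<close> is a
  singleton.\<close>

definition char_coords ::
    "('g, 'm) monoid_scheme \<Rightarrow> 'g \<Rightarrow> 'g \<Rightarrow> ('g \<Rightarrow> complex^2^2) set
      \<Rightarrow> complex \<times> complex \<times> complex" where
  "char_coords G a b c = the_elem (rep_coords G a b ` c)"

text \<open>For \<open>\<tau> \<noteq> 2\<close> the map \<open>char_coords\<close> is injective on \<open>char_space\<close>, with image the cubic
  surface \<open>x\<^sup>2 + y\<^sup>2 + z\<^sup>2 - x y z = \<tau> + 2\<close>; the topology is the one transported from this
  surface.\<close>

definition char_topology ::
    "('g, 'm) monoid_scheme \<Rightarrow> 'g \<Rightarrow> 'g \<Rightarrow> complex \<Rightarrow> ('g \<Rightarrow> complex^2^2) set topology" where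
  "char_topology G a b \<tau> =
     pullback_topology (char_space G a b \<tau>) (char_coords G a b) euclidean"

section \<open>The BQ-conditions\<close>

definition BQ1 :: "('g, 'm) monoid_scheme \<Rightarrow> ('g \<Rightarrow> complex^2^2) \<Rightarrow> bool" where
  "BQ1 G \<rho> \<longleftrightarrow> (\<forall>C\<in>simple_curves G. \<forall>g\<in>C. trace (\<rho> g) \<notin> complex_of_real ` {-2..2})"

definition BQ2 :: "('g, 'm) monoid_scheme \<Rightarrow> ('g \<Rightarrow> complex^2^2) \<Rightarrow> bool" where
  "BQ2 G \<rho> \<longleftrightarrow> finite {C \<in> simple_curves G. \<exists>g\<in>C. norm (trace (\<rho> g)) \<le> 2}"

definition BQ_space ::
    "('g, 'm) monoid_scheme \<Rightarrow> 'g \<Rightarrow> 'g \<Rightarrow> complex \<Rightarrow> ('g \<Rightarrow> complex^2^2) set set" where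
  "BQ_space G a b \<tau> = {c \<in> char_space G a b \<tau>. \<exists>\<rho>\<in>c. BQ1 G \<rho> \<and> BQ2 G \<rho>}"

section \<open>The mapping class group and its action\<close>

definition inner_auts :: "('g, 'm) monoid_scheme \<Rightarrow> ('g \<Rightarrow> 'g) set" where
  "inner_auts G = (\<lambda>k. \<lambda>g\<in>carrier G. k \<otimes>\<^bsub>G\<^esub> g \<otimes>\<^bsub>G\<^esub> inv\<^bsub>G\<^esub> k) ` carrier G"

text \<open>
  The commutator of \<open>a\<close> and \<open>b\<close> is the oriented loop around the puncture.  An automorphism is
  induced by an orientation-preserving homeomorphism of the once-punctured torus iff it maps
  this loop to a conjugate of itself (and not of its inverse); by Nielsen, this holds iff it
  acts with determinant 1 on the abelianization.  Isotopy of homeomorphisms corresponds to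
  equality up to inner automorphisms, so that \<open>MCG\<close> below is the mapping class group, with its
  identification with \<open>SL(2, \<int>)\<close> given by the action on the abelianization.
\<close>

definition orientation_auts :: "('g, 'm) monoid_scheme \<Rightarrow> 'g \<Rightarrow> 'g \<Rightarrow> ('g \<Rightarrow> 'g) set" where
  "orientation_auts G a b =
     {\<phi> \<in> auto G. \<exists>k\<in>carrier G.
        \<phi> (commutator G a b) = k \<otimes>\<^bsub>G\<^esub> commutator G a b \<otimes>\<^bsub>G\<^esub> inv\<^bsub>G\<^esub> k}"

definition MCG :: "('g, 'm) monoid_scheme \<Rightarrow> 'g \<Rightarrow> 'g \<Rightarrow> ('g \<Rightarrow> 'g) set monoid" where
  "MCG G a b = (AutoGroup G)\<lparr>carrier := orientation_auts G a b\<rparr> Mod inner_auts G"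

text \<open>A mapping class \<open>H\<close> is a coset of automorphisms, and a point \<open>c\<close> of the character space a
  conjugacy class of representations; the set of all compositions of members of \<open>c\<close> with members
  of \<open>H\<close> is again a single conjugacy class.\<close>

definition mcg_act ::
    "('g, 'm) monoid_scheme \<Rightarrow> ('g \<Rightarrow> 'g) set \<Rightarrow> ('g \<Rightarrow> complex^2^2) set
      \<Rightarrow> ('g \<Rightarrow> complex^2^2) set" where
  "mcg_act G H c = {compose (carrier G) \<rho> \<phi> | \<rho> \<phi>. \<rho> \<in> c \<and> \<phi> \<in> H}"

definition mcg_invariant ::
    "('g, 'm) monoid_scheme \<Rightarrow> 'g \<Rightarrow> 'g \<Rightarrow> ('g \<Rightarrow> complex^2^2) set set \<Rightarrow> bool" where
  "mcg_invariant G a b U \<longleftrightarrow> (\<forall>H\<in>carrier (MCG G a b). mcg_act G H ` U \<subseteq> U)"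

definition acts_properly_discontinuously ::
    "('g, 'm) monoid_scheme \<Rightarrow> 'g \<Rightarrow> 'g \<Rightarrow> complex \<Rightarrow> ('g \<Rightarrow> complex^2^2) set set \<Rightarrow> bool" where
  "acts_properly_discontinuously G a b \<tau> U \<longleftrightarrow>
     (\<forall>K. compactin (char_topology G a b \<tau>) K \<and> K \<subseteq> U \<longrightarrow>
        finite {H \<in> carrier (MCG G a b). mcg_act G H ` K \<inter> K \<noteq> {}})"

end

theory Submission
  imports Defs "HOL-Complex_Analysis.Complex_Analysis"
begin

text \<open>
  Nielsen reduction shows that the conjugacy class of a basis is determined by its image in
  \<open>\<int>\<^sup>2\<close>, so simple curves become primitive vectors \<open>u\<close> up to sign, the mapping class group becomes
  \<open>SL(2, \<int>)\<close>, and the traces of a representation with coordinates \<open>p\<close> become a function \<open>\<Phi> p u\<close>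
  with \<open>\<Phi> p (u + v) + \<Phi> p (u - v) = \<Phi> p u * \<Phi> p v\<close> for \<open>det (u, v) = 1\<close>.

  Call the cone spanned by an integral basis tame at \<open>p\<close> if on a neighbourhood of \<open>p\<close> its values
  avoid \<open>[-2, 2]\<close> and only finitely many of them are bounded by any given constant. A nest of non-tame
  cones at a point satisfying the BQ-conditions either has a constant side, and then the values along
  the fan of that side grow geometrically since the side has trace outside \<open>[-2, 2]\<close>; or the logarithms
  of the values along it are eventually subtractive, hence the moduli tend to 2, which forces
  \<open>\<tau> = 2\<close>. So the BQ-conditions hold uniformly near \<open>p\<close>; this gives openness, and proper discontinuity
  because the coordinates of a translate of \<open>p\<close> are again values of \<open>\<Phi> p\<close>.

  Conversely, let the action be properly discontinuous on an invariant open set. A trace in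
  \<open>[-2, 2]\<close> would, after a perturbation into \<open>(-2, 2)\<close>, give a recurrent Dehn twist, so every trace
  omits \<open>[-2, 2]\<close>, which bounds it, by Harnack's inequality, in terms of its value at the centre.
  If infinitely many traces were at most 2 in modulus at \<open>p\<close>, infinitely many \<open>M\<^sub>n\<close> would move \<open>p\<close> to
  a bounded sequence, with a limit point \<open>q\<close>. Since the \<open>M\<^sub>n\<close> preserve the area form of the
  cubic surface and their derivatives near \<open>p\<close> are bounded, \<open>M\<^sub>n\<close> maps a fixed compact neighbourhood of
  \<open>p\<close> onto a neighbourhood of \<open>q\<close> of fixed size. Hence \<open>q\<close> lies in the domain, which contradicts
  proper discontinuity.
\<close>

text \<open>The area argument in the converse gives nothing at a limit point
  \<open>(x, y, z)\<close> with \<open>2 z = x y\<close>, \<open>2 x = y z\<close> and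
  \<open>2 y = z x\<close>, that is, at a critical point of \<open>kappa\<close>. Apart from the
  origin, all coordinates of such a point have square 4 and \<open>kappa\<close> is 4 there; this is
  the value for \<tau> = 2, so the hypothesis excludes it. The origin lies on the surface for \<tau>
  = -2. Translates tending to it are replaced, by Dehn twists, by other bounded translates one of
  whose traces stays away from 0.

  The value 4 is also the only obstruction on the side of the BQ-conditions: in a nest of cones
  without growth each step lowers the sum of the two logarithms by at least the one that is kept, as
  in Euclid's algorithm by subtraction.

  The recurrent twist at a trace in (-2, 2) comes from its linear action on the two other traces,
  with two distinct eigenvalues of modulus 1. At the ends -2 and 2 the eigenvalues coincide, hence
  the perturbation.\<close>

definition det2 :: "int \<times> int \<Rightarrow> int \<times> int \<Rightarrow> int" where
  "det2 u v = fst u * snd v - snd u * fst v"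

definition lin :: "int \<times> int \<Rightarrow> int \<times> int \<Rightarrow> int \<times> int \<Rightarrow> int \<times> int" where
  "lin u v w = (fst w * fst u + snd w * fst v, fst w * snd u + snd w * snd v)"

lemma det2_simps [simp]:
  "det2 u u = 0" "det2 (- u) v = - det2 u v" "det2 u (- v) = - det2 u v"
  "det2 (u + u') v = det2 u v + det2 u' v" "det2 u (v + v') = det2 u v + det2 u v'"
  "det2 (u - u') v = det2 u v - det2 u' v" "det2 u (v - v') = det2 u v - det2 u v'"
  "det2 (1, 0) (0, 1) = 1"
  by (auto simp: det2_def algebra_simps)

lemma det2_swap: "det2 v u = - det2 u v"
  by (simp add: det2_def algebra_simps)

lemma lin_simps [simp]:
  "lin u v (1, 0) = u" "lin u v (0, 1) = v" "lin u v (1, 1) = u + v"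
  "lin u v (- w) = - lin u v w" "lin u v (w + w') = lin u v w + lin u v w'"
  "lin u v (w - w') = lin u v w - lin u v w'" "lin (1, 0) (0, 1) w = w"
  by (auto simp: lin_def algebra_simps prod_eq_iff)

lemma det2_lin: "det2 (lin u v w) (lin u v w') = det2 u v * det2 w w'"
  by (simp add: det2_def lin_def algebra_simps)

lemma lin_solve:
  assumes "det2 u v = 1"
  shows "lin u v (det2 w v, det2 u w) = w"
proof -
  have "fst (lin u v (det2 w v, det2 u w)) = det2 u v * fst w"
    "snd (lin u v (det2 w v, det2 u w)) = det2 u v * snd w"
    by (simp_all add: lin_def det2_def algebra_simps)
  then show ?thesis using assms by (simp add: prod_eq_iff)
qed

lemma lin_inject:
  assumes "det2 u v \<noteq> 0" and eq: "lin u v w = lin u v w'"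
  shows "w = w'"
proof -
  have "det2 (lin u v w) v = det2 u v * fst w" "det2 u (lin u v w) = det2 u v * snd w" for w
    by (auto simp: lin_def det2_def algebra_simps)
  then show ?thesis using assms by (metis mult_cancel_left prod_eq_iff)
qed

text \<open>The Euclidean algorithm on the first coordinates: as long as neither vanishes, adding or
  subtracting one vector to or from the other lowers the sum of their absolute values. The rule
  serves every property of oriented bases that survives a twist, its inverse and a quarter
  turn.\<close>

lemma sl2_induct [consumes 1, case_names base add sub rot]:
  assumes det: "det2 U V = 1"
    and base: "P (1, 0) (0, 1)"
    and add: "\<And>U V. det2 U V = 1 \<Longrightarrow> P U V \<Longrightarrow> P U (V + U)"
    and sub: "\<And>U V. det2 U V = 1 \<Longrightarrow> P U V \<Longrightarrow> P U (V - U)"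
    and rot: "\<And>U V. det2 U V = 1 \<Longrightarrow> P U V \<Longrightarrow> P V (- U)"
  shows "P U V"
proof -
  have rot2: "P (- U) (- V)" if "det2 U V = 1" "P U V" for U V
    using rot[OF _ rot[OF that]] that by (simp add: det2_swap[of V])
  have rot3: "P (- V) U" if "det2 U V = 1" "P U V" for U V
    using rot[OF _ rot2[OF that]] that by simp
  have add': "P (U + V) V" if "det2 U V = 1" "P U V" for U V
  proof -
    have "P V (- U - V)"
      using sub[OF _ rot[OF that]] that by (simp add: det2_swap[of V])
    from rot3[OF _ this] that show ?thesis by (simp add: det2_swap[of V] add.commute)
  qed
  have sub': "P (U - V) V" if "det2 U V = 1" "P U V" for U V
  proof -
    have "P V (- U + V)"
      using add[OF _ rot[OF that]] that by (simp add: det2_swap[of V])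
    from rot3[OF _ this] that show ?thesis by (simp add: det2_swap[of V])
  qed
  \<comment> \<open>Once a first coordinate is 0, the basis is such a shear up to a
    rotation.\<close>
  have q: "P (1, q) (0, 1)" for q :: int
  proof -
    have n: "P (1, int n) (0, 1)" for n
    proof (induction n)
      case (Suc n)
      then show ?case using add'[of "(1, int n)" "(0, 1)"] by (simp add: det2_def add.commute)
    qed (use base in simp)
    have m: "P (1, - int n) (0, 1)" for n
    proof (induction n)
      case (Suc n)
      then show ?case using sub'[of "(1, - int n)" "(0, 1)"]
        by (simp add: det2_def) (metis add.commute uminus_add_conv_diff minus_add_distrib)
    qed (use base in simp)
    show ?thesis using n[of "nat q"] m[of "nat (- q)"] by (cases "q \<ge> 0") auto
  qed
  show ?thesis using det
  proof (induction "nat \<bar>fst U\<bar> + nat \<bar>fst V\<bar>" arbitrary: U V rule: less_induct)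
    case less
    obtain p q r s where UV: "U = (p, q)" "V = (r, s)" by fastforce
    consider "r = 0" | "p = 0" | "p \<noteq> 0" "r \<noteq> 0" by blast
    then show ?case
    proof cases
      assume r: "r = 0"
      then have "p * s = 1" using less.prems UV by (simp add: det2_def)
      then consider "p = 1" "s = 1" | "p = -1" "s = -1"
        by (auto simp: zmult_eq_1_iff)
      then show ?thesis
      proof cases
        case 1 then show ?thesis using q UV r by simp
      next
        case 2 then show ?thesis using rot2[of "(1, -q)" "(0, 1)"] q[of "-q"] UV r
          by (simp add: det2_def)
      qed
    next
      assume p: "p = 0"
      then have "r * (- q) = 1" using less.prems UV by (simp add: det2_def algebra_simps)
      then consider "r = 1" "q = -1" | "r = -1" "q = 1"
        unfolding zmult_eq_1_iff by fastforce
      then show ?thesis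
      proof cases
        case 1 then show ?thesis using rot3[of "(1, s)" "(0, 1)"] q[of s] UV p
          by (simp add: det2_def)
      next
        case 2 then show ?thesis using rot[of "(1, -s)" "(0, 1)"] q[of "-s"] UV p
          by (simp add: det2_def)
      qed
    next
      assume nz: "p \<noteq> 0" "r \<noteq> 0"
      \<comment> \<open>Subtract for equal signs and add for opposite ones; the larger modulus
        drops.\<close>
      have "\<exists>e. (e = 1 \<or> e = -1) \<and> (\<bar>p + e * r\<bar> < \<bar>p\<bar> \<or> \<bar>r + e * p\<bar> < \<bar>r\<bar>)"
      proof (cases "p > 0 \<longleftrightarrow> r > 0")
        case True then show ?thesis using nz by (intro exI[of _ "-1"]) auto
      next
        case False then show ?thesis using nz by (intro exI[of _ 1]) auto
      qed
      then obtain e where e: "e = 1 \<or> e = -1" "\<bar>p + e * r\<bar> < \<bar>p\<bar> \<or> \<bar>r + e * p\<bar> < \<bar>r\<bar>"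
        by blast
      from e(2) show ?thesis
      proof
        assume lt: "\<bar>p + e * r\<bar> < \<bar>p\<bar>"
        show ?thesis
        proof (cases "e = 1")
          case True
          have "P (U + V) V" by (rule less.hyps) (use lt True UV in simp, use less.prems in simp)
          then show ?thesis using sub'[of "U + V" V] less.prems by simp
        next
          case False
          then have e: "e = -1" using e by simp
          have "P (U - V) V" by (rule less.hyps) (use lt e UV in simp, use less.prems in simp)
          then show ?thesis using add'[of "U - V" V] less.prems by simp
        qed
      next
        assume lt: "\<bar>r + e * p\<bar> < \<bar>r\<bar>"
        show ?thesis
        proof (cases "e = 1")
          case True
          have "P U (V + U)" by (rule less.hyps) (use lt True UV in simp, use less.prems in simp)
          then show ?thesis using sub[of U "V + U"] less.prems by simp
        next
          case False
          then have e: "e = -1" using e by simp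
          have "P U (V - U)" by (rule less.hyps) (use lt e UV in simp, use less.prems in simp)
          then show ?thesis using add[of U "V - U"] less.prems by simp
        qed
      qed
    qed
  qed
qed

section \<open>Generalized Markoff maps\<close>

definition seg :: "complex set" where "seg = complex_of_real ` {-2..2}"

lemma not_seg: "cmod x > 2 \<Longrightarrow> x \<notin> seg"
  by (auto simp: seg_def)

lemma closed_seg: "closed seg"
  unfolding seg_def
  by (intro compact_imp_closed compact_continuous_image continuous_intros) auto

section \<open>Primitive vectors and Farey cones\<close>

definition prim :: "int \<times> int \<Rightarrow> bool" where "prim u \<longleftrightarrow> coprime (fst u) (snd u)"

lemma prim_uminus [simp]: "prim (- u) = prim u"
  by (simp add: prim_def)

lemma det2_prim:
  assumes "\<bar>det2 u v\<bar> = 1" shows "prim u" "prim v"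
proof -
  have *: "prim u" if "\<bar>det2 u v\<bar> = 1" for u v
  proof -
    have "c dvd 1" if "c dvd fst u" "c dvd snd u" for c
    proof -
      have "c dvd det2 u v" using that by (simp add: det2_def)
      then show ?thesis using \<open>\<bar>det2 u v\<bar> = 1\<close> by (metis dvd_abs_iff)
    qed
    then show ?thesis by (auto simp: prim_def intro: coprimeI)
  qed
  show "prim u" using * assms by blast
  have "\<bar>det2 v u\<bar> = 1" using assms by (simp add: det2_swap[of v])
  then show "prim v" using * by blast
qed

lemma prim_complete:
  assumes "prim u" obtains v where "det2 u v = 1"
proof -
  obtain r s where "r * fst u + s * snd u = 1"
    using assms bezout_int[of "fst u" "snd u"] by (auto simp: prim_def)
  then have "det2 u (- s, r) = 1" by (simp add: det2_def algebra_simps)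
  then show ?thesis using that by blast
qed

lemma prim_lin:
  assumes "\<bar>det2 u v\<bar> = 1" "prim w" shows "prim (lin u v w)"
proof -
  obtain w' where "det2 w w' = 1" using assms prim_complete by blast
  then have "\<bar>det2 (lin u v w) (lin u v w')\<bar> = 1" using assms by (simp add: det2_lin)
  then show ?thesis using det2_prim by blast
qed

text \<open>The slopes in the closed Farey interval between u and v; since
  \<open>coprime 1 0\<close> holds, both ends belong to it.\<close>

definition cone :: "int \<times> int \<Rightarrow> int \<times> int \<Rightarrow> (int \<times> int) set" where
  "cone u v = {lin u v (int i, int j) | i j. coprime i j}"

lemma lin_swap: "lin v u (i, j) = lin u v (j, i)"
  by (simp add: lin_def add.commute)

lemma cone_swap: "cone v u = cone u v"
proof -
  have "cone v u \<subseteq> cone u v" for u v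
  proof
    fix w assume "w \<in> cone v u"
    then obtain i j where "w = lin v u (int i, int j)" "coprime i j" unfolding cone_def by blast
    then have "w = lin u v (int j, int i)" "coprime j i"
      using lin_swap[of v u] by (simp_all add: coprime_commute)
    then show "w \<in> cone u v" unfolding cone_def by blast
  qed
  then show ?thesis by blast
qed

lemma lin_split:
  "lin u v (int (j + d), int j) = lin u (u + v) (int d, int j)"
  "lin u v (int i, int (i + d)) = lin (u + v) v (int i, int d)"
  by (simp_all add: lin_def algebra_simps)

text \<open>Subtracting the smaller coefficient from the larger keeps them coprime and gives the
  coefficients in the half of the interval on that side of the mediant u + v.\<close>

lemma cone_split: "cone u v \<subseteq> cone u (u + v) \<union> cone (u + v) v"
proof
  fix w assume "w \<in> cone u v"
  then obtain i j where ij: "w = lin u v (int i, int j)" "coprime i j" by (auto simp: cone_def)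
  show "w \<in> cone u (u + v) \<union> cone (u + v) v"
  proof (cases "j \<le> i")
    case True
    then obtain d where d: "i = j + d" using le_Suc_ex by blast
    then have "coprime d j" using ij(2) by (metis coprime_iff_gcd_eq_1 gcd_add1 add.commute)
    then show ?thesis using ij d lin_split(1)[of u v j d] unfolding cone_def by blast
  next
    case False
    then obtain d where d: "j = i + d" using le_Suc_ex nat_le_linear by metis
    then have "coprime i d" using ij(2) by (metis coprime_iff_gcd_eq_1 gcd_add2)
    then show ?thesis using ij d lin_split(2)[of u v i d] unfolding cone_def by blast
  qed
qed

text \<open>Up to sign a primitive vector has nonnegative first coordinate, so two adjacent
  quadrants suffice; the lower one is written so that its sides, too, form an oriented
  basis.\<close>

lemma prim_cones:
  assumes "prim u"
  shows "u \<in> cone (1, 0) (0, 1) \<or> - u \<in> cone (1, 0) (0, 1) \<or>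
    u \<in> cone (0, -1) (1, 0) \<or> - u \<in> cone (0, -1) (1, 0)"
proof -
  obtain p q where u: "u = (p, q)" by fastforce
  have c: "coprime (nat \<bar>p\<bar>) (nat \<bar>q\<bar>)" using assms u
    by (simp add: prim_def coprime_nat_abs_left_iff coprime_nat_abs_right_iff)
  have 1: "(int (nat \<bar>p\<bar>), int (nat \<bar>q\<bar>)) \<in> cone (1, 0) (0, 1)"
    unfolding cone_def using c by (intro CollectI exI[of _ "nat \<bar>p\<bar>"] exI[of _ "nat \<bar>q\<bar>"]) simp
  have c': "coprime (nat \<bar>q\<bar>) (nat \<bar>p\<bar>)" using c by (simp add: coprime_commute)
  have 2: "(int (nat \<bar>p\<bar>), - int (nat \<bar>q\<bar>)) \<in> cone (0, -1) (1, 0)"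
  proof -
    have "(int (nat \<bar>p\<bar>), - int (nat \<bar>q\<bar>)) = lin (0, -1) (1, 0) (int (nat \<bar>q\<bar>), int (nat \<bar>p\<bar>))"
      by (simp add: lin_def)
    then show ?thesis unfolding cone_def using c' by blast
  qed
  show ?thesis using 1 2 u by (cases "p \<ge> 0"; cases "q \<ge> 0") auto
qed

text \<open>Fricke's polynomial: the trace of the commutator plus 2.\<close>

definition kappa :: "complex \<times> complex \<times> complex \<Rightarrow> complex" where
  "kappa = (\<lambda>(x, y, z). x\<^sup>2 + y\<^sup>2 + z\<^sup>2 - x * y * z)"

text \<open>The three moves are the effect on the traces of u, v and u + v of passing from (u, v) to
  (u, v + u), (u, v - u) and (v, - u).\<close>

definition mv_add :: "complex \<times> complex \<times> complex \<Rightarrow> complex \<times> complex \<times> complex" where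
  "mv_add = (\<lambda>(x, y, z). (x, z, x * z - y))"
definition mv_sub :: "complex \<times> complex \<times> complex \<Rightarrow> complex \<times> complex \<times> complex" where
  "mv_sub = (\<lambda>(x, y, z). (x, x * y - z, y))"
definition mv_rot :: "complex \<times> complex \<times> complex \<Rightarrow> complex \<times> complex \<times> complex" where
  "mv_rot = (\<lambda>(x, y, z). (y, x, x * y - z))"

lemma kappa_mv: "kappa (mv_add p) = kappa p" "kappa (mv_sub p) = kappa p" "kappa (mv_rot p) = kappa p"
proof -
  obtain x y z where p: "p = (x, y, z)" by (cases p)
  show "kappa (mv_add p) = kappa p" "kappa (mv_sub p) = kappa p" "kappa (mv_rot p) = kappa p"
    unfolding p kappa_def mv_add_def mv_sub_def mv_rot_def split_conv by Groebner_Basis.algebra+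
qed

text \<open>\<open>\<Phi> p u\<close> is the trace of the primitive class of slope \<open>u\<close> in the representation with
  coordinates \<open>p\<close>.\<close>

locale trace_family =
  fixes \<Phi> :: "complex \<times> complex \<times> complex \<Rightarrow> int \<times> int \<Rightarrow> complex"
  assumes Phi_base: "\<Phi> (x, y, z) (1, 0) = x" "\<Phi> (x, y, z) (0, 1) = y" "\<Phi> (x, y, z) (1, 1) = z"
    and Phi_uminus [simp]: "\<Phi> p (- u) = \<Phi> p u"
    and Phi_rel1: "det2 u v = 1 \<Longrightarrow> \<Phi> p (u + v) + \<Phi> p (u - v) = \<Phi> p u * \<Phi> p v"
begin

lemma Phi_diff: "\<Phi> p (u - v) = \<Phi> p (v - u)"
  using Phi_uminus[of p "u - v"] by simp

lemma Phi_rel: "\<bar>det2 u v\<bar> = 1 \<Longrightarrow> \<Phi> p (u + v) + \<Phi> p (u - v) = \<Phi> p u * \<Phi> p v"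
  using Phi_rel1[of u v p] Phi_rel1[of u "- v" p] by (auto simp: abs_if add.commute split: if_splits)

text \<open>The coordinates of a pulled back representation, if the automorphism sends the standard
  basis to elements of slopes u and v.\<close>

definition act :: "int \<times> int \<Rightarrow> int \<times> int \<Rightarrow> complex \<times> complex \<times> complex
    \<Rightarrow> complex \<times> complex \<times> complex" where
  "act u v p = (\<Phi> p u, \<Phi> p v, \<Phi> p (u + v))"

lemma act_base: "act (1, 0) (0, 1) p = p"
  by (cases p) (simp add: act_def Phi_base)

lemma act_moves:
  assumes "det2 u v = 1"
  shows "act u (v + u) p = mv_add (act u v p)" "act u (v - u) p = mv_sub (act u v p)"
    "act v (- u) p = mv_rot (act u v p)"
proof -
  have "\<Phi> p (u + (u + v)) + \<Phi> p (u - (u + v)) = \<Phi> p u * \<Phi> p (u + v)"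
    by (rule Phi_rel1) (use assms in simp)
  moreover have "u - (u + v) = - v" by simp
  ultimately have 1: "\<Phi> p (u + (v + u)) = \<Phi> p u * \<Phi> p (u + v) - \<Phi> p v"
    by (simp add: add.commute[of v] algebra_simps del: minus_add_distrib)
  have 2: "\<Phi> p (u - v) = \<Phi> p u * \<Phi> p v - \<Phi> p (u + v)"
    using Phi_rel1[OF assms, of p] by (simp add: algebra_simps)
  show "act u (v + u) p = mv_add (act u v p)" using 1 by (simp add: act_def mv_add_def add.commute)
  show "act u (v - u) p = mv_sub (act u v p)" using 2 Phi_diff[of p v u]
    by (simp add: act_def mv_sub_def)
  show "act v (- u) p = mv_rot (act u v p)" using 2 Phi_diff[of p v u]
    by (simp add: act_def mv_rot_def)
qed

text \<open>The predicate concerns the map and not its value at a point, so that continuity and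
  differential relations can be proved this way. The moves come after the map because they change
  the basis reached so far.\<close>

lemma act_induct [consumes 1, case_names base add sub rot]:
  assumes "det2 u v = 1" and "Q (\<lambda>p. p)"
    and "\<And>F. Q F \<Longrightarrow> Q (\<lambda>p. mv_add (F p))" and "\<And>F. Q F \<Longrightarrow> Q (\<lambda>p. mv_sub (F p))"
    and "\<And>F. Q F \<Longrightarrow> Q (\<lambda>p. mv_rot (F p))"
  shows "Q (act u v)"
  using assms(1)
proof (induction rule: sl2_induct)
  case base
  have "act (1, 0) (0, 1) = (\<lambda>p. p)" by (simp add: fun_eq_iff act_base)
  then show ?case using assms(2) by simp
next
  case (add U V)
  have "act U (V + U) = (\<lambda>p. mv_add (act U V p))" using add by (simp add: fun_eq_iff act_moves)
  then show ?case using assms(3)[OF add(2)] by simp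
next
  case (sub U V)
  have "act U (V - U) = (\<lambda>p. mv_sub (act U V p))" using sub by (simp add: fun_eq_iff act_moves)
  then show ?case using assms(4)[OF sub(2)] by simp
next
  case (rot U V)
  have "act V (- U) = (\<lambda>p. mv_rot (act U V p))" using rot by (simp add: fun_eq_iff act_moves)
  then show ?case using assms(5)[OF rot(2)] by simp
qed

lemma kappa_act:
  assumes "det2 u v = 1" shows "kappa (act u v p) = kappa p"
  using assms by (induction rule: act_induct) (simp_all add: kappa_mv)

text \<open>Pulling back is contravariant, so the product appears in the opposite order: the outer
  pair is read in the basis (u, v).\<close>

lemma act_lin:
  assumes "det2 u v = 1" "det2 w w' = 1"
  shows "act w w' (act u v p) = act (lin u v w) (lin u v w') p"
  using assms(2)
proof (induction rule: sl2_induct)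
  case base then show ?case by (simp add: act_base)
next
  case (add U V)
  then show ?case using assms(1) act_moves(1)[of "lin u v U" "lin u v V" p]
    by (simp add: act_moves det2_lin)
next
  case (sub U V)
  then show ?case using assms(1) act_moves(2)[of "lin u v U" "lin u v V" p]
    by (simp add: act_moves det2_lin)
next
  case (rot U V)
  then show ?case using assms(1) act_moves(3)[of "lin u v U" "lin u v V" p]
    by (simp add: act_moves det2_lin)
qed

lemma continuous_act: "det2 u v = 1 \<Longrightarrow> continuous_on UNIV (act u v)"
proof (induction rule: act_induct)
  case (add F)
  have "(\<lambda>p. mv_add (F p)) = (\<lambda>p. (fst (F p), snd (snd (F p)), fst (F p) * snd (snd (F p)) - fst (snd (F p))))"
    by (simp add: mv_add_def fun_eq_iff split: prod.splits)
  then show ?case using add by (simp only:) (intro continuous_intros)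
next
  case (sub F)
  have "(\<lambda>p. mv_sub (F p)) = (\<lambda>p. (fst (F p), fst (F p) * fst (snd (F p)) - snd (snd (F p)), fst (snd (F p))))"
    by (simp add: mv_sub_def fun_eq_iff split: prod.splits)
  then show ?case using sub by (simp only:) (intro continuous_intros)
next
  case (rot F)
  have "(\<lambda>p. mv_rot (F p)) = (\<lambda>p. (fst (snd (F p)), fst (F p), fst (F p) * fst (snd (F p)) - snd (snd (F p))))"
    by (simp add: mv_rot_def fun_eq_iff split: prod.splits)
  then show ?case using rot by (simp only:) (intro continuous_intros)
qed (simp add: continuous_intros)

lemma continuous_Phi:
  assumes "prim u" shows "continuous_on UNIV (\<lambda>p. \<Phi> p u)"
proof -
  obtain v where "det2 u v = 1" using assms prim_complete by blast
  from continuous_on_fst[OF continuous_act[OF this]] show ?thesis by (simp add: act_def)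
qed

lemma Phi_kappa:
  assumes "\<bar>det2 u v\<bar> = 1"
  shows "(\<Phi> p u)\<^sup>2 + (\<Phi> p v)\<^sup>2 + (\<Phi> p (u + v))\<^sup>2 - \<Phi> p u * \<Phi> p v * \<Phi> p (u + v) = kappa p"
proof (cases "det2 u v = 1")
  case True
  then show ?thesis using kappa_act[OF True, of p] by (simp add: act_def kappa_def)
next
  case False
  then have d: "det2 v u = 1" using assms by (simp add: det2_swap[of v] abs_if split: if_splits)
  show ?thesis using kappa_act[OF d, of p] by (simp add: act_def kappa_def algebra_simps)
qed

subsection \<open>Growth on cones\<close>

text \<open>The product of the traces of u and v is the sum of those of u + v and u - v, and the
  latter is not the larger one. So half the modulus at the mediant is at least the product of the
  halves at the two sides. The hypotheses pass to both halves of the cone, and the estimate follows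
  by the Euclidean algorithm on (i, j).\<close>

lemma growth:
  assumes "\<bar>det2 u v\<bar> = 1" "cmod (\<Phi> p u) > 2" "cmod (\<Phi> p v) > 2"
    "cmod (\<Phi> p (u - v)) \<le> cmod (\<Phi> p (u + v))" "coprime i j"
  shows "(cmod (\<Phi> p u) / 2) ^ i * (cmod (\<Phi> p v) / 2) ^ j \<le> cmod (\<Phi> p (lin u v (int i, int j))) / 2"
  using assms
proof (induction "i + j" arbitrary: i j u v rule: less_induct)
  case less
  let ?x = "\<Phi> p u" and ?y = "\<Phi> p v" and ?w = "\<Phi> p (u + v)"
  have xy: "cmod ?x > 2" "cmod ?y > 2" by fact+
  have "cmod (?x * ?y) \<le> cmod ?w + cmod (\<Phi> p (u - v))"
    using norm_triangle_ineq[of ?w "\<Phi> p (u - v)"] Phi_rel[OF less.prems(1), of p] by simp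
  then have w: "cmod ?x / 2 * (cmod ?y / 2) \<le> cmod ?w / 2"
    using less.prems(4) by (simp add: norm_mult)
  have wx: "cmod ?x \<le> cmod ?w" "cmod ?y \<le> cmod ?w"
  proof -
    have "cmod ?x * 2 \<le> cmod ?x * cmod ?y" "2 * cmod ?y \<le> cmod ?x * cmod ?y"
      using xy by (intro mult_left_mono mult_right_mono; simp)+
    then show "cmod ?x \<le> cmod ?w" "cmod ?y \<le> cmod ?w" using w by auto
  qed
  consider "i = 0" | "j = 0" | "i = j" "i > 0" | d where "i = j + d" "d > 0" "j > 0"
    | d where "j = i + d" "d > 0" "i > 0"
    by (metis gr0I less_imp_add_positive linorder_neqE_nat)
  then show ?case
  proof cases
    case 1 then show ?thesis using less.prems by simp
  next
    case 2 then show ?thesis using less.prems by simp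
  next
    case 3
    then have "i = 1" "j = 1" using less.prems by auto
    then show ?thesis using w by simp
  next
    case 4
    have c: "coprime d j" using less.prems(5) 4 by (metis coprime_iff_gcd_eq_1 gcd_add1 add.commute)
    \<comment> \<open>The comparison of sum and difference for the cone of u and u + v: the
      difference has the trace y, and |x| > 2 leaves at least 2 |w| - |y| \<ge> |y| for the
      sum.\<close>
    have "cmod ?y \<le> cmod (\<Phi> p (u + (u + v)))"
    proof -
      have "u - (u + v) = - v" by simp
      then have "\<Phi> p (u + (u + v)) + ?y = ?x * ?w"
        using Phi_rel[of u "u + v" p] less.prems(1) by (metis Phi_uminus det2_simps(1,5) add_0)
      then have "cmod ?x * cmod ?w \<le> cmod (\<Phi> p (u + (u + v))) + cmod ?y"
        by (metis norm_mult norm_triangle_ineq)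
      moreover have "2 * cmod ?w \<le> cmod ?x * cmod ?w"
        using xy by (intro mult_right_mono) auto
      ultimately show ?thesis using wx by simp
    qed
    moreover have "\<Phi> p (u - (u + v)) = ?y" using Phi_uminus[of p v] by simp
    ultimately have "(cmod ?x / 2) ^ d * (cmod ?w / 2) ^ j \<le> cmod (\<Phi> p (lin u (u + v) (int d, int j))) / 2"
      using 4 c xy wx less.prems by (intro less.hyps) auto
    moreover have "(cmod ?x / 2) ^ i * (cmod ?y / 2) ^ j \<le> (cmod ?x / 2) ^ d * (cmod ?w / 2) ^ j"
    proof -
      have "(cmod ?x / 2) ^ i * (cmod ?y / 2) ^ j = (cmod ?x / 2) ^ d * (cmod ?x / 2 * (cmod ?y / 2)) ^ j"
        unfolding 4(1) power_add power_mult_distrib by (simp only: mult_ac)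
      also have "\<dots> \<le> (cmod ?x / 2) ^ d * (cmod ?w / 2) ^ j"
        using w by (intro mult_left_mono power_mono) auto
      finally show ?thesis .
    qed
    ultimately show ?thesis using 4 lin_split(1)[of u v j d] by simp
  next
    case 5
    have c: "coprime i d" using less.prems(5) 5 by (metis coprime_iff_gcd_eq_1 gcd_add2)
    have "\<Phi> p (u + v + v) + ?x = ?w * ?y"
      using Phi_rel[of "u + v" v p] less.prems(1) by simp
    then have "cmod ?w * cmod ?y \<le> cmod (\<Phi> p (u + v + v)) + cmod ?x"
      by (metis norm_mult norm_triangle_ineq)
    moreover have "cmod ?w * 2 \<le> cmod ?w * cmod ?y"
      using xy by (intro mult_left_mono) auto
    ultimately have "cmod ?x \<le> cmod (\<Phi> p (u + v + v))" using wx by simp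
    then have "(cmod ?w / 2) ^ i * (cmod ?y / 2) ^ d \<le> cmod (\<Phi> p (lin (u + v) v (int i, int d))) / 2"
      using 5 c xy wx less.prems by (intro less.hyps) auto
    moreover have "(cmod ?x / 2) ^ i * (cmod ?y / 2) ^ j \<le> (cmod ?w / 2) ^ i * (cmod ?y / 2) ^ d"
    proof -
      have "(cmod ?x / 2) ^ i * (cmod ?y / 2) ^ j = (cmod ?x / 2 * (cmod ?y / 2)) ^ i * (cmod ?y / 2) ^ d"
        unfolding 5(1) power_add power_mult_distrib by (simp only: mult_ac)
      also have "\<dots> \<le> (cmod ?w / 2) ^ i * (cmod ?y / 2) ^ d"
        using w by (intro mult_right_mono power_mono) auto
      finally show ?thesis .
    qed
    ultimately show ?thesis using 5 lin_split(2)[of u v i d] by simp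
  qed
qed

text \<open>The neighbourhood is chosen before the bound C: larger bounds admit more slopes but do
  not shrink it.\<close>

definition tame :: "complex \<times> complex \<times> complex \<Rightarrow> int \<times> int \<Rightarrow> int \<times> int \<Rightarrow> bool" where
  "tame p u v \<longleftrightarrow> (\<exists>N. open N \<and> p \<in> N \<and> (\<forall>q\<in>N. \<forall>w\<in>cone u v. \<Phi> q w \<notin> seg) \<and>
     (\<forall>C. finite {w \<in> cone u v. \<exists>q\<in>N. cmod (\<Phi> q w) \<le> C}))"

lemma tame_swap: "tame p u v \<Longrightarrow> tame p v u"
  unfolding tame_def cone_swap[of u v] .

lemma tame_split:
  assumes "tame p u (u + v)" "tame p (u + v) v" shows "tame p u v"
proof -
  obtain N1 where N1: "open N1" "p \<in> N1" "\<forall>q\<in>N1. \<forall>w\<in>cone u (u + v). \<Phi> q w \<notin> seg"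
    "\<forall>C. finite {w \<in> cone u (u + v). \<exists>q\<in>N1. cmod (\<Phi> q w) \<le> C}" using assms(1) unfolding tame_def by blast
  obtain N2 where N2: "open N2" "p \<in> N2" "\<forall>q\<in>N2. \<forall>w\<in>cone (u + v) v. \<Phi> q w \<notin> seg"
    "\<forall>C. finite {w \<in> cone (u + v) v. \<exists>q\<in>N2. cmod (\<Phi> q w) \<le> C}" using assms(2) unfolding tame_def by blast
  show ?thesis unfolding tame_def
  proof (intro exI[of _ "N1 \<inter> N2"] conjI allI)
    fix C
    have "{w \<in> cone u v. \<exists>q\<in>N1 \<inter> N2. cmod (\<Phi> q w) \<le> C} \<subseteq>
      {w \<in> cone u (u + v). \<exists>q\<in>N1. cmod (\<Phi> q w) \<le> C} \<union> {w \<in> cone (u + v) v. \<exists>q\<in>N2. cmod (\<Phi> q w) \<le> C}"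
      using cone_split[of u v] by blast
    then show "finite {w \<in> cone u v. \<exists>q\<in>N1 \<inter> N2. cmod (\<Phi> q w) \<le> C}"
      using N1(4) N2(4) finite_subset by blast
  qed (use N1 N2 cone_split[of u v] in blast)+
qed

text \<open>The exponential bound settles both requirements for every slope except the side u, the
  only one with j = 0. The trace of u may be small, so it is required separately to avoid the
  segment.\<close>

lemma growth_tame:
  assumes "open N" "p \<in> N" "s > 1" "\<And>q. q \<in> N \<Longrightarrow> \<Phi> q u \<notin> seg"
    and gr: "\<And>q i j. q \<in> N \<Longrightarrow> coprime i j \<Longrightarrow> j \<ge> 1 \<Longrightarrow> 2 * s ^ (i + j) \<le> cmod (\<Phi> q (lin u v (int i, int j)))"
  shows "tame p u v"
  unfolding tame_def
proof (intro exI[of _ N] conjI ballI allI)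
  fix q w assume q: "q \<in> N" and "w \<in> cone u v"
  then obtain i j where w: "w = lin u v (int i, int j)" "coprime i j" by (auto simp: cone_def)
  show "\<Phi> q w \<notin> seg"
  proof (cases "j = 0")
    case True then show ?thesis using w assms(4)[OF q] by simp
  next
    case False
    then have "2 * s ^ (i + j) \<le> cmod (\<Phi> q w)" using gr[OF q w(2)] w by simp
    moreover have "s ^ (i + j) > 1" using \<open>s > 1\<close> False by (intro one_less_power) auto
    ultimately show ?thesis by (intro not_seg) simp
  qed
next
  fix C
  obtain n where n: "C < s ^ n" using real_arch_pow[OF \<open>s > 1\<close>] by blast
  have "{w \<in> cone u v. \<exists>q\<in>N. cmod (\<Phi> q w) \<le> C} \<subseteq>
     insert u ((\<lambda>(i, j). lin u v (int i, int j)) ` ({..n} \<times> {..n}))"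
  proof
    fix w assume "w \<in> {w \<in> cone u v. \<exists>q\<in>N. cmod (\<Phi> q w) \<le> C}"
    then obtain i j q where w: "w = lin u v (int i, int j)" "coprime i j" "q \<in> N" "cmod (\<Phi> q w) \<le> C"
      by (auto simp: cone_def)
    show "w \<in> insert u ((\<lambda>(i, j). lin u v (int i, int j)) ` ({..n} \<times> {..n}))"
    proof (cases "j = 0")
      case True then show ?thesis using w by simp
    next
      case False
      have "i + j < n"
      proof (rule ccontr)
        assume "\<not> i + j < n"
        then have "s ^ n \<le> s ^ (i + j)" using \<open>s > 1\<close> by (intro power_increasing) auto
        moreover have "2 * s ^ (i + j) \<le> C" using gr[OF w(3,2)] False w by simp
        moreover have "s ^ (i + j) > 0" using \<open>s > 1\<close> by simp
        ultimately show False using n by simp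
      qed
      then show ?thesis using w by force
    qed
  qed
  then show "finite {w \<in> cone u v. \<exists>q\<in>N. cmod (\<Phi> q w) \<le> C}" by (rule finite_subset) simp
qed (use assms in auto)

text \<open>All three inequalities are strict, so they persist near p with a common rate s > 1, and
  \<open>growth\<close> applies at each nearby point.\<close>

lemma increasing_tame:
  assumes det: "\<bar>det2 u v\<bar> = 1" and x: "cmod (\<Phi> p u) > 2" and y: "cmod (\<Phi> p v) > 2"
    and lt: "cmod (\<Phi> p (u - v)) < cmod (\<Phi> p (u + v))"
  shows "tame p u v"
proof -
  obtain s where s: "s > 1" "2 * s < cmod (\<Phi> p u)" "2 * s < cmod (\<Phi> p v)"
  proof -
    obtain s where "1 < s" "s < min (cmod (\<Phi> p u) / 2) (cmod (\<Phi> p v) / 2)"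
      using dense[of 1 "min (cmod (\<Phi> p u) / 2) (cmod (\<Phi> p v) / 2)"] x y by auto
    then show ?thesis using that[of s] by auto
  qed
  have pr: "prim u" "prim v" "prim (u + v)" "prim (u - v)"
    using det det2_prim[of u v] det2_prim[of u "u + v"] det2_prim[of u "u - v"] by auto
  define N where "N = {q. 2 * s < cmod (\<Phi> q u)} \<inter> {q. 2 * s < cmod (\<Phi> q v)}
    \<inter> {q. cmod (\<Phi> q (u - v)) < cmod (\<Phi> q (u + v))}"
  show ?thesis
  proof (rule growth_tame[of N _ s])
    show "open N" unfolding N_def
      by (intro open_Int open_Collect_less continuous_intros continuous_Phi pr)
    show "p \<in> N" using s lt by (simp add: N_def)
  next
    fix q i j assume q: "q \<in> N" and ij: "coprime i j" "(j::nat) \<ge> 1"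
    have "s ^ i * s ^ j \<le> (cmod (\<Phi> q u) / 2) ^ i * (cmod (\<Phi> q v) / 2) ^ j"
      using q s unfolding N_def by (intro mult_mono power_mono) auto
    also have "\<dots> \<le> cmod (\<Phi> q (lin u v (int i, int j))) / 2"
      by (rule growth) (use q s ij det in \<open>auto simp: N_def\<close>)
    finally show "2 * s ^ (i + j) \<le> cmod (\<Phi> q (lin u v (int i, int j)))" by (simp add: power_add)
  next
    fix q assume "q \<in> N" then show "\<Phi> q u \<notin> seg" using s by (intro not_seg) (simp add: N_def)
  qed (use s in simp)
qed

end

section \<open>Traces outside the segment, and fans around a fixed slope\<close>

lemma joukowski:
  assumes "x \<notin> seg"
  obtains l where "cmod l > 1" "l + 1 / l = x"
proof -
  define l where "l = (x + csqrt (x\<^sup>2 - 4)) / 2"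
  have "l * (x - l) = (x\<^sup>2 - (csqrt (x\<^sup>2 - 4))\<^sup>2) / 4"
    by (simp add: l_def field_simps power2_eq_square)
  then have e: "l * (x - l) = 1" by simp
  then have l0: "l \<noteq> 0" by auto
  then have l1: "l + 1 / l = x" using e by (simp add: field_simps)
  have "cmod l \<noteq> 1"
  proof
    assume "cmod l = 1"
    then have "l * cnj l = 1" by (simp add: complex_norm_square[symmetric])
    then have "1 / l = cnj l" using l0 by (simp add: field_simps)
    then have "x = complex_of_real (2 * Re l)" using l1 complex_add_cnj[of l] by simp
    moreover have "\<bar>Re l\<bar> \<le> 1" using abs_Re_le_cmod[of l] \<open>cmod l = 1\<close> by simp
    then have "2 * Re l \<in> {-2..2}" by auto
    ultimately show False using assms unfolding seg_def by blast
  qed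
  then have "cmod l > 1 \<or> cmod (1 / l) > 1"
    using l0 by (auto simp: norm_divide field_simps)
  then consider "cmod l > 1" | "cmod (1 / l) > 1" by blast
  then show ?thesis
  proof cases
    case 1 then show ?thesis using that l1 by blast
  next
    case 2 then show ?thesis using that[of "1 / l"] l1 l0 by (simp add: add.commute)
  qed
qed

lemma parallelogram: "(cmod (x - y))\<^sup>2 + (cmod (x + y))\<^sup>2 = 2 * (cmod x)\<^sup>2 + 2 * (cmod y)\<^sup>2"
  unfolding cmod_power2 by (simp add: power2_eq_square algebra_simps)

text \<open>If the sum of two numbers of modulus about 2 has modulus about 4, they are nearly equal;
  applied to \<open>x w = x' + y\<close> and \<open>w x' = t + x\<close> this forces \<open>w\<close> to be near \<open>\<plusminus>2\<close> and \<open>x'\<close> near \<open>\<plusminus>x\<close>.\<close>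

lemma kappa_near_4:
  fixes x y w x' t :: complex
  assumes d: "0 < d" "d \<le> 1"
    and lo: "cmod x \<ge> 2" "cmod w \<ge> 2" "cmod x' \<ge> 2"
    and hi: "cmod x \<le> 2 + d" "cmod y \<le> 2 + d" "cmod w \<le> 2 + d" "cmod x' \<le> 2 + d" "cmod t \<le> 2 + d"
    and r1: "x * w = x' + y" and r2: "w * x' = t + x"
  shows "(cmod (x\<^sup>2 + w\<^sup>2 + x'\<^sup>2 - x * w * x' - 4))\<^sup>2 \<le> 720 * d"
proof -
  have close: "(cmod (p - q))\<^sup>2 \<le> 20 * d"
    if "cmod (p + q) \<ge> 4" "cmod p \<le> 2 + d" "cmod q \<le> 2 + d" for p q
  proof -
    have "(cmod p)\<^sup>2 \<le> (2 + d)\<^sup>2" "(cmod q)\<^sup>2 \<le> (2 + d)\<^sup>2" "4\<^sup>2 \<le> (cmod (p + q))\<^sup>2"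
      using that by (intro power_mono; simp)+
    then have "(cmod (p - q))\<^sup>2 \<le> 4 * (2 + d)\<^sup>2 - 16" using parallelogram[of p q] by simp
    also have "\<dots> = 16 * d + 4 * (d * d)" by (simp add: power2_eq_square algebra_simps)
    also have "\<dots> \<le> 20 * d" using d mult_right_le_one_le[of d d] by simp
    finally show ?thesis .
  qed
  have "2 * 2 \<le> cmod x * cmod w" using lo by (intro mult_mono) auto
  then have e1: "(cmod (y - x'))\<^sup>2 \<le> 20 * d"
    using close[of y x'] hi r1 by (simp add: norm_mult[symmetric] add.commute)
  have "2 * 2 \<le> cmod w * cmod x'" using lo by (intro mult_mono) auto
  then have e2: "(cmod (t - x))\<^sup>2 \<le> 20 * d"
    using close[of t x] hi r2 by (simp add: norm_mult[symmetric])
  define h where "h = sqrt (20 * d)"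
  have h: "h \<ge> 0" "h\<^sup>2 = 20 * d" using d by (auto simp: h_def)
  have e1': "cmod (y - x') \<le> h" and e2': "cmod (t - x) \<le> h"
    using e1 e2 unfolding h_def by (auto intro: real_le_rsqrt)
  \<comment> \<open>Obtained from r2 multiplied by w. Both defects y - x' and t - x are at most h,
    and x' has modulus at least 2, so the square of w is near 4.\<close>
  have "(w\<^sup>2 - 4) * x' = 2 * (y - x') + (t - x) * w"
  proof -
    have "(w\<^sup>2 - 4) * x' = w * (w * x') - 4 * x'" by (simp add: power2_eq_square algebra_simps)
    also have "\<dots> = 2 * (x * w) + (t - x) * w - 4 * x'" unfolding r2 by (simp add: algebra_simps)
    also have "\<dots> = 2 * (y - x') + (t - x) * w" unfolding r1 by (simp add: algebra_simps)
    finally show ?thesis .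
  qed
  then have "cmod (w\<^sup>2 - 4) * cmod x' \<le> cmod (2 * (y - x')) + cmod ((t - x) * w)"
    by (metis norm_mult norm_triangle_ineq)
  also have "\<dots> \<le> 2 * h + h * 3"
  proof -
    have "cmod ((t - x) * w) \<le> h * 3"
      unfolding norm_mult using e2' hi d h by (intro mult_mono) auto
    moreover have "cmod (2 * (y - x')) \<le> 2 * h" unfolding norm_mult using e1' by simp
    ultimately show ?thesis by simp
  qed
  finally have "cmod (w\<^sup>2 - 4) * 2 \<le> 5 * h"
    using lo(3) mult_left_mono[OF lo(3), of "cmod (w\<^sup>2 - 4)"] by simp
  moreover have "x\<^sup>2 + w\<^sup>2 + x'\<^sup>2 - x * w * x' - 4 = (w\<^sup>2 - 4) - ((y - x') * x' + (t - x) * x) / 2"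
  proof -
    have "x * w * x' * 2 = (x * w) * x' + x * (w * x')" by (simp add: algebra_simps)
    also have "\<dots> = 2 * x'\<^sup>2 + 2 * x\<^sup>2 + (y - x') * x' + (t - x) * x"
      unfolding r1 r2 by (simp add: algebra_simps power2_eq_square)
    finally have "x * w * x' = x'\<^sup>2 + x\<^sup>2 + ((y - x') * x' + (t - x) * x) / 2"
      by (simp add: field_simps)
    then show ?thesis by simp
  qed
  moreover have "cmod (((y - x') * x' + (t - x) * x) / 2) \<le> 3 * h"
  proof -
    have "cmod ((y - x') * x' + (t - x) * x) \<le> cmod ((y - x') * x') + cmod ((t - x) * x)"
      by (rule norm_triangle_ineq)
    also have "\<dots> \<le> h * 3 + h * 3"
      unfolding norm_mult using e1' e2' hi d h by (intro add_mono mult_mono) auto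
    finally show ?thesis by simp
  qed
  moreover have "cmod ((w\<^sup>2 - 4) - ((y - x') * x' + (t - x) * x) / 2)
      \<le> cmod (w\<^sup>2 - 4) + cmod (((y - x') * x' + (t - x) * x) / 2)" by (rule norm_triangle_ineq4)
  ultimately have "cmod (w\<^sup>2 - 4 - ((y - x') * x' + (t - x) * x) / 2) \<le> 5 * h / 2 + 3 * h"
    and eq: "x\<^sup>2 + w\<^sup>2 + x'\<^sup>2 - x * w * x' - 4 = (w\<^sup>2 - 4) - ((y - x') * x' + (t - x) * x) / 2"
    by (linarith, blast)
  then have "cmod (x\<^sup>2 + w\<^sup>2 + x'\<^sup>2 - x * w * x' - 4) \<le> 5 * h / 2 + 3 * h"
    by (simp only: eq)
  \<comment> \<open>5/2 + 3 is rounded up to 6, and \<open>6\<^sup>2 * 20 = 720\<close>.\<close>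
  then have "cmod (x\<^sup>2 + w\<^sup>2 + x'\<^sup>2 - x * w * x' - 4) \<le> 6 * h" using h by simp
  then have "(cmod (x\<^sup>2 + w\<^sup>2 + x'\<^sup>2 - x * w * x' - 4))\<^sup>2 \<le> (6 * h)\<^sup>2" by (intro power_mono) auto
  also have "\<dots> = 720 * d" using h by (simp add: power_mult_distrib)
  finally show ?thesis .
qed

text \<open>The vectors v + k u. For a basis (u, v) these are the neighbours of the slope u on one
  side, and k to k + 1 is the Dehn twist about u.\<close>

definition fan :: "int \<times> int \<Rightarrow> int \<times> int \<Rightarrow> nat \<Rightarrow> int \<times> int" where
  "fan u v k = lin u v (int k, 1)"

lemma fan_0 [simp]: "fan u v 0 = v"
  by (simp add: fan_def)

lemma fan_Suc: "fan u v (Suc k) = u + fan u v k"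
  by (simp add: fan_def lin_def algebra_simps prod_eq_iff)

lemma det2_fan [simp]: "det2 u (fan u v k) = det2 u v"
  by (induction k) (simp_all add: fan_Suc)

context trace_family
begin

lemma Phi_fan:
  assumes "\<bar>det2 u v\<bar> = 1"
  shows "\<Phi> p (fan u v (Suc (Suc k))) = \<Phi> p u * \<Phi> p (fan u v (Suc k)) - \<Phi> p (fan u v k)"
proof -
  have "\<Phi> p (u + fan u v (Suc k)) + \<Phi> p (u - fan u v (Suc k)) = \<Phi> p u * \<Phi> p (fan u v (Suc k))"
    by (rule Phi_rel) (use assms in simp)
  moreover have "u - fan u v (Suc k) = - fan u v k" by (simp add: fan_Suc)
  ultimately show ?thesis by (simp add: fan_Suc algebra_simps del: minus_add_distrib)
qed

text \<open>Apart from u, the cone of u and v is the union of the cones of consecutive members of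
  the fan; \<open>growth\<close> is applied to the one containing the slope. Consecutive members
  differ by u, so the condition on the trace of u is the comparison of sum and difference that
  \<open>growth\<close> asks for.\<close>

lemma fan_growth:
  assumes det: "\<bar>det2 u v\<bar> = 1" and s: "s > 1"
    and y: "\<And>k. 2 * s ^ (k + 1) \<le> cmod (\<Phi> q (fan u v k))"
    and x: "\<And>k. 2 * cmod (\<Phi> q u) \<le> cmod (\<Phi> q (fan u v k)) * cmod (\<Phi> q (fan u v (Suc k)))"
    and ij: "coprime i j" "j \<ge> 1"
  shows "2 * s ^ (i + j) \<le> cmod (\<Phi> q (lin u v (int i, int j)))"
proof -
  \<comment> \<open>The slope lies between the members n and n + 1 of the fan, with coefficients j -
    r and r.\<close>
  define n r where "n = i div j" and "r = i mod j"
  have i: "i = n * j + r" and r: "r < j" using ij by (auto simp: n_def r_def)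
  let ?Y = "fan u v n" and ?Z = "fan u v (Suc n)"
  have eq: "lin u v (int i, int j) = lin ?Y ?Z (int (j - r), int r)"
    using r unfolding i by (simp add: fan_def lin_def of_nat_diff algebra_simps)
  have d: "\<bar>det2 ?Y ?Z\<bar> = 1" using det det2_swap[of "fan u v n" u] by (simp add: fan_Suc)
  have sp: "s ^ (k + 1) > 1" for k using s by (intro one_less_power) auto
  have big: "cmod (\<Phi> q (fan u v k)) > 2" for k using y[of k] sp[of k] by linarith
  have le: "cmod (\<Phi> q (?Y - ?Z)) \<le> cmod (\<Phi> q (?Y + ?Z))"
  proof -
    have "?Y - ?Z = - u" by (simp add: fan_Suc)
    then have "\<Phi> q (?Y + ?Z) + \<Phi> q u = \<Phi> q ?Y * \<Phi> q ?Z" using Phi_rel[OF d, of q] by simp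
    then have "cmod (\<Phi> q ?Y) * cmod (\<Phi> q ?Z) \<le> cmod (\<Phi> q (?Y + ?Z)) + cmod (\<Phi> q u)"
      by (metis norm_mult norm_triangle_ineq)
    then show ?thesis using x[of n] \<open>?Y - ?Z = - u\<close> by simp
  qed
  have cop: "coprime (j - r) r"
  proof -
    have "coprime r j" using ij(1) unfolding r_def
      by (metis coprime_iff_gcd_eq_1 gcd.commute gcd_red_nat)
    then show ?thesis using r by (metis coprime_commute coprime_iff_gcd_eq_1 gcd_diff1_nat less_imp_le)
  qed
  have "(s ^ (n + 1)) ^ (j - r) * (s ^ (Suc n + 1)) ^ r
      \<le> (cmod (\<Phi> q ?Y) / 2) ^ (j - r) * (cmod (\<Phi> q ?Z) / 2) ^ r"
    using y[of n] y[of "Suc n"] s by (intro mult_mono power_mono) auto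
  also have "\<dots> \<le> cmod (\<Phi> q (lin ?Y ?Z (int (j - r), int r))) / 2"
    by (rule growth[OF d big big le cop])
  finally have "(s ^ (n + 1)) ^ (j - r) * (s ^ (Suc n + 1)) ^ r \<le> cmod (\<Phi> q (lin u v (int i, int j))) / 2"
    by (simp only: eq)
  moreover have "(s ^ (n + 1)) ^ (j - r) * (s ^ (Suc n + 1)) ^ r = s ^ ((n + 1) * (j - r) + (Suc n + 1) * r)"
    by (simp only: power_mult power_add)
  \<comment> \<open>Member k has exponent k + 1, and with this offset the exponents add up to i + j
    exactly.\<close>
  moreover have "(n + 1) * (j - r) + (Suc n + 1) * r = i + j"
  proof -
    obtain m where "j = r + m" using r less_imp_add_positive by blast
    then show ?thesis unfolding i by (simp add: algebra_simps)
  qed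
  ultimately show ?thesis by simp
qed

text \<open>At p the recurrence divides the defect y (k + 1) - l y k by l in each step. At a nearby
  q, with l still taken from p, there is an additional error proportional to y (k + 1). If it is
  small, the bound (|l| - s) |y k| for the defect reproduces itself, and this bound implies growth
  at rate s.\<close>

lemma fan_tame:
  assumes det: "\<bar>det2 u v\<bar> = 1" and l: "cmod l > 1" "l + 1 / l = \<Phi> p u" and ns: "\<Phi> p u \<notin> seg"
    and s: "1 < s" "s < cmod l"
    and near: "cmod (\<Phi> p (u + v) - l * \<Phi> p v) < (cmod l - s) * cmod (\<Phi> p v)"
    and big: "2 * s < cmod (\<Phi> p v)" "2 * cmod (\<Phi> p u) < (cmod (\<Phi> p v))\<^sup>2"
  shows "tame p u v"
proof -
  have pr: "prim u" "prim v" "prim (u + v)"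
    using det det2_prim[of u v] det2_prim[of u "u + v"] by auto
  define r where "r = cmod l"
  have rs: "r * s > 1" using s l unfolding r_def by (metis less_1_mult)
  \<comment> \<open>Exactly the room that the contraction leaves:
    \<open>e + (r - s) / (r * s) = r - s\<close>.\<close>
  define e where "e = (r - s) * (1 - 1 / (r * s))"
  have e: "e > 0" unfolding e_def using s rs r_def by (intro mult_pos_pos) auto
  define N where "N = {q. cmod (\<Phi> q u - \<Phi> p u) < e} \<inter>
     {q. cmod (\<Phi> q (u + v) - l * \<Phi> q v) < (r - s) * cmod (\<Phi> q v)} \<inter>
     {q. 2 * s < cmod (\<Phi> q v)} \<inter> {q. 2 * cmod (\<Phi> q u) < (cmod (\<Phi> q v))\<^sup>2} \<inter> (\<lambda>q. \<Phi> q u) -` (- seg)"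
  show ?thesis
  proof (rule growth_tame[of N _ s])
    show "open N" unfolding N_def
      by (intro open_Int open_Collect_less continuous_intros continuous_Phi pr open_vimage
          open_Compl closed_seg)
    show "p \<in> N" using near big e ns by (simp add: N_def r_def)
    show "s > 1" by fact
    fix q assume q: "q \<in> N"
    show "\<Phi> q u \<notin> seg" using q by (simp add: N_def)
    let ?y = "\<lambda>k. \<Phi> q (fan u v k)"
    have q2: "2 * s < cmod (?y 0)" using q by (simp add: N_def)
    have inv: "cmod (?y (Suc k) - l * ?y k) \<le> (r - s) * cmod (?y k) \<and>
        2 * s ^ (k + 1) \<le> cmod (?y k) \<and> cmod (?y 0) \<le> cmod (?y k)" for k
    proof (induction k)
      case 0
      show ?case using q by (simp add: N_def fan_Suc[of u v 0, simplified])
    next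
      case (Suc k)
      have "r * cmod (?y k) = cmod (l * ?y k)" by (simp add: r_def norm_mult)
      also have "\<dots> \<le> cmod (?y (Suc k)) + cmod (?y (Suc k) - l * ?y k)"
        using norm_triangle_sub[of "l * ?y k" "?y (Suc k)"] by (simp add: norm_minus_commute)
      finally have g: "s * cmod (?y k) \<le> cmod (?y (Suc k))" using Suc.IH by (simp add: algebra_simps)
      have b1: "2 * s ^ (Suc k + 1) \<le> cmod (?y (Suc k))"
      proof -
        have "2 * s ^ (Suc k + 1) = s * (2 * s ^ (k + 1))" by simp
        also have "\<dots> \<le> s * cmod (?y k)" using Suc.IH s by (intro mult_left_mono) auto
        finally show ?thesis using g by simp
      qed
      have b2: "cmod (?y 0) \<le> cmod (?y (Suc k))"
      proof -
        have "1 * cmod (?y k) \<le> s * cmod (?y k)" using s by (intro mult_right_mono) auto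
        then show ?thesis using g Suc.IH by simp
      qed
      have l0: "l \<noteq> 0" using l by auto
      have "?y (Suc (Suc k)) - l * ?y (Suc k) = (\<Phi> q u - \<Phi> p u) * ?y (Suc k) + (?y (Suc k) - l * ?y k) / l"
        unfolding Phi_fan[OF det] l(2)[symmetric] using l0 by (simp add: field_simps)
      then have "cmod (?y (Suc (Suc k)) - l * ?y (Suc k)) \<le>
          cmod ((\<Phi> q u - \<Phi> p u) * ?y (Suc k)) + cmod ((?y (Suc k) - l * ?y k) / l)"
        by (metis norm_triangle_ineq)
      also have "\<dots> \<le> e * cmod (?y (Suc k)) + ((r - s) * cmod (?y k)) / r"
        unfolding norm_mult norm_divide r_def[symmetric]
        using Suc.IH q l by (intro add_mono mult_right_mono divide_right_mono) (auto simp: N_def r_def)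
      also have "\<dots> \<le> e * cmod (?y (Suc k)) + ((r - s) * (cmod (?y (Suc k)) / s)) / r"
        using g s l by (intro add_left_mono divide_right_mono mult_left_mono)
          (auto simp: r_def field_simps)
      also have "\<dots> = (r - s) * cmod (?y (Suc k))"
        using s l unfolding e_def by (simp add: field_simps r_def)
      finally show ?case using b1 b2 by simp
    qed
    fix i j :: nat assume ij: "coprime i j" "j \<ge> 1"
    show "2 * s ^ (i + j) \<le> cmod (\<Phi> q (lin u v (int i, int j)))"
    proof (rule fan_growth[OF det s(1) _ _ ij])
      show "2 * cmod (\<Phi> q u) \<le> cmod (?y k) * cmod (?y (Suc k))" for k
      proof -
        have "cmod (?y 0) * cmod (?y 0) \<le> cmod (?y k) * cmod (?y (Suc k))"
          using inv[of k] inv[of "Suc k"] by (intro mult_mono) auto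
        moreover have "2 * cmod (\<Phi> q u) < cmod (?y 0) * cmod (?y 0)"
          using q by (simp add: N_def power2_eq_square)
        ultimately show ?thesis by simp
      qed
    qed (use inv in blast)
  qed
qed

lemma joukowski_diff_nonzero:
  assumes "cmod l > 1" shows "l - 1 / l \<noteq> 0"
proof
  assume "l - 1 / l = 0"
  moreover have "l \<noteq> 0" using assms by auto
  ultimately have "l * l = 1" by (simp add: field_simps)
  then have "cmod l * cmod l = 1" by (metis norm_mult norm_one)
  then show False using less_1_mult[OF assms assms] by simp
qed

text \<open>l and 1 / l are the roots of the recurrence; e and d measure the growing and the
  decaying solution in the fan, and the factor l - 1 / l comes from eliminating y (k + 1).\<close>

lemma fan_formula:
  assumes det: "\<bar>det2 u v\<bar> = 1" and l: "cmod l > 1" "l + 1 / l = \<Phi> p u"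
  defines "d \<equiv> \<Phi> p (u + v) - l * \<Phi> p v" and "e \<equiv> \<Phi> p (u + v) - \<Phi> p v / l"
  shows "\<Phi> p (fan u v (Suc k)) - l * \<Phi> p (fan u v k) = d / l ^ k"
    and "\<Phi> p (fan u v k) * (l - 1 / l) = e * l ^ k - d / l ^ k"
proof -
  have l0: "l \<noteq> 0" using l by auto
  let ?y = "\<lambda>k. \<Phi> p (fan u v k)"
  have dk: "?y (Suc k) - l * ?y k = d / l ^ k" for k
  proof (induction k)
    case (Suc k)
    have "?y (Suc (Suc k)) - l * ?y (Suc k) = (?y (Suc k) - l * ?y k) / l"
      unfolding Phi_fan[OF det] l(2)[symmetric] using l0 by (simp add: field_simps)
    then show ?case using Suc l0 by simp
  qed (simp add: d_def fan_Suc)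
  have ek: "?y (Suc k) - ?y k / l = e * l ^ k" for k
  proof (induction k)
    case (Suc k)
    have "?y (Suc (Suc k)) - ?y (Suc k) / l = l * (?y (Suc k) - ?y k / l)"
      unfolding Phi_fan[OF det] l(2)[symmetric] using l0 by (simp add: field_simps)
    then show ?case using Suc l0 by simp
  qed (simp add: e_def fan_Suc)
  show "?y (Suc k) - l * ?y k = d / l ^ k" by (rule dk)
  show "?y k * (l - 1 / l) = e * l ^ k - d / l ^ k"
    unfolding dk[symmetric] ek[symmetric] by (simp add: algebra_simps)
qed

lemma fan_unbounded:
  assumes det: "\<bar>det2 u v\<bar> = 1" and l: "cmod l > 1" "l + 1 / l = \<Phi> p u"
    and ne: "\<Phi> p (u + v) \<noteq> \<Phi> p v / l"
  shows "\<exists>k. K < cmod (\<Phi> p (fan u v k))"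
proof -
  let ?y = "\<lambda>k. \<Phi> p (fan u v k)"
  define d where "d = \<Phi> p (u + v) - l * \<Phi> p v"
  define e where "e = \<Phi> p (u + v) - \<Phi> p v / l"
  note yk = fan_formula(2)[OF det l, folded d_def e_def]
  have e: "e \<noteq> 0" using ne by (simp add: e_def)
  have ll: "l - 1 / l \<noteq> 0" using joukowski_diff_nonzero[OF l(1)] .
  obtain k where k: "(K * cmod (l - 1 / l) + cmod d) / cmod e < cmod l ^ k"
    using real_arch_pow[OF l(1)] by blast
  have lk: "cmod l ^ k \<ge> 1" using l by simp
  have "K * cmod (l - 1 / l) + cmod d < cmod e * cmod l ^ k"
    using k e by (simp add: field_simps)
  also have "\<dots> = cmod (?y k * (l - 1 / l) + d / l ^ k)"
    using yk[of k] by (simp add: norm_mult norm_power)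
  also have "\<dots> \<le> cmod (?y k) * cmod (l - 1 / l) + cmod d / cmod l ^ k"
    using norm_triangle_ineq[of "?y k * (l - 1 / l)" "d / l ^ k"]
    by (simp add: norm_mult norm_divide norm_power)
  also have "\<dots> \<le> cmod (?y k) * cmod (l - 1 / l) + cmod d"
    using lk by (simp add: divide_le_eq mult_le_cancel_left1)
  finally have "K < cmod (?y k)" using ll by simp
  then show ?thesis by blast
qed

text \<open>Without a growing component the fan tends to 0. Otherwise its members exceed every
  constant while the defect stays bounded, so far out in the fan the assumptions of
  \<open>fan_tame\<close> hold.\<close>

lemma fan_dichotomy:
  assumes det: "\<bar>det2 u v\<bar> = 1" and ns: "\<Phi> p u \<notin> seg"
  shows "(\<exists>k. tame p u (fan u v k)) \<or> (\<lambda>k. \<Phi> p (fan u v k)) \<longlonglongrightarrow> 0"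
proof -
  obtain l where l: "cmod l > 1" "l + 1 / l = \<Phi> p u" using joukowski[OF ns] by blast
  have ll: "l - 1 / l \<noteq> 0" using joukowski_diff_nonzero[OF l(1)] .
  let ?y = "\<lambda>k. \<Phi> p (fan u v k)"
  define d where "d = \<Phi> p (u + v) - l * \<Phi> p v"
  define e where "e = \<Phi> p (u + v) - \<Phi> p v / l"
  note fan_formula = fan_formula[OF det l, folded d_def e_def]
  show ?thesis
  proof (cases "e = 0")
    case True
    have "?y = (\<lambda>k. (- d / (l - 1 / l)) * (1 / l) ^ k)"
    proof
      fix k
      have "?y k = (- d / l ^ k) / (l - 1 / l)"
        using fan_formula(2)[of k] True ll by (simp only: eq_divide_eq) simp
      then show "?y k = (- d / (l - 1 / l)) * (1 / l) ^ k"
        by (simp add: power_one_over mult.commute)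
    qed
    moreover have "(\<lambda>k. (- d / (l - 1 / l)) * (1 / l) ^ k) \<longlonglongrightarrow> (- d / (l - 1 / l)) * 0"
      using l(1) by (intro tendsto_mult tendsto_const LIMSEQ_power_zero) (simp add: norm_divide divide_less_eq)
    ultimately show ?thesis by (simp only: mult_zero_right) blast
  next
    case False
    define s where "s = (1 + cmod l) / 2"
    have s: "1 < s" "s < cmod l" using l(1) by (auto simp: s_def)
    \<comment> \<open>One summand for each assumption of \<open>fan_tame\<close>; K \<ge> 1 turns
      the bound for |y| into the one for its square.\<close>
    define K where "K = 2 * s + cmod d / (cmod l - s) + 2 * cmod (\<Phi> p u) + 1"
    obtain k where K: "K < cmod (?y k)"
      using fan_unbounded[OF det l, of K] False by (auto simp: e_def)
    have lk: "cmod l ^ k \<ge> 1" using l by simp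
    have K3: "2 * s \<le> K" "cmod d / (cmod l - s) < K" "2 * cmod (\<Phi> p u) \<le> K" "1 \<le> K"
      using s by (auto simp: K_def intro!: add_nonneg_nonneg add_strict_increasing2)
    have "tame p u (fan u v k)"
    proof (rule fan_tame[OF _ l ns s])
      show "cmod (\<Phi> p (u + fan u v k) - l * ?y k) < (cmod l - s) * cmod (?y k)"
      proof -
        have "cmod (?y (Suc k) - l * ?y k) = cmod d / cmod l ^ k"
          by (simp only: fan_formula(1) norm_divide norm_power)
        also have "\<dots> \<le> cmod d" using lk by (simp add: divide_le_eq mult_le_cancel_left1)
        also have "\<dots> < (cmod l - s) * K" using K3(2) s by (simp add: field_simps)
        also have "\<dots> \<le> (cmod l - s) * cmod (?y k)" using K s by (intro mult_left_mono) auto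
        finally show ?thesis by (simp only: fan_Suc)
      qed
      show "2 * cmod (\<Phi> p u) < (cmod (?y k))\<^sup>2"
      proof -
        have "K * 1 < cmod (?y k) * cmod (?y k)"
          using K K3 by (intro mult_less_le_imp_less) auto
        then show ?thesis using K3 by (simp add: power2_eq_square)
      qed
    qed (use det K K3 in auto)
    then show ?thesis by blast
  qed
qed

subsection \<open>Infinite descending paths\<close>

text \<open>A path down the Farey tree; \<open>b n\<close> says that the step keeps the side U and
  replaces V by the mediant.\<close>

definition descent :: "(nat \<Rightarrow> int \<times> int) \<Rightarrow> (nat \<Rightarrow> int \<times> int) \<Rightarrow> (nat \<Rightarrow> bool) \<Rightarrow> bool" where
  "descent U V b \<longleftrightarrow> (\<forall>n. det2 (U n) (V n) = 1 \<and>
     (b n \<longrightarrow> U (Suc n) = U n \<and> V (Suc n) = U n + V n) \<and>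
     (\<not> b n \<longrightarrow> U (Suc n) = U n + V n \<and> V (Suc n) = V n))"

lemma descent_shift: "descent U V b \<Longrightarrow> descent (\<lambda>n. U (n + m)) (\<lambda>n. V (n + m)) (\<lambda>n. b (n + m))"
  by (simp add: descent_def)

lemma descent_exists:
  assumes det: "det2 u v = 1" and bad: "bad u v"
    and split: "\<And>u v. det2 u v = 1 \<Longrightarrow> bad u v \<Longrightarrow> bad u (u + v) \<or> bad (u + v) v"
  obtains U V b where "descent U V b" "U 0 = u" "V 0 = v" "\<And>n. bad (U n) (V n)"
proof -
  define step where "step = (\<lambda>(w :: (int \<times> int) \<times> (int \<times> int)).
    if bad (fst w) (fst w + snd w) then (fst w, fst w + snd w) else (fst w + snd w, snd w))"
  define S where "S n = (step ^^ n) (u, v)" for n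
  have S: "det2 (fst (S n)) (snd (S n)) = 1 \<and> bad (fst (S n)) (snd (S n))" for n
  proof (induction n)
    case (Suc n)
    then show ?case using split[of "fst (S n)" "snd (S n)"] by (auto simp: S_def step_def)
  qed (simp add: S_def det bad)
  have "descent (\<lambda>n. fst (S n)) (\<lambda>n. snd (S n)) (\<lambda>n. bad (fst (S n)) (fst (S n) + snd (S n)))"
    using S unfolding descent_def by (simp add: S_def step_def)
  then show ?thesis using that[of "\<lambda>n. fst (S n)" "\<lambda>n. snd (S n)"] S by (simp add: S_def)
qed

lemma descent_const:
  assumes "descent U V b"
  shows "(\<And>n. b n) \<Longrightarrow> U k = U 0 \<and> V k = fan (U 0) (V 0) k"
    and "(\<And>n. \<not> b n) \<Longrightarrow> V k = V 0 \<and> U k = fan (V 0) (U 0) k"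
proof -
  show "U k = U 0 \<and> V k = fan (U 0) (V 0) k" if "\<And>n. b n"
    using assms that by (induction k) (auto simp: descent_def fan_Suc)
  show "V k = V 0 \<and> U k = fan (V 0) (U 0) k" if "\<And>n. \<not> b n"
    using assms that by (induction k) (auto simp: descent_def fan_Suc add.commute)
qed

lemma infinite_switches:
  fixes b :: "nat \<Rightarrow> bool"
  assumes "\<And>n. \<exists>m\<ge>n. b m" "\<And>n. \<exists>m\<ge>n. \<not> b m"
  shows "\<exists>m\<ge>n. b m \<and> \<not> b (Suc m)"
proof (rule ccontr)
  assume *: "\<not> ?thesis"
  obtain m where m: "m \<ge> n" "b m" using assms(1) by blast
  have "b (m + k)" for k using * m by (induction k) auto
  then show False using assms(2)[of m] by (metis le_Suc_ex)
qed

text \<open>Since the sum never exceeds the difference, the logarithms of half the moduli at U and V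
  add up to at most that at U - V. One step later this difference is, up to sign, the side just
  dropped. So each step lowers \<sigma> by at least the logarithm K of the side kept, and K tends to
  0 because \<sigma> stays positive. At a change of the kept side \<sigma> is the sum of two
  consecutive values of K, so it tends to 0 as well, and all traces involved approach modulus
  2.\<close>

lemma descent_big_imp_kappa:
  assumes descent: "descent U V b" and inf: "\<And>n. \<exists>m\<ge>n. b m" "\<And>n. \<exists>m\<ge>n. \<not> b m"
    and big: "\<And>n. cmod (\<Phi> p (U n)) > 2" "\<And>n. cmod (\<Phi> p (V n)) > 2"
    and le: "\<And>n. cmod (\<Phi> p (U n + V n)) \<le> cmod (\<Phi> p (U n - V n))"
  shows "kappa p = 4"
proof (rule ccontr)
  assume k4: "kappa p \<noteq> 4"
  define L where "L w = ln (cmod (\<Phi> p w) / 2)" for w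
  have L_uminus: "L (- w) = L w" for w by (simp add: L_def)
  define \<sigma> where "\<sigma> n = L (U n) + L (V n)" for n
  define K where "K n = (if b n then L (U n) else L (V n))" for n
  have step: "det2 (U n) (V n) = 1" "b n \<Longrightarrow> U (Suc n) = U n \<and> V (Suc n) = U n + V n"
    "\<not> b n \<Longrightarrow> U (Suc n) = U n + V n \<and> V (Suc n) = V n" for n
    using descent by (auto simp: descent_def)
  have Lpos: "L (U n) > 0" "L (V n) > 0" for n using big[of n] unfolding L_def by (auto intro!: ln_gt_zero)
  have Lz: "\<sigma> n \<le> L (U n - V n)" for n
  proof -
    let ?x = "\<Phi> p (U n)" and ?y = "\<Phi> p (V n)" and ?z = "\<Phi> p (U n - V n)"
    have "cmod (?x * ?y) \<le> cmod (\<Phi> p (U n + V n)) + cmod ?z"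
      using Phi_rel1[OF step(1)[of n], of p] norm_triangle_ineq by metis
    then have *: "cmod ?x / 2 * (cmod ?y / 2) \<le> cmod ?z / 2" using le[of n] by (simp add: norm_mult)
    have pos: "cmod ?x / 2 > 0" "cmod ?y / 2 > 0" using big[of n] by auto
    have "\<sigma> n = ln (cmod ?x / 2 * (cmod ?y / 2))"
      unfolding \<sigma>_def L_def by (rule ln_mult_pos[symmetric]) (use pos in auto)
    also have "\<dots> \<le> ln (cmod ?z / 2)" using * pos mult_pos_pos[OF pos]
      by (intro ln_mono) linarith+
    finally show ?thesis by (simp add: L_def)
  qed
  have dec: "K n \<le> \<sigma> n - \<sigma> (Suc n)" for n
  proof (cases "b n")
    case True
    then have "U (Suc n) - V (Suc n) = - V n" using step(2)[of n] by simp
    then have "\<sigma> (Suc n) \<le> L (V n)" using Lz[of "Suc n"] L_uminus by metis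
    then show ?thesis using True by (simp add: K_def \<sigma>_def)
  next
    case False
    then have "U (Suc n) - V (Suc n) = U n" using step(3)[of n] by simp
    then have "\<sigma> (Suc n) \<le> L (U n)" using Lz[of "Suc n"] by metis
    then show ?thesis using False by (simp add: K_def \<sigma>_def)
  qed
  have Kpos: "K n > 0" for n using Lpos by (simp add: K_def)
  have decs: "decseq \<sigma>" using dec Kpos by (intro decseq_SucI) (smt (verit))
  have pos: "\<sigma> n > 0" for n using Lpos[of n] by (simp add: \<sigma>_def)
  obtain L0 where lim: "\<sigma> \<longlonglongrightarrow> L0"
    using decseq_convergent[OF decs, of 0] pos by (metis less_imp_le)
  have "(\<lambda>n. \<sigma> n - \<sigma> (Suc n)) \<longlonglongrightarrow> L0 - L0" by (intro tendsto_diff lim LIMSEQ_Suc)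
  then have K0: "K \<longlonglongrightarrow> 0"
    by (intro tendsto_sandwich[where f = "\<lambda>_. 0" and g = K and h = "\<lambda>n. \<sigma> n - \<sigma> (Suc n)"])
      (use Kpos dec in \<open>auto simp: less_imp_le\<close>)
  have small: "\<exists>n0. \<forall>n\<ge>n0. \<sigma> n < \<epsilon>" if "\<epsilon> > 0" for \<epsilon>
  proof -
    have "\<forall>\<^sub>F n in sequentially. K n < \<epsilon> / 2" using K0 that by (intro order_tendstoD(2)) auto
    then obtain n0 where n0: "\<And>n. n \<ge> n0 \<Longrightarrow> K n < \<epsilon> / 2" by (auto simp: eventually_sequentially)
    obtain m where m: "m \<ge> n0" "b m" "\<not> b (Suc m)" using infinite_switches[OF inf] by blast
    have "\<sigma> (Suc m) = K m + K (Suc m)" using m step(2)[of m] by (simp add: \<sigma>_def K_def)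
    then have "\<sigma> (Suc m) < \<epsilon>" using n0[of m] n0[of "Suc m"] m by simp
    then show ?thesis using decs unfolding decseq_def by (meson le_less_trans)
  qed
  define c where "c = cmod (kappa p - 4)"
  have c: "c > 0" using k4 by (simp add: c_def)
  \<comment> \<open>Any number above the 720 of \<open>kappa_near_4\<close> could replace
    1000.\<close>
  define d where "d = min 1 (c\<^sup>2 / 1000)"
  have d: "0 < d" "d \<le> 1" "1000 * d \<le> c\<^sup>2" using c by (auto simp: d_def)
  obtain n0 where n0: "\<And>n. n \<ge> n0 \<Longrightarrow> \<sigma> n < ln (1 + d / 2)"
    using small[of "ln (1 + d / 2)"] d by auto
  have near: "cmod (\<Phi> p (U n)) \<le> 2 + d" "cmod (\<Phi> p (V n)) \<le> 2 + d" if "n \<ge> n0" for n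
  proof -
    have "L (U n) < ln (1 + d / 2)" "L (V n) < ln (1 + d / 2)"
      using n0[OF that] Lpos[of n] by (auto simp: \<sigma>_def)
    then show "cmod (\<Phi> p (U n)) \<le> 2 + d" "cmod (\<Phi> p (V n)) \<le> 2 + d"
      using big[of n] d ln_less_cancel_iff[of "cmod (\<Phi> p (U n)) / 2" "1 + d / 2"]
        ln_less_cancel_iff[of "cmod (\<Phi> p (V n)) / 2" "1 + d / 2"]
      unfolding L_def by linarith+
  qed
  \<comment> \<open>Three consecutive pairs around a change of side supply the traces x, y, w, x' of
    \<open>kappa_near_4\<close>; the fifth, t, is a mediant and is bounded by
    \<open>le\<close>.\<close>
  obtain n where n: "n \<ge> n0" "b n" "\<not> b (Suc n)" using infinite_switches[OF inf] by blast
  define u v where "u = U n" and "v = V n"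
  define w where "w = u + v"
  have U1: "U (Suc n) = u" "V (Suc n) = w" using step(2)[OF n(2)] by (simp_all add: u_def v_def w_def)
  have U2: "U (Suc (Suc n)) = u + w" "V (Suc (Suc n)) = w" using step(3)[OF n(3)] U1 by simp_all
  have det: "det2 u w = 1" using step(1)[of "Suc n"] U1 by simp
  have t: "cmod (\<Phi> p (u + w + w)) \<le> 2 + d"
    using le[of "Suc (Suc n)"] near(1)[of "Suc n"] n U1 U2 by simp
  have r1: "\<Phi> p u * \<Phi> p w = \<Phi> p (u + w) + \<Phi> p v"
  proof -
    have "u - w = - v" by (simp add: w_def)
    then show ?thesis using Phi_rel1[OF det, of p] by simp
  qed
  have r2: "\<Phi> p w * \<Phi> p (u + w) = \<Phi> p (u + w + w) + \<Phi> p u"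
    using Phi_rel1[of "u + w" w p] det by (simp add: mult.commute)
  have "(cmod ((\<Phi> p u)\<^sup>2 + (\<Phi> p w)\<^sup>2 + (\<Phi> p (u + w))\<^sup>2 - \<Phi> p u * \<Phi> p w * \<Phi> p (u + w) - 4))\<^sup>2 \<le> 720 * d"
    by (rule kappa_near_4[OF d(1,2) _ _ _ _ _ _ _ t r1 r2])
      (use near[of n] near[of "Suc n"] near[of "Suc (Suc n)"] big(1)[of n] big(2)[of "Suc n"]
        big(1)[of "Suc (Suc n)"] n U1 U2 in \<open>auto simp: u_def[symmetric] v_def[symmetric]\<close>)
  then have "c\<^sup>2 \<le> 720 * d" using Phi_kappa[of u w p] det by (simp add: c_def)
  then show False using d by simp
qed

end

lemma fan_inject:
  assumes "det2 u v \<noteq> 0" "fan u v k = fan u v k'" shows "k = k'"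
  using lin_inject[OF assms(1), of "(int k, 1)" "(int k', 1)"] assms(2) by (simp add: fan_def)

text \<open>The equation gives |z|^2 \<le> |k| + 8 + 4 |z|, which fails beyond |k| + 12; here 12 = 8
  + 4.\<close>

lemma third_coordinate_bound:
  fixes x y z :: complex
  assumes "cmod x \<le> 2" "cmod y \<le> 2" "x\<^sup>2 + y\<^sup>2 + z\<^sup>2 - x * y * z = k"
  shows "cmod z \<le> 12 + cmod k"
proof (rule ccontr)
  assume "\<not> ?thesis"
  then have z: "cmod z > 12 + cmod k" by simp
  have "z\<^sup>2 = k - (x\<^sup>2 + y\<^sup>2) + x * y * z" using assms(3) by (simp add: algebra_simps)
  then have "(cmod z)\<^sup>2 \<le> cmod k + cmod (x\<^sup>2 + y\<^sup>2) + cmod (x * y * z)"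
    by (metis norm_power norm_triangle_le norm_triangle_ineq4 add_mono order_refl)
  moreover have "cmod (x\<^sup>2 + y\<^sup>2) \<le> 2\<^sup>2 + 2\<^sup>2"
  proof -
    have "cmod (x\<^sup>2 + y\<^sup>2) \<le> (cmod x)\<^sup>2 + (cmod y)\<^sup>2"
      using norm_triangle_ineq[of "x\<^sup>2" "y\<^sup>2"] by (simp add: norm_power)
    also have "\<dots> \<le> 2\<^sup>2 + 2\<^sup>2" using assms by (intro add_mono power_mono) auto
    finally show ?thesis .
  qed
  moreover have "cmod (x * y * z) \<le> 2 * 2 * cmod z"
    unfolding norm_mult using assms by (intro mult_mono) auto
  moreover have "(12 + cmod k) * cmod z \<le> (cmod z)\<^sup>2"
    using z unfolding power2_eq_square by (intro mult_right_mono) auto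
  moreover have "cmod k * 1 \<le> cmod k * cmod z"
  proof (rule mult_left_mono)
    have "1 \<le> 12 + cmod k" by (rule add_increasing2) auto
    then show "1 \<le> cmod z" by (rule order_trans[OF _ less_imp_le[OF z]])
  qed simp
  moreover have "12 < cmod z" using z norm_ge_zero[of k] by (simp add: order_le_less_trans[OF _ z])
  ultimately show False by (simp add: algebra_simps)
qed

section \<open>The BQ-conditions along Farey paths\<close>

context trace_family
begin

definition BQ :: "complex \<times> complex \<times> complex \<Rightarrow> bool" where
  "BQ p \<longleftrightarrow> (\<forall>u. prim u \<longrightarrow> \<Phi> p u \<notin> seg) \<and> finite {u. prim u \<and> cmod (\<Phi> p u) \<le> 2}"

lemma fan_tendsto_infinite:
  assumes det: "\<bar>det2 u v\<bar> = 1" and lim: "(\<lambda>k. \<Phi> p (fan u v k)) \<longlonglongrightarrow> 0"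
  shows "infinite {w. prim w \<and> cmod (\<Phi> p w) \<le> 2}"
proof
  assume fin: "finite {w. prim w \<and> cmod (\<Phi> p w) \<le> 2}"
  have "(\<lambda>k. cmod (\<Phi> p (fan u v k))) \<longlonglongrightarrow> 0" using lim by (rule tendsto_norm_zero)
  then have "\<forall>\<^sub>F k in sequentially. cmod (\<Phi> p (fan u v k)) < 2" by (rule order_tendstoD) simp
  then obtain n where n: "\<And>k. k \<ge> n \<Longrightarrow> cmod (\<Phi> p (fan u v k)) < 2"
    by (auto simp: eventually_sequentially)
  have "prim (fan u v k)" for k using det2_prim(2)[of u "fan u v k"] det by simp
  then have "fan u v ` {n..} \<subseteq> {w. prim w \<and> cmod (\<Phi> p w) \<le> 2}" using n by (auto intro: less_imp_le)
  then have "finite (fan u v ` {n..})" using fin finite_subset by blast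
  moreover have "inj_on (fan u v) {n..}"
  proof (rule inj_onI)
    fix k k' assume "fan u v k = fan u v k'"
    then show "k = k'" using fan_inject[of u v k k'] det by auto
  qed
  ultimately show False using finite_imageD infinite_Ici by blast
qed

text \<open>\<open>N w\<close> is the sum of the coordinates of w in the starting basis, as in
  \<open>lin_solve\<close>. Hence it is additive, and it increases on the side that is
  replaced.\<close>

lemma descent_size:
  assumes d: "descent U V b"
  defines "N \<equiv> \<lambda>w. det2 (U 0) w + det2 w (V 0)"
  shows "N (U n) \<ge> 1 \<and> N (V n) \<ge> 1 \<and> N (U n) \<le> N (U (Suc n)) \<and> N (V n) \<le> N (V (Suc n)) \<and>
    (\<not> b n \<longrightarrow> N (U n) < N (U (Suc n))) \<and> (b n \<longrightarrow> N (V n) < N (V (Suc n)))"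
proof -
  have add: "N (w + w') = N w + N w'" for w w' by (simp add: N_def)
  have step: "det2 (U n) (V n) = 1" "b n \<Longrightarrow> U (Suc n) = U n \<and> V (Suc n) = U n + V n"
    "\<not> b n \<Longrightarrow> U (Suc n) = U n + V n \<and> V (Suc n) = V n" for n
    using d by (auto simp: descent_def)
  have pos: "N (U n) \<ge> 1 \<and> N (V n) \<ge> 1" for n
  proof (induction n)
    case 0 show ?case using step(1)[of 0] by (simp add: N_def)
  next
    case (Suc n) then show ?case using step(2,3)[of n] add[of "U n" "V n"] by (cases "b n") auto
  qed
  show ?thesis using pos[of n] step(2,3)[of n] add[of "U n" "V n"] by (cases "b n") auto
qed

text \<open>Both sides are replaced infinitely often, so their coordinate sums tend to infinity,
  whereas these sums are bounded on F.\<close>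

lemma descent_escape:
  assumes d: "descent U V b" and inf: "\<And>n. \<exists>m\<ge>n. b m" "\<And>n. \<exists>m\<ge>n. \<not> b m" and "finite F"
  shows "\<exists>n0. \<forall>n\<ge>n0. U n \<notin> F \<and> V n \<notin> F"
proof -
  define N where "N w = det2 (U 0) w + det2 w (V 0)" for w
  note size = descent_size[OF d, folded N_def]
  have monoU: "N (U n) \<le> N (U m)" if "n \<le> m" for n m
    by (rule lift_Suc_mono_le[of "\<lambda>n. N (U n)", OF _ that]) (use size in blast)
  have monoV: "N (V n) \<le> N (V m)" if "n \<le> m" for n m
    by (rule lift_Suc_mono_le[of "\<lambda>n. N (V n)", OF _ that]) (use size in blast)
  have ex: "\<exists>n. N (U n) \<ge> int m \<and> N (V n) \<ge> int m" for m
  proof (induction m)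
    case 0 show ?case using size[of 0] by (intro exI[of _ 0]) auto
  next
    case (Suc m)
    then obtain n where n: "N (U n) \<ge> int m" "N (V n) \<ge> int m" by blast
    obtain i where i: "i \<ge> n" "b i" using inf by blast
    obtain j where j: "j \<ge> n" "\<not> b j" using inf by blast
    have "N (V (Suc i)) \<ge> int (Suc m)" using size[of i] i n monoV[of n i] by simp
    moreover have "N (U (Suc j)) \<ge> int (Suc m)" using size[of j] j n monoU[of n j] by simp
    ultimately show ?case
      using order_trans[OF _ monoU[of "Suc j" "max (Suc i) (Suc j)"]]
        order_trans[OF _ monoV[of "Suc i" "max (Suc i) (Suc j)"]]
      by (intro exI[of _ "max (Suc i) (Suc j)"]) simp
  qed
  define M where "M = nat (Max (insert 0 (N ` F))) + 1"
  have M: "N w < int M" if "w \<in> F" for w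
  proof -
    have "N w \<le> Max (insert 0 (N ` F))" using that \<open>finite F\<close> by (intro Max_ge) auto
    then show ?thesis by (simp add: M_def)
  qed
  obtain n where n: "N (U n) \<ge> int M" "N (V n) \<ge> int M" using ex by blast
  show ?thesis
  proof (intro exI[of _ n] allI impI conjI)
    fix k assume k: "n \<le> k"
    show "U k \<notin> F" using M[of "U k"] monoU[OF k] n by auto
    show "V k \<notin> F" using M[of "V k"] monoV[OF k] n by auto
  qed
qed

lemma descent_inj:
  assumes d: "descent U V b" shows "inj (\<lambda>n. (U n, V n))"
proof -
  define N where "N w = det2 (U 0) w + det2 w (V 0)" for w
  note size = descent_size[OF d, folded N_def]
  have "N (U n) + N (V n) < N (U (Suc n)) + N (V (Suc n))" for n using size[of n] by (cases "b n") auto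
  then have "strict_mono (\<lambda>n. N (U n) + N (V n))" by (rule strict_monoI_Suc)
  then have "inj (\<lambda>n. N (U n) + N (V n))" by (rule strict_mono_imp_inj_on)
  then show ?thesis by (auto simp: inj_on_def)
qed

text \<open>From n on, one side is constant and the other runs through its fan, so the tame
  alternative of \<open>fan_dichotomy\<close> is excluded at every stage.\<close>

lemma descent_stuck:
  assumes d: "descent U V b" and nt: "\<And>n. \<not> tame p (U n) (V n)" and ns: "\<And>u. prim u \<Longrightarrow> \<Phi> p u \<notin> seg"
    and stuck: "(\<forall>m\<ge>n. b m) \<or> (\<forall>m\<ge>n. \<not> b m)"
  obtains u v where "\<bar>det2 u v\<bar> = 1" "(\<lambda>k. \<Phi> p (fan u v k)) \<longlonglongrightarrow> 0"
proof -
  note s = descent_shift[OF d, of n]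
  have det: "det2 (U n) (V n) = 1" using d by (simp add: descent_def)
  show ?thesis using stuck
  proof
    assume "\<forall>m\<ge>n. b m"
    then have "U (k + n) = U n \<and> V (k + n) = fan (U n) (V n) k" for k
      using descent_const(1)[OF s, of k] by simp
    then have "\<not> tame p (U n) (fan (U n) (V n) k)" for k using nt[of "k + n"] by metis
    moreover have "\<bar>det2 (U n) (V n)\<bar> = 1" using det by simp
    ultimately show ?thesis
      using that fan_dichotomy[of "U n" "V n" p] ns[OF det2_prim(1)] by blast
  next
    assume "\<forall>m\<ge>n. \<not> b m"
    then have "V (k + n) = V n \<and> U (k + n) = fan (V n) (U n) k" for k
      using descent_const(2)[OF s, of k] by simp
    then have "\<not> tame p (V n) (fan (V n) (U n) k)" for k
      using nt[of "k + n"] tame_swap[of p "V n" "fan (V n) (U n) k"] by metis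
    moreover have "\<bar>det2 (V n) (U n)\<bar> = 1" using det by (simp add: det2_swap[of "V n"])
    ultimately show ?thesis
      using that fan_dichotomy[of "V n" "U n" p] ns[OF det2_prim(1)] by blast
  qed
qed

text \<open>A path of non-tame cones that keeps one side forever gives a fan tending to 0, hence
  infinitely many values of modulus at most 2. Any other path leaves the finite set of slopes with
  such values; from then on a sum exceeding the difference would make the cone tame, so
  \<open>descent_big_imp_kappa\<close> applies.\<close>

lemma BQ_cone_tame:
  assumes BQ: "BQ p" and k: "kappa p \<noteq> 4" and det: "det2 u v = 1"
  shows "tame p u v"
proof (rule ccontr)
  assume nt: "\<not> tame p u v"
  have "\<not> tame p u (u + v) \<or> \<not> tame p (u + v) v" if "\<not> tame p u v" for u v
    using tame_split that by blast
  then obtain U V b where d: "descent U V b" and ntn: "\<And>n. \<not> tame p (U n) (V n)"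
    using descent_exists[of u v "\<lambda>u v. \<not> tame p u v", OF det nt] by metis
  have ns: "\<And>u. prim u \<Longrightarrow> \<Phi> p u \<notin> seg" and fin: "finite {u. prim u \<and> cmod (\<Phi> p u) \<le> 2}"
    using BQ by (auto simp: BQ_def)
  have inf: "\<exists>m\<ge>n. b m" "\<exists>m\<ge>n. \<not> b m" for n
  proof -
    have "\<not> ((\<forall>m\<ge>n. b m) \<or> (\<forall>m\<ge>n. \<not> b m))"
    proof
      assume st: "(\<forall>m\<ge>n. b m) \<or> (\<forall>m\<ge>n. \<not> b m)"
      show False
        by (rule descent_stuck[OF d ntn ns st]) (use fan_tendsto_infinite fin in blast)+
    qed
    then show "\<exists>m\<ge>n. b m" "\<exists>m\<ge>n. \<not> b m" by blast+
  qed
  obtain n0 where n0: "\<And>n. n \<ge> n0 \<Longrightarrow> U n \<notin> {u. prim u \<and> cmod (\<Phi> p u) \<le> 2}"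
    "\<And>n. n \<ge> n0 \<Longrightarrow> V n \<notin> {u. prim u \<and> cmod (\<Phi> p u) \<le> 2}"
    using descent_escape[OF d inf fin] by blast
  have detn: "\<bar>det2 (U n) (V n)\<bar> = 1" for n using d by (simp add: descent_def)
  have big: "cmod (\<Phi> p (U n)) > 2" "cmod (\<Phi> p (V n)) > 2" if "n \<ge> n0" for n
    using n0[OF that] det2_prim[OF detn[of n]] by auto
  have inf': "\<exists>m\<ge>n. b (m + n0)" "\<exists>m\<ge>n. \<not> b (m + n0)" for n
  proof -
    obtain m m' where "m \<ge> n + n0" "b m" "m' \<ge> n + n0" "\<not> b m'" using inf by blast
    then show "\<exists>m\<ge>n. b (m + n0)" "\<exists>m\<ge>n. \<not> b (m + n0)"
      by (intro exI[of _ "m - n0"] exI[of _ "m' - n0"]; simp)+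
  qed
  have "kappa p = 4"
  proof (rule descent_big_imp_kappa[OF descent_shift[OF d, of n0]])
    fix n
    show "cmod (\<Phi> p (U (n + n0) + V (n + n0))) \<le> cmod (\<Phi> p (U (n + n0) - V (n + n0)))"
    proof (rule ccontr)
      assume "\<not> ?thesis"
      then have "tame p (U (n + n0)) (V (n + n0))"
        by (intro increasing_tame detn big) auto
      then show False using ntn by blast
    qed
  qed (use big inf' in auto)
  then show False using k by simp
qed

theorem BQ_locally_uniform:
  assumes BQ: "BQ p" and k: "kappa p \<noteq> 4"
  obtains N where "open N" "p \<in> N" "\<And>q. q \<in> N \<Longrightarrow> BQ q"
    "\<And>C. finite {u. prim u \<and> (\<exists>q\<in>N. cmod (\<Phi> q u) \<le> C)}"
proof -
  have t: "tame p (1, 0) (0, 1)" "tame p (0, -1) (1, 0)"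
    by (rule BQ_cone_tame[OF BQ k]; simp add: det2_def)+
  obtain N1 where N1: "open N1" "p \<in> N1" "\<forall>q\<in>N1. \<forall>w\<in>cone (1, 0) (0, 1). \<Phi> q w \<notin> seg"
    "\<And>C. finite {w \<in> cone (1, 0) (0, 1). \<exists>q\<in>N1. cmod (\<Phi> q w) \<le> C}"
    using t(1) unfolding tame_def by blast
  obtain N2 where N2: "open N2" "p \<in> N2" "\<forall>q\<in>N2. \<forall>w\<in>cone (0, -1) (1, 0). \<Phi> q w \<notin> seg"
    "\<And>C. finite {w \<in> cone (0, -1) (1, 0). \<exists>q\<in>N2. cmod (\<Phi> q w) \<le> C}"
    using t(2) unfolding tame_def by blast
  define N where "N = N1 \<inter> N2"
  have fin: "finite {u. prim u \<and> (\<exists>q\<in>N. cmod (\<Phi> q u) \<le> C)}" for C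
  proof -
    let ?A = "{w \<in> cone (1, 0) (0, 1). \<exists>q\<in>N1. cmod (\<Phi> q w) \<le> C} \<union>
        {w \<in> cone (0, -1) (1, 0). \<exists>q\<in>N2. cmod (\<Phi> q w) \<le> C}"
    have "{u. prim u \<and> (\<exists>q\<in>N. cmod (\<Phi> q u) \<le> C)} \<subseteq> ?A \<union> uminus ` ?A"
    proof
      fix u assume "u \<in> {u. prim u \<and> (\<exists>q\<in>N. cmod (\<Phi> q u) \<le> C)}"
      then obtain q where q: "prim u" "q \<in> N" "cmod (\<Phi> q u) \<le> C" by blast
      then have "u \<in> ?A \<or> - u \<in> ?A" using prim_cones[OF q(1)] unfolding N_def by auto
      then show "u \<in> ?A \<union> uminus ` ?A" by force
    qed
    moreover have "finite (?A \<union> uminus ` ?A)" using N1(4) N2(4) by simp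
    ultimately show ?thesis by (rule finite_subset)
  qed
  have "BQ q" if "q \<in> N" for q
  proof -
    have "\<Phi> q u \<notin> seg" if "prim u" for u
    proof -
      have "q \<in> N1" "q \<in> N2" using \<open>q \<in> N\<close> by (auto simp: N_def)
      then have "\<Phi> q u \<notin> seg \<or> \<Phi> q (- u) \<notin> seg" using prim_cones[OF that] N1(3) N2(3) by blast
      then show ?thesis by simp
    qed
    moreover have "finite {u. prim u \<and> cmod (\<Phi> q u) \<le> 2}"
      by (rule finite_subset[OF _ fin[of 2]]) (use that in blast)
    ultimately show ?thesis by (simp add: BQ_def)
  qed
  then show ?thesis using that[of N] N1 N2 fin by (auto simp: N_def)
qed

text \<open>A small value alone says nothing about its neighbours. Cones with infinitely many small
  values form a path. If it keeps a side forever, the fan of that side tends to 0 and supplies the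
  triples. Otherwise all late pairs have a side of modulus at most 2. When such a side is dropped,
  the next pair still contains a small one, so two of the three traces of the triangle are at most
  2, and \<open>third_coordinate_bound\<close> controls the third.\<close>

theorem infinitely_many_bounded_triples:
  assumes ns: "\<And>u. prim u \<Longrightarrow> \<Phi> p u \<notin> seg" and k: "kappa p \<noteq> 4"
    and inf2: "infinite {u. prim u \<and> cmod (\<Phi> p u) \<le> 2}"
  obtains C where "infinite {(u, v). det2 u v = 1 \<and> cmod (\<Phi> p u) \<le> C \<and> cmod (\<Phi> p v) \<le> C \<and>
    cmod (\<Phi> p (u + v)) \<le> C}"
proof -
  define bad where "bad u v \<longleftrightarrow> infinite {w \<in> cone u v. cmod (\<Phi> p w) \<le> 2}" for u v
  have bad_not_tame: "\<not> tame p u v" if "bad u v" for u v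
  proof
    assume "tame p u v"
    then obtain N where N: "p \<in> N" "finite {w \<in> cone u v. \<exists>q\<in>N. cmod (\<Phi> q w) \<le> 2}"
      unfolding tame_def by blast
    have "finite {w \<in> cone u v. cmod (\<Phi> p w) \<le> 2}"
      by (rule finite_subset[OF _ N(2)]) (use N(1) in blast)
    then show False using that by (simp add: bad_def)
  qed
  have bad_split: "bad u (u + v) \<or> bad (u + v) v" if "bad u v" for u v
  proof (rule ccontr)
    assume "\<not> ?thesis"
    then have "finite ({w \<in> cone u (u + v). cmod (\<Phi> p w) \<le> 2} \<union> {w \<in> cone (u + v) v. cmod (\<Phi> p w) \<le> 2})"
      by (simp add: bad_def)
    then have "finite {w \<in> cone u v. cmod (\<Phi> p w) \<le> 2}"
      by (rule rev_finite_subset) (use cone_split[of u v] in blast)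
    then show False using that by (simp add: bad_def)
  qed
  have "bad (1, 0) (0, 1) \<or> bad (0, -1) (1, 0)"
  proof (rule ccontr)
    let ?A = "{w \<in> cone (1, 0) (0, 1). cmod (\<Phi> p w) \<le> 2} \<union> {w \<in> cone (0, -1) (1, 0). cmod (\<Phi> p w) \<le> 2}"
    assume "\<not> ?thesis"
    then have "finite (?A \<union> uminus ` ?A)" by (simp add: bad_def)
    moreover have "{u. prim u \<and> cmod (\<Phi> p u) \<le> 2} \<subseteq> ?A \<union> uminus ` ?A"
    proof
      fix u assume "u \<in> {u. prim u \<and> cmod (\<Phi> p u) \<le> 2}"
      then have "u \<in> ?A \<or> - u \<in> ?A" using prim_cones[of u] by auto
      then show "u \<in> ?A \<union> uminus ` ?A" by force
    qed
    ultimately show False using inf2 finite_subset by blast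
  qed
  then obtain u0 v0 where uv0: "det2 u0 v0 = 1" "bad u0 v0"
  proof (elim disjE)
    assume "bad (0, -1) (1, 0)"
    moreover have "det2 (0, -1) (1, 0) = 1" by (simp add: det2_def)
    ultimately show ?thesis using that by blast
  qed (use that det2_simps(8) in blast)
  then obtain U V b where d: "descent U V b" and badn: "\<And>n. bad (U n) (V n)"
    using descent_exists[of u0 v0 bad, OF uv0] bad_split by metis
  note ntn = bad_not_tame[OF badn]
  have detn: "det2 (U n) (V n) = 1" for n using d by (simp add: descent_def)
  have step: "b n \<Longrightarrow> U (Suc n) = U n \<and> V (Suc n) = U n + V n"
    "\<not> b n \<Longrightarrow> U (Suc n) = U n + V n \<and> V (Suc n) = V n" for n
    using d by (auto simp: descent_def)
  show ?thesis
  proof (cases "\<exists>n. (\<forall>m\<ge>n. b m) \<or> (\<forall>m\<ge>n. \<not> b m)")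
    case True
    then obtain u v where uv: "\<bar>det2 u v\<bar> = 1" "(\<lambda>k. \<Phi> p (fan u v k)) \<longlonglongrightarrow> 0"
      using descent_stuck[OF d ntn ns] by blast
    have "Bseq (\<lambda>k. \<Phi> p (fan u v k))" using uv(2) by (rule convergent_imp_Bseq[OF convergentI])
    then obtain B where B: "\<And>k. cmod (\<Phi> p (fan u v k)) \<le> B" unfolding Bseq_def by blast
    define C where "C = max B (cmod (\<Phi> p u))"
    have C: "cmod (\<Phi> p (fan u v k)) \<le> C" "cmod (\<Phi> p u) \<le> C" for k
      using B[of k] by (auto simp: C_def)
    let ?S = "{(u, v). det2 u v = 1 \<and> cmod (\<Phi> p u) \<le> C \<and> cmod (\<Phi> p v) \<le> C \<and> cmod (\<Phi> p (u + v)) \<le> C}"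
    define g where "g k = (if det2 u v = 1 then (u, fan u v k) else (fan u v k, u))" for k
    have gS: "g k \<in> ?S" for k
    proof (cases "det2 u v = 1")
      case True
      then show ?thesis using C C(1)[of "Suc k"] by (simp add: g_def fan_Suc)
    next
      case False
      then have "det2 (fan u v k) u = 1" using uv(1) by (simp add: det2_swap[of "fan u v k"] abs_if split: if_splits)
      then show ?thesis using False C C(1)[of "Suc k"] by (simp add: g_def fan_Suc add.commute)
    qed
    have "inj g"
    proof (rule injI)
      fix k k' assume "g k = g k'"
      then have "fan u v k = fan u v k'" by (auto simp: g_def split: if_splits)
      then show "k = k'" using fan_inject[of u v k k'] uv(1) by auto
    qed
    then have "infinite (range g)" by (rule range_inj_infinite)
    moreover have "range g \<subseteq> ?S" using gS by (rule image_subsetI)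
    ultimately have "infinite ?S" using infinite_super by blast
    then show ?thesis by (rule that)
  next
    case False
    then have inf: "\<exists>m\<ge>n. b m" "\<exists>m\<ge>n. \<not> b m" for n by blast+
    define small where "small n \<longleftrightarrow> cmod (\<Phi> p (U n)) \<le> 2 \<or> cmod (\<Phi> p (V n)) \<le> 2" for n
    have noninc: "cmod (\<Phi> p (U n + V n)) \<le> cmod (\<Phi> p (U n - V n))" if "\<not> small n" for n
    proof (rule ccontr)
      assume "\<not> ?thesis"
      then have "tame p (U n) (V n)"
        using that detn[of n] by (intro increasing_tame) (auto simp: small_def)
      then show False using ntn by blast
    qed
    have ex_small: "\<exists>n. small n"
    proof (rule ccontr)
      assume "\<nexists>n. small n"
      then have "kappa p = 4"
        using descent_big_imp_kappa[OF d inf, of p] noninc by (simp add: small_def not_le)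
      then show False using k by simp
    qed
    \<comment> \<open>The side dropped is the difference of the next pair. Were it small and both
      new sides large, their product would exceed 4, although sum and difference are at most 2 by
      \<open>noninc\<close>.\<close>
    have hered: "small (Suc n)" if "small n" for n
    proof (rule ccontr)
      assume ns': "\<not> small (Suc n)"
      let ?u = "U (Suc n)" and ?v = "V (Suc n)"
      have big: "cmod (\<Phi> p ?u) > 2" "cmod (\<Phi> p ?v) > 2" using ns' by (auto simp: small_def)
      have "cmod (\<Phi> p (?u - ?v)) \<le> 2"
      proof (cases "b n")
        case True
        then have "?u - ?v = - V n" using step(1)[of n] by simp
        then show ?thesis using that big step(1)[OF True] by (simp add: small_def)
      next
        case False
        then have "?u - ?v = U n" using step(2)[of n] by simp
        then show ?thesis using that big step(2)[OF False] by (simp add: small_def)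
      qed
      moreover have "2 * 2 < cmod (\<Phi> p ?u) * cmod (\<Phi> p ?v)" using big by (intro mult_strict_mono) auto
      moreover have "cmod (\<Phi> p ?u) * cmod (\<Phi> p ?v) \<le> cmod (\<Phi> p (?u + ?v)) + cmod (\<Phi> p (?u - ?v))"
        by (metis Phi_rel1[OF detn] norm_mult norm_triangle_ineq)
      ultimately show False using noninc[OF ns'] by simp
    qed
    obtain n1 where n1: "small n1" using ex_small by blast
    have smalln: "small n" if "n \<ge> n1" for n using that n1 hered by (induction rule: dec_induct) auto
    define C where "C = 12 + cmod (kappa p)"
    let ?S = "{(u, v). det2 u v = 1 \<and> cmod (\<Phi> p u) \<le> C \<and> cmod (\<Phi> p v) \<le> C \<and> cmod (\<Phi> p (u + v)) \<le> C}"
    have C2: "2 \<le> C" by (simp add: C_def)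
    have rel: "(\<Phi> p (U m))\<^sup>2 + (\<Phi> p (V m))\<^sup>2 + (\<Phi> p (U m + V m))\<^sup>2 - \<Phi> p (U m) * \<Phi> p (V m) * \<Phi> p (U m + V m) = kappa p" for m
      using Phi_kappa[of "U m" "V m" p] detn[of m] by simp
    have two: "(U m, V m) \<in> ?S" if m: "m \<ge> n1"
      and "cmod (\<Phi> p (U m)) \<le> 2 \<and> \<not> b m \<or> cmod (\<Phi> p (V m)) \<le> 2 \<and> b m" for m
    proof -
      have s: "small (Suc m)" using smalln m by simp
      have xy: "cmod (\<Phi> p (U m + V m)) \<le> C" if "cmod (\<Phi> p (U m)) \<le> 2" "cmod (\<Phi> p (V m)) \<le> 2"
        using third_coordinate_bound[OF that rel] by (simp add: C_def)
      have xz: "cmod (\<Phi> p (V m)) \<le> C" if "cmod (\<Phi> p (U m)) \<le> 2" "cmod (\<Phi> p (U m + V m)) \<le> 2"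
        unfolding C_def by (rule third_coordinate_bound[OF that]) (use rel[of m] in \<open>simp add: algebra_simps\<close>)
      have yz: "cmod (\<Phi> p (U m)) \<le> C" if "cmod (\<Phi> p (V m)) \<le> 2" "cmod (\<Phi> p (U m + V m)) \<le> 2"
        unfolding C_def by (rule third_coordinate_bound[OF that]) (use rel[of m] in \<open>simp add: algebra_simps\<close>)
      have "cmod (\<Phi> p (U m)) \<le> C \<and> cmod (\<Phi> p (V m)) \<le> C \<and> cmod (\<Phi> p (U m + V m)) \<le> C"
      proof (cases "b m")
        case True
        then have "cmod (\<Phi> p (U m)) \<le> 2 \<or> cmod (\<Phi> p (U m + V m)) \<le> 2"
          using s step(1)[of m] by (simp add: small_def)
        then show ?thesis using xy yz that True C2 by (auto intro: order_trans)
      next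
        case False
        then have "cmod (\<Phi> p (V m)) \<le> 2 \<or> cmod (\<Phi> p (U m + V m)) \<le> 2"
          using s step(2)[of m] by (auto simp: small_def)
        then show ?thesis using xy xz that False C2 by (auto intro: order_trans)
      qed
      then show ?thesis using detn by simp
    qed
    have ex: "\<exists>m\<ge>n. (U m, V m) \<in> ?S" for n
    proof -
      define n' where "n' = max n n1"
      have n': "n' \<ge> n" "n' \<ge> n1" by (auto simp: n'_def)
      from smalln[OF n'(2)] show ?thesis unfolding small_def
      proof
        assume x: "cmod (\<Phi> p (U n')) \<le> 2"
        \<comment> \<open>The first time from n' on at which the small side U is dropped.\<close>
        define j where "j = (LEAST j. \<not> b (n' + j))"
        have "\<exists>j. \<not> b (n' + j)" using inf(2)[of n'] by (metis le_Suc_ex)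
        then have j: "\<not> b (n' + j)" "\<And>i. i < j \<Longrightarrow> b (n' + i)"
          unfolding j_def by (rule LeastI_ex, auto dest: not_less_Least)
        have "i \<le> j \<Longrightarrow> U (n' + i) = U n'" for i
          by (induction i) (use step(1) j(2) in auto)
        then have "cmod (\<Phi> p (U (n' + j))) \<le> 2" using x by simp
        then show ?thesis using two[of "n' + j"] j(1) n' by (intro exI[of _ "n' + j"]) auto
      next
        assume x: "cmod (\<Phi> p (V n')) \<le> 2"
        define j where "j = (LEAST j. b (n' + j))"
        have "\<exists>j. b (n' + j)" using inf(1)[of n'] by (metis le_Suc_ex)
        then have j: "b (n' + j)" "\<And>i. i < j \<Longrightarrow> \<not> b (n' + i)"
          unfolding j_def by (rule LeastI_ex, auto dest: not_less_Least)
        have "i \<le> j \<Longrightarrow> V (n' + i) = V n'" for i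
          by (induction i) (use step(2) j(2) in auto)
        then have "cmod (\<Phi> p (V (n' + j))) \<le> 2" using x by simp
        then show ?thesis using two[of "n' + j"] j(1) n' by (intro exI[of _ "n' + j"]) auto
      qed
    qed
    have "infinite {m. (U m, V m) \<in> ?S}"
      unfolding infinite_nat_iff_unbounded_le using ex by blast
    then have "infinite ((\<lambda>m. (U m, V m)) ` {m. (U m, V m) \<in> ?S})"
      using finite_image_iff[OF inj_on_subset[OF descent_inj[OF d] subset_UNIV]] by blast
    moreover have "(\<lambda>m. (U m, V m)) ` {m. (U m, V m) \<in> ?S} \<subseteq> ?S" by blast
    ultimately have "infinite ?S" using infinite_super by blast
    then show ?thesis by (rule that)
  qed
qed

end

section \<open>Holomorphic functions omitting the segment\<close>

text \<open>With \<open>q = csqrt ((g - 2) / (g + 2))\<close>, which has positive real part, \<open>m = (1 - q) / (1 + q)\<close>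
  is a holomorphic branch of the inverse Joukowski map: \<open>g = m + 1 / m\<close> and \<open>0 < \<bar>m\<bar> < 1\<close>.\<close>

lemma joukowski_branch:
  assumes holo: "g holomorphic_on S" and avoid: "\<And>z. z \<in> S \<Longrightarrow> g z \<notin> seg"
  obtains m where "m holomorphic_on S" "\<And>z. z \<in> S \<Longrightarrow> m z \<noteq> 0 \<and> cmod (m z) < 1 \<and> g z = m z + 1 / m z"
proof -
  define w where "w z = (g z - 2) / (g z + 2)" for z
  define q where "q z = csqrt (w z)" for z
  define m where "m z = (1 - q z) / (1 + q z)" for z
  have gm2: "g z + 2 \<noteq> 0" if "z \<in> S" for z
  proof
    assume "g z + 2 = 0"
    then have "g z = complex_of_real (-2)" by (simp add: add_eq_0_iff2)
    moreover have "complex_of_real (-2) \<in> seg" unfolding seg_def by (intro imageI) simp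
    ultimately show False using avoid[OF that] by simp
  qed
  \<comment> \<open>The Moebius map takes the segment without -2 onto the nonpositive reals, the cut
    of \<open>csqrt\<close>.\<close>
  have wn: "w z \<notin> \<real>\<^sub>\<le>\<^sub>0" if "z \<in> S" for z
  proof
    assume "w z \<in> \<real>\<^sub>\<le>\<^sub>0"
    then obtain t where t: "w z = complex_of_real t" "t \<le> 0" by (auto elim!: nonpos_Reals_cases)
    have "g z - 2 = complex_of_real t * (g z + 2)"
      using t gm2[OF that] by (simp add: w_def field_simps)
    then have "g z * complex_of_real (1 - t) = complex_of_real (2 * (1 + t))" by (simp add: algebra_simps)
    then have "g z = complex_of_real (2 * (1 + t) / (1 - t))" using t by (simp add: field_simps flip: of_real_mult)
    moreover have "2 * (1 + t) / (1 - t) \<in> {-2..2}" using t by (simp add: field_simps)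
    ultimately show False using avoid[OF that] unfolding seg_def by blast
  qed
  have w_hol: "w holomorphic_on S" unfolding w_def using holo gm2 by (intro holomorphic_intros) auto
  have q_hol: "q holomorphic_on S" unfolding q_def using w_hol wn by (intro holomorphic_intros) auto
  have qpos: "Re (q z) > 0" if "z \<in> S" for z
  proof -
    have "Re (q z) \<noteq> 0"
    proof
      assume "Re (q z) = 0"
      then have "q z = \<i> * complex_of_real (Im (q z))" by (simp add: complex_eq_iff)
      then have "(q z)\<^sup>2 = complex_of_real (- (Im (q z))\<^sup>2)"
        by (metis power_mult_distrib power2_i mult_minus1 of_real_minus of_real_power)
      moreover have "(q z)\<^sup>2 = w z" by (simp add: q_def)
      ultimately show False using wn[OF that] by (metis complex_nonpos_Reals_iff complex_of_real_def Re_complex_of_real Im_complex_of_real neg_le_0_iff_le zero_le_power2)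
    qed
    moreover have "Re (q z) \<ge> 0" unfolding q_def using csqrt_principal[of "w z"] by auto
    ultimately show ?thesis by simp
  qed
  have q1: "1 + q z \<noteq> 0" if "z \<in> S" for z
    using qpos[OF that] by (auto simp: complex_eq_iff)
  have qq: "(q z)\<^sup>2 * (g z + 2) = g z - 2" if "z \<in> S" for z
    using gm2[OF that] by (simp add: q_def w_def)
  have q2: "1 - q z \<noteq> 0" if "z \<in> S" for z
  proof
    assume "1 - q z = 0"
    then have "q z = 1" by simp
    then show False using qq[OF that] by simp
  qed
  show ?thesis
  proof (rule that[of m])
    show "m holomorphic_on S" unfolding m_def using q_hol q1 by (intro holomorphic_intros) auto
    fix z assume z: "z \<in> S"
    have "cmod (1 - q z) < cmod (1 + q z)"
    proof -
      have "(cmod (1 - q z))\<^sup>2 < (cmod (1 + q z))\<^sup>2"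
        using qpos[OF z] unfolding cmod_power2 by (simp add: power2_eq_square algebra_simps)
      then show ?thesis by (rule power_less_imp_less_base) simp
    qed
    then have "cmod (m z) < 1" using q1[OF z] by (simp add: m_def norm_divide)
    moreover have "g z * ((1 - q z) * (1 + q z)) = (1 - q z) * (1 - q z) + (1 + q z) * (1 + q z)"
      using qq[OF z] by (simp add: algebra_simps power2_eq_square)
    then have "g z = m z + 1 / m z" using q1[OF z] q2[OF z] unfolding m_def
      by (simp add: divide_simps) (simp add: mult_ac)
    ultimately show "m z \<noteq> 0 \<and> cmod (m z) < 1 \<and> g z = m z + 1 / m z"
      using q1[OF z] q2[OF z] by (simp add: m_def)
  qed
qed

text \<open>Harnack's inequality for the positive harmonic function \<open>- ln \<bar>m\<bar>\<close>, by way of the Schwarz lemma.\<close>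

lemma avoid_seg_bound:
  assumes holo: "g holomorphic_on ball 0 1" and avoid: "\<And>z. z \<in> ball 0 1 \<Longrightarrow> g z \<notin> seg"
    and M: "cmod (g 0) \<le> M" and z: "cmod z \<le> 1 / 2"
  shows "cmod (g z) \<le> 1 + (M + 1) ^ 3"
proof -
  obtain m where m_hol: "m holomorphic_on ball 0 1"
    and m: "\<And>z. z \<in> ball 0 1 \<Longrightarrow> m z \<noteq> 0 \<and> cmod (m z) < 1 \<and> g z = m z + 1 / m z"
    using joukowski_branch[OF holo avoid] by blast
  obtain k' where k'_hol: "k' holomorphic_on ball 0 1" and k': "\<And>z. z \<in> ball 0 1 \<Longrightarrow> m z = exp (k' z)"
    using contractible_imp_holomorphic_log[OF m_hol convex_imp_contractible] m convex_ball by metis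
  define k where "k z = - k' z" for z
  have k_hol: "k holomorphic_on ball 0 1" unfolding k_def using k'_hol by (intro holomorphic_intros)
  have mk: "cmod (m z) = exp (- Re (k z))" if "z \<in> ball 0 1" for z
    using k'[OF that] by (simp add: k_def)
  have kpos: "Re (k z) > 0" if "z \<in> ball 0 1" for z
    using m[OF that] mk[OF that] by simp
  have z0: "(0::complex) \<in> ball 0 1" by simp
  \<comment> \<open>The half plane Re > 0 is moved to the unit disk, with k 0 going to 0.\<close>
  define h where "h z = (k z - k 0) / (k z + cnj (k 0))" for z
  have den: "k z + cnj (k 0) \<noteq> 0" if "z \<in> ball 0 1" for z
    using kpos[OF that] kpos[OF z0] by (auto simp: complex_eq_iff)
  have h_hol: "h holomorphic_on ball 0 1" unfolding h_def using k_hol den by (intro holomorphic_intros) auto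
  have h1: "cmod (h z) < 1" if "cmod z < 1" for z
  proof -
    have zb: "z \<in> ball 0 1" using that by simp
    have "(cmod (k z - k 0))\<^sup>2 < (cmod (k z + cnj (k 0)))\<^sup>2"
      using mult_pos_pos[OF kpos[OF zb] kpos[OF z0]]
      unfolding cmod_power2 by (simp add: power2_eq_square algebra_simps)
    then have "cmod (k z - k 0) < cmod (k z + cnj (k 0))" by (rule power_less_imp_less_base) simp
    then show ?thesis using den[OF zb] by (simp add: h_def norm_divide)
  qed
  have zb: "z \<in> ball 0 1" using z by simp
  have "cmod (h z) \<le> cmod z"
    by (rule Schwarz_Lemma(1)[OF h_hol _ h1]) (use z in \<open>auto simp: h_def\<close>)
  then have "cmod (h z) \<le> 1 / 2" using z by simp
  then have "cmod (k z - k 0) * 2 \<le> cmod (k z + cnj (k 0))"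
    using den[OF zb] by (simp add: h_def norm_divide field_simps)
  also have "k z + cnj (k 0) = (k z - k 0) + complex_of_real (2 * Re (k 0))"
    by (simp add: complex_eq_iff)
  also have "cmod \<dots> \<le> cmod (k z - k 0) + 2 * Re (k 0)"
    using norm_triangle_ineq[of "k z - k 0" "complex_of_real (2 * Re (k 0))"] kpos[OF z0]
    by (simp only: norm_of_real)
  \<comment> \<open>This yields Harnack's factor (1 + r) / (1 - r) = 3 for r = 1 / 2, the exponent
    in the final bound.\<close>
  finally have "cmod (k z - k 0) \<le> 2 * Re (k 0)" by simp
  then have "Re (k z) \<le> 3 * Re (k 0)" using complex_Re_le_cmod[of "k z - k 0"] by simp
  then have "inverse (cmod (m z)) \<le> inverse (cmod (m 0)) ^ 3"
    by (simp add: mk[OF zb] mk[OF z0] exp_minus flip: exp_of_nat_mult)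
  moreover have "inverse (cmod (m 0)) \<le> M + 1"
  proof -
    have "1 / m 0 = g 0 - m 0" using m[OF z0] by simp
    then have "cmod (1 / m 0) \<le> cmod (g 0) + cmod (m 0)" by (metis norm_triangle_ineq4)
    moreover have "cmod (1 / m 0) = inverse (cmod (m 0))" by (simp add: norm_inverse divide_inverse)
    moreover have "cmod (m 0) < 1" using m[OF z0] by simp
    ultimately show ?thesis using M by linarith
  qed
  then have "inverse (cmod (m 0)) ^ 3 \<le> (M + 1) ^ 3" by (intro power_mono) auto
  moreover have "cmod (g z) \<le> cmod (m z) + inverse (cmod (m z))"
    using m[OF zb] norm_triangle_ineq[of "m z" "1 / m z"] by (simp add: norm_inverse divide_inverse)
  ultimately show ?thesis using m[OF zb] by linarith
qed

text \<open>Circles of radius 1 / 4 about points of the disk of radius 1 / 4 stay where B is a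
  bound, so Cauchy's inequality bounds the first derivative by 4 B and the second by 32 B.\<close>

lemma quadratic_remainder:
  assumes holo: "g holomorphic_on ball 0 1" and B: "\<And>z. cmod z \<le> 1 / 2 \<Longrightarrow> cmod (g z) \<le> B"
    and z: "cmod z \<le> 1 / 4"
  shows "cmod (g z - g 0 - deriv g 0 * z) \<le> 128 * B * (cmod z)\<^sup>2" and "cmod (deriv g 0) \<le> 4 * B"
proof -
  have cont: "continuous_on (ball 0 1) g" using holo by (rule holomorphic_on_imp_continuous_on)
  have bound: "cmod ((deriv ^^ n) g w) \<le> fact n * B / (1 / 4) ^ n" if w: "w \<in> cball 0 (1 / 4)" for n w
  proof (rule Cauchy_inequality)
    have sub: "cball w (1 / 4) \<subseteq> cball 0 (1 / 2)"
    proof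
      fix x assume "x \<in> cball w (1 / 4)"
      then have "cmod (x - w) \<le> 1 / 4" "cmod w \<le> 1 / 4" using w by (auto simp: dist_norm norm_minus_commute)
      then show "x \<in> cball 0 (1 / 2)" using norm_triangle_sub[of x w] by (simp add: dist_norm)
    qed
    have sub1: "cball (0::complex) (1 / 2) \<subseteq> ball 0 1" by auto
    show "g holomorphic_on ball w (1 / 4)"
      by (rule holomorphic_on_subset[OF holo]) (use sub sub1 ball_subset_cball in blast)
    show "continuous_on (cball w (1 / 4)) g" by (rule continuous_on_subset[OF cont]) (use sub sub1 in blast)
    show "cmod (g x) \<le> B" if "cmod (w - x) = 1 / 4" for x
    proof -
      have "x \<in> cball w (1 / 4)" using that by (simp add: dist_norm)
      then have "x \<in> cball 0 (1 / 2)" using sub by blast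
      then show ?thesis using B by simp
    qed
  qed simp
  show "cmod (deriv g 0) \<le> 4 * B" using bound[of 0 1] by simp
  have B0: "0 \<le> B" using B[of 0] norm_ge_zero[of "g 0"] by (metis norm_zero order_trans zero_le_divide_1_iff zero_le_numeral)
  have der: "((deriv ^^ i) g has_field_derivative (deriv ^^ Suc i) g x) (at x within cball 0 (1 / 4))"
    if "x \<in> cball 0 (1 / 4)" for i x
  proof -
    have "(deriv ^^ i) g holomorphic_on ball 0 1" using holo by (intro holomorphic_higher_deriv) auto
    moreover have "x \<in> ball 0 1" using that by auto
    ultimately have "((deriv ^^ i) g has_field_derivative deriv ((deriv ^^ i) g) x) (at x)"
      by (intro holomorphic_derivI[of _ "ball 0 1"]) auto
    then show ?thesis by (simp add: has_field_derivative_at_within)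
  qed
  have "cmod ((deriv ^^ 0) g z - (\<Sum>i\<le>1. (deriv ^^ i) g 0 * (z - 0) ^ i / fact i))
      \<le> (32 * B) * cmod (z - 0) ^ Suc 1 / fact 1"
  proof (rule complex_Taylor[where S = "cball 0 (1 / 4)"])
    show "cmod ((deriv ^^ Suc 1) g x) \<le> 32 * B" if "x \<in> cball 0 (1 / 4)" for x
      using bound[OF that, of 2] by (simp add: numeral_2_eq_2 power2_eq_square)
  qed (use der z in auto)
  then have "cmod (g z - g 0 - deriv g 0 * z) \<le> 32 * B * (cmod z)\<^sup>2"
    by (simp add: algebra_simps power2_eq_square)
  also have "\<dots> \<le> 128 * B * (cmod z)\<^sup>2" using B0 by (intro mult_right_mono) auto
  finally show "cmod (g z - g 0 - deriv g 0 * z) \<le> 128 * B * (cmod z)\<^sup>2" .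
qed

text \<open>The powers of l have a convergent subsequence; the quotients of its late terms by a
  fixed late term are powers near 1, with infinitely many exponents.\<close>

lemma unit_recurrence:
  assumes l: "cmod l = 1" and e: "e > 0"
  shows "infinite {n. cmod (l ^ n - 1) < e}"
proof -
  have "\<forall>n. l ^ n \<in> sphere 0 1" using l by (simp add: norm_power)
  then obtain L r where r: "strict_mono r" "((\<lambda>n. l ^ n) \<circ> r) \<longlonglongrightarrow> L"
    using compact_sphere[of "0::complex" 1] unfolding compact_def by blast
  have "Cauchy ((\<lambda>n. l ^ n) \<circ> r)" using r(2) by (rule LIMSEQ_imp_Cauchy)
  then obtain N where N: "\<And>m n. m \<ge> N \<Longrightarrow> n \<ge> N \<Longrightarrow> cmod (l ^ r m - l ^ r n) < e"
    using CauchyD[OF _ e] by (metis comp_apply)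
  have "r m - r N \<in> {n. cmod (l ^ n - 1) < e}" if "m \<ge> N" for m
  proof -
    have "r N \<le> r m" using r(1) that by (simp add: strict_mono_less_eq)
    then have "l ^ r m - l ^ r N = l ^ r N * (l ^ (r m - r N) - 1)"
      by (simp add: algebra_simps flip: power_add)
    then have "cmod (l ^ r m - l ^ r N) = cmod (l ^ (r m - r N) - 1)"
      using l by (simp add: norm_mult norm_power)
    then show ?thesis using N[OF that, of N] by simp
  qed
  moreover have "infinite ((\<lambda>m. r m - r N) ` {N..})"
  proof -
    have "inj_on (\<lambda>m. r m - r N) {N..}"
    proof (rule inj_onI)
      fix x y assume "x \<in> {N..}" "y \<in> {N..}" "r x - r N = r y - r N"
      moreover from this have "r N \<le> r x" "r N \<le> r y" using r(1) by (simp_all add: strict_mono_less_eq)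
      ultimately have "r x = r y" by simp
      then show "x = y" using r(1) by (simp add: strict_mono_eq)
    qed
    then show ?thesis using finite_image_iff infinite_Ici by blast
  qed
  ultimately show ?thesis by (meson finite_subset image_subsetI atLeast_iff)
qed

text \<open>The modulus of the polynomial at y is the product of the distances to the two roots.
  This covers double roots, where the implicit function theorem fails.\<close>

lemma quadratic_root_near:
  fixes y \<beta> \<gamma> :: complex
  obtains r where "r\<^sup>2 - \<beta> * r + \<gamma> = 0" "(cmod (y - r))\<^sup>2 \<le> cmod (y\<^sup>2 - \<beta> * y + \<gamma>)"
proof -
  define s where "s = csqrt (\<beta>\<^sup>2 - 4 * \<gamma>)"
  define r1 r2 where "r1 = (\<beta> + s) / 2" and "r2 = (\<beta> - s) / 2"
  have s2: "s\<^sup>2 = \<beta>\<^sup>2 - 4 * \<gamma>" by (simp add: s_def)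
  have sum: "r1 + r2 = \<beta>" by (simp add: r1_def r2_def field_simps)
  have prod: "r1 * r2 = \<gamma>" using s2 by (simp add: r1_def r2_def field_simps power2_eq_square)
  have root: "r1\<^sup>2 - \<beta> * r1 + \<gamma> = 0" "r2\<^sup>2 - \<beta> * r2 + \<gamma> = 0"
    unfolding sum[symmetric] prod[symmetric] by (simp_all add: power2_eq_square algebra_simps)
  have fac: "y\<^sup>2 - \<beta> * y + \<gamma> = (y - r1) * (y - r2)"
    unfolding sum[symmetric] prod[symmetric] by (simp add: power2_eq_square algebra_simps)
  show ?thesis
  proof (cases "cmod (y - r1) \<le> cmod (y - r2)")
    case True
    then have "(cmod (y - r1))\<^sup>2 \<le> cmod (y - r1) * cmod (y - r2)"
      unfolding power2_eq_square by (intro mult_left_mono) auto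
    then show ?thesis using that[OF root(1)] fac by (simp add: norm_mult)
  next
    case False
    then have "(cmod (y - r2))\<^sup>2 \<le> cmod (y - r1) * cmod (y - r2)"
      unfolding power2_eq_square by (intro mult_right_mono) auto
    then show ?thesis using that[OF root(2)] fac by (simp add: norm_mult)
  qed
qed

section \<open>Maximality\<close>

text \<open>An invariant open set of classes in coordinates: S is open in the ambient space, only
  its part on the level \<mu> = \<tau> + 2 of \<open>kappa\<close> matters, and mapping classes
  appear as oriented bases (u, v).\<close>

locale discontinuity_domain = trace_family +
  fixes S :: "(complex \<times> complex \<times> complex) set" and \<mu> :: complex
  assumes open_S: "open S" and mu: "\<mu> \<noteq> 4"
    and invariant: "\<And>u v p. det2 u v = 1 \<Longrightarrow> p \<in> S \<Longrightarrow> kappa p = \<mu> \<Longrightarrow> act u v p \<in> S"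
    and discontinuous: "\<And>K. compact K \<Longrightarrow> K \<subseteq> {p \<in> S. kappa p = \<mu>} \<Longrightarrow>
      finite {(u, v). det2 u v = 1 \<and> act u v ` K \<inter> K \<noteq> {}}"
begin

definition D :: "(complex \<times> complex \<times> complex) set" where "D = {p \<in> S. kappa p = \<mu>}"

lemma act_D: "det2 u v = 1 \<Longrightarrow> p \<in> D \<Longrightarrow> act u v p \<in> D"
  using invariant kappa_act by (simp add: D_def)

lemma continuous_kappa: "continuous_on UNIV kappa"
  unfolding kappa_def case_prod_beta by (intro continuous_intros)

lemma compact_ball_kappa: "compact (cball p r \<inter> {q. kappa q = \<mu>})"
  by (intro compact_Int_closed compact_cball closed_Collect_eq continuous_kappa continuous_intros)

lemma D_ball:
  assumes "p \<in> D"
  obtains r where "r > 0" "cball p r \<inter> {q. kappa q = \<mu>} \<subseteq> D"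
proof -
  obtain r where "r > 0" "cball p r \<subseteq> S"
    using assms open_S open_contains_cball unfolding D_def by blast
  then show ?thesis using that by (auto simp: D_def)
qed

text \<open>The point p may lie outside K. One element of T moves it into K, and the others,
  expressed in the basis \<open>(u0, v0)\<close>, carry this translate into K again; so infinitely
  many translates of K meet K.\<close>

lemma no_recurrence:
  assumes K: "compact K" "K \<subseteq> D" and inf: "infinite T"
    and T: "\<And>u v. (u, v) \<in> T \<Longrightarrow> det2 u v = 1 \<and> act u v p \<in> K"
  shows False
proof -
  have "T \<noteq> {}" using inf by auto
  then obtain u0 v0 where 0: "(u0, v0) \<in> T" by auto
  have det0: "det2 u0 v0 = 1" and q: "act u0 v0 p \<in> K" using T[OF 0] by auto
  define g where "g w = (det2 w v0, det2 u0 w)" for w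
  have lg: "lin u0 v0 (g w) = w" for w using lin_solve[OF det0] by (simp add: g_def)
  have "inj g" by (rule inj_on_inverseI[of _ "lin u0 v0"]) (rule lg)
  then have "inj_on (\<lambda>(u, v). (g u, g v)) T" by (auto simp: inj_on_def)
  then have "infinite ((\<lambda>(u, v). (g u, g v)) ` T)" using inf by (simp add: finite_image_iff)
  moreover have "(\<lambda>(u, v). (g u, g v)) ` T \<subseteq> {(u, v). det2 u v = 1 \<and> act u v ` K \<inter> K \<noteq> {}}"
  proof (rule image_subsetI)
    fix w assume "w \<in> T"
    then obtain u v where w: "w = (u, v)" and uv: "(u, v) \<in> T" by (cases w) auto
    have d: "det2 (g u) (g v) = 1"
      using det2_lin[of u0 v0 "g u" "g v"] T[OF uv] det0 by (simp add: lg)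
    have "act (g u) (g v) (act u0 v0 p) = act u v p"
      using act_lin[OF det0 d, of p] by (simp add: lg)
    then have "act u v p \<in> act (g u) (g v) ` K" using imageI[OF q, of "act (g u) (g v)"] by simp
    then have "act (g u) (g v) ` K \<inter> K \<noteq> {}" using T[OF uv] by blast
    then show "(case w of (u, v) \<Rightarrow> (g u, g v)) \<in> {(u, v). det2 u v = 1 \<and> act u v ` K \<inter> K \<noteq> {}}"
      using d by (simp add: w)
  qed
  ultimately have "infinite {(u, v). det2 u v = 1 \<and> act u v ` K \<inter> K \<noteq> {}}"
    using infinite_super by blast
  then show False using discontinuous K by (simp add: D_def)
qed

section \<open>Traces in the segment contradict discontinuity\<close>

lemma elliptic_perturbation:
  assumes p: "(x, y, z) \<in> D" and x: "x \<in> seg"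
  obtains t y' where "\<bar>t\<bar> < 2" "(complex_of_real t, y', z) \<in> D"
proof -
  obtain r where r: "r > 0" "cball (x, y, z) r \<inter> {q. kappa q = \<mu>} \<subseteq> D" using D_ball[OF p] by blast
  obtain s where s: "x = complex_of_real s" "\<bar>s\<bar> \<le> 2" using x by (auto simp: seg_def)
  define M where "M = cmod (z * y) + 4"
  have M: "M \<ge> 4" by (simp add: M_def)
  \<comment> \<open>1 / 2 keeps 1 - e positive, r / 4 lets x move by at most r / 2, and the last
    bound does the same for y by way of \<open>2 * e * M \<le> (r / 2)\<^sup>2\<close>.\<close>
  define e where "e = min (1 / 2) (min (r / 4) (r\<^sup>2 / (8 * M)))"
  have e: "0 < e" "e \<le> 1 / 2" "e \<le> r / 4" "e \<le> r\<^sup>2 / (8 * M)" using r M by (auto simp: e_def)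
  define t where "t = (1 - e) * s"
  have t: "\<bar>t\<bar> < 2"
  proof -
    have "(1 - e) * \<bar>s\<bar> \<le> (1 - e) * 2" using e s by (intro mult_left_mono) auto
    then show ?thesis using e by (simp add: t_def abs_mult)
  qed
  let ?x = "complex_of_real t"
  have dx: "cmod (x - ?x) \<le> 2 * e"
  proof -
    have "x - ?x = complex_of_real (e * s)" by (simp add: s t_def algebra_simps)
    then have "cmod (x - ?x) = e * \<bar>s\<bar>" using e by (simp add: norm_mult)
    also have "\<dots> \<le> e * 2" using e s by (intro mult_left_mono) auto
    finally show ?thesis by simp
  qed
  \<comment> \<open>z is kept, and y is moved to the nearer root of the equation of the surface at
    the new x; the old y almost satisfies it.\<close>
  obtain y' where y': "y'\<^sup>2 - (?x * z) * y' + (z\<^sup>2 + ?x\<^sup>2 - \<mu>) = 0"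
    "(cmod (y - y'))\<^sup>2 \<le> cmod (y\<^sup>2 - (?x * z) * y + (z\<^sup>2 + ?x\<^sup>2 - \<mu>))"
    using quadratic_root_near by blast
  have "y\<^sup>2 - (?x * z) * y + (z\<^sup>2 + ?x\<^sup>2 - \<mu>) = (x - ?x) * (z * y - x - ?x)"
  proof -
    have "\<mu> = x\<^sup>2 + y\<^sup>2 + z\<^sup>2 - x * y * z" using p by (simp add: D_def kappa_def)
    then show ?thesis by (simp add: power2_eq_square algebra_simps)
  qed
  moreover have "cmod ((x - ?x) * (z * y - x - ?x)) \<le> 2 * e * M"
  proof -
    have "cmod (z * y - x - ?x) \<le> cmod (z * y) + cmod x + cmod ?x"
      using norm_triangle_ineq4[of "z * y - x" ?x] norm_triangle_ineq4[of "z * y" x] by linarith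
    also have "\<dots> \<le> M" using s t by (simp add: M_def)
    finally show ?thesis unfolding norm_mult using dx e by (intro mult_mono) auto
  qed
  moreover have "2 * e * M \<le> (r / 2)\<^sup>2"
    using e(4) M by (simp add: field_simps power2_eq_square)
  ultimately have "(cmod (y - y'))\<^sup>2 \<le> (r / 2)\<^sup>2" using y'(2) by simp
  then have dy: "cmod (y - y') \<le> r / 2" using r by (simp add: power2_le_iff_abs_le)
  have "dist (x, y, z) (?x, y', z) \<le> cmod (x - ?x) + cmod (y - y')"
    using norm_Pair_le[of "x - ?x" "(y - y', z - z)"] norm_Pair_le[of "y - y'" "z - z"] by (simp add: dist_norm)
  also have "\<dots> \<le> r" using dx dy e(3) by simp
  finally have "(?x, y', z) \<in> cball (x, y, z) r" by simp
  moreover have "kappa (?x, y', z) = \<mu>" using y'(1) by (simp add: kappa_def algebra_simps)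
  ultimately have "(?x, y', z) \<in> D" using r(2) by blast
  then show ?thesis using that t by blast
qed

text \<open>For |t| < 2 the eigenvalues l and 1 / l of the Dehn twist about the first generator,
  acting on the two other traces, are distinct and of modulus 1. Infinitely many powers of the twist
  therefore return the point to a small compact ball around it.\<close>

lemma elliptic_not_in_D:
  assumes t: "\<bar>t\<bar> < 2"
  shows "(complex_of_real t, y, z) \<notin> D"
proof
  let ?p = "(complex_of_real t, y, z)"
  assume p: "?p \<in> D"
  obtain r where r: "r > 0" "cball ?p r \<inter> {q. kappa q = \<mu>} \<subseteq> D" using D_ball[OF p] by blast
  define l where "l = cis (arccos (t / 2))"
  have l1: "cmod l = 1" and l0: "l \<noteq> 0" by (auto simp: l_def)
  have li: "1 / l = cis (- arccos (t / 2))" unfolding l_def by (metis cis_inverse divide_inverse mult_1)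
  have ll: "l + 1 / l = complex_of_real t"
    unfolding li unfolding l_def using t by (simp add: complex_eq_iff cos_arccos_abs)
  have lm: "l - 1 / l \<noteq> 0"
  proof
    assume "l - 1 / l = 0"
    then have "Im (l - 1 / l) = 0" by simp
    then have "sin (arccos (t / 2)) = 0" unfolding li unfolding l_def by simp
    then have "sqrt (1 - (t / 2)\<^sup>2) = 0" using t by (simp add: sin_arccos_abs)
    then have "t\<^sup>2 = 2\<^sup>2" by (simp add: power_divide)
    then have "t = 2 \<or> t = -2" by (simp only: power2_eq_iff)
    then show False using t by auto
  qed
  define Y where "Y k = \<Phi> ?p (fan (1, 0) (0, 1) k)" for k
  have Y0: "Y 0 = y" "Y 1 = z" by (simp_all add: Y_def fan_def lin_def Phi_base)
  have Yrec: "Y (Suc (Suc k)) = (l + 1 / l) * Y (Suc k) - Y k" for k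
    using Phi_fan[of "(1, 0)" "(0, 1)" ?p k] by (simp add: Y_def ll Phi_base)
  define A where "A = (z - y / l) / (l - 1 / l)"
  define B where "B = (l * y - z) / (l - 1 / l)"
  have AB: "A + B = y" "A * l + B / l = z"
  proof -
    define m where "m = 1 / l"
    have lm1: "l * m = 1" and d: "l - m \<noteq> 0" using l0 lm by (simp_all add: m_def)
    have e: "A * (l - m) = z - y * m" "B * (l - m) = l * y - z"
      using d by (simp_all add: A_def B_def m_def)
    have "(A + B) * (l - m) = y * (l - m)" unfolding distrib_right e by (simp add: algebra_simps)
    then show "A + B = y" using d by simp
    have "(A * l + B * m) * (l - m) = l * (A * (l - m)) + m * (B * (l - m))" by (simp add: algebra_simps)
    also have "\<dots> = z * (l - m) - y * (l * m) + (l * m) * y" unfolding e by (simp add: algebra_simps)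
    finally have "A * l + B * m = z" using d by simp
    then show "A * l + B / l = z" by (simp add: m_def)
  qed
  have Yf: "Y k = A * l ^ k + B / l ^ k \<and> Y (Suc k) = A * l ^ Suc k + B / l ^ Suc k" for k
  proof (induction k)
    case 0 show ?case using AB Y0 by simp
  next
    case (Suc k)
    have "Y (Suc (Suc k)) = (l + 1 / l) * (A * l ^ Suc k + B / l ^ Suc k) - (A * l ^ k + B / l ^ k)"
      using Suc by (simp add: Yrec)
    also have "\<dots> = A * l ^ Suc (Suc k) + B / l ^ Suc (Suc k)" using l0 by (simp add: field_simps)
    finally show ?case using Suc by simp
  qed
  define c where "c = cmod A + cmod B"
  have diff: "cmod (Y (n + j) - Y j) \<le> c * cmod (l ^ n - 1)" for n j
  proof -
    have "Y (n + j) - Y j = A * l ^ j * (l ^ n - 1) + B / l ^ j * (1 / l ^ n - 1)"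
      using Yf[of "n + j"] Yf[of j] by (simp add: power_add algebra_simps)
    then have "cmod (Y (n + j) - Y j) \<le> cmod (A * l ^ j * (l ^ n - 1)) + cmod (B / l ^ j * (1 / l ^ n - 1))"
      by (metis norm_triangle_ineq)
    moreover have "cmod (1 / l ^ n - 1) = cmod (l ^ n - 1)"
    proof -
      have "1 / l ^ n - 1 = - (l ^ n - 1) / l ^ n" using l0 by (simp add: field_simps)
      then show ?thesis using l1 by (simp add: norm_divide norm_power norm_minus_commute)
    qed
    moreover have "cmod (A * l ^ j * (l ^ n - 1)) = cmod A * cmod (l ^ n - 1)"
      "cmod (B / l ^ j * (1 / l ^ n - 1)) = cmod B * cmod (1 / l ^ n - 1)"
      unfolding norm_mult norm_divide norm_power l1 by simp_all
    ultimately show ?thesis by (simp only: c_def distrib_right)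
  qed
  \<comment> \<open>Two coordinates move by at most c e each, and 2 c e \<le> r; the summand 1
    covers c = 0.\<close>
  define e where "e = r / (2 * c + 1)"
  have c0: "c \<ge> 0" by (simp add: c_def)
  have e: "e > 0" using r c0 by (simp add: e_def)
  define I where "I = {n. cmod (l ^ n - 1) < e}"
  have "infinite I" unfolding I_def by (rule unit_recurrence[OF l1 e])
  define T where "T = (\<lambda>n. ((1::int, 0::int), fan (1, 0) (0, 1) n)) ` I"
  have "inj_on (\<lambda>n. ((1::int, 0::int), fan (1, 0) (0, 1) n)) I"
    by (rule inj_onI) (simp add: fan_def lin_def)
  from finite_imageD[OF _ this] have "infinite T" using \<open>infinite I\<close> unfolding T_def by blast
  show False
  proof (rule no_recurrence[OF compact_ball_kappa r(2) \<open>infinite T\<close>, of ?p])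
    fix u v assume "(u, v) \<in> T"
    then obtain n where n: "n \<in> I" "u = (1, 0)" "v = fan (1, 0) (0, 1) n" by (auto simp: T_def)
    have det: "det2 u v = 1" unfolding n by simp
    have a: "act u v ?p = (complex_of_real t, Y n, Y (Suc n))"
      unfolding n act_def Y_def fan_Suc by (simp add: Phi_base)
    have d: "cmod (Y (n + j) - Y j) \<le> c * e" for j
      using order_trans[OF diff[of n j] mult_left_mono[OF _ c0, of "cmod (l ^ n - 1)" e]] n(1)
      by (simp add: I_def)
    have "dist (act u v ?p) ?p \<le> cmod (Y n - y) + cmod (Y (Suc n) - z)"
      unfolding a using norm_Pair_le[of "0::complex" "(Y n - y, Y (Suc n) - z)"]
        norm_Pair_le[of "Y n - y" "Y (Suc n) - z"] by (simp add: dist_norm)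
    also have "\<dots> \<le> 2 * c * e" using d[of 0] d[of 1] Y0 by simp
    also have "\<dots> \<le> r" using r c0 by (simp add: e_def field_simps)
    finally have "act u v ?p \<in> cball ?p r" by (simp add: dist_commute)
    then show "det2 u v = 1 \<and> act u v ?p \<in> cball ?p r \<inter> {q. kappa q = \<mu>}"
      using det kappa_act[OF det, of ?p] p by (simp add: D_def)
  qed
qed

lemma D_BQ1:
  assumes p: "p \<in> D" and u: "prim u" shows "\<Phi> p u \<notin> seg"
proof
  assume "\<Phi> p u \<in> seg"
  obtain v where det: "det2 u v = 1" using prim_complete[OF u] by blast
  have q: "(\<Phi> p u, \<Phi> p v, \<Phi> p (u + v)) \<in> D" using act_D[OF det p] by (simp add: act_def)
  show False
    by (rule elliptic_perturbation[OF q \<open>\<Phi> p u \<in> seg\<close>]) (use elliptic_not_in_D in blast)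
qed

end

section \<open>A chart of the cubic surface and its area form\<close>

context discontinuity_domain
begin

text \<open>A chart of the cubic surface: for fixed \<open>x = l + 1 / l\<close> the fibre is the hyperbola
  \<open>y = A + B\<close>, \<open>z = A l + B / l\<close> with \<open>A B = (x\<^sup>2 - \<mu>) / (x\<^sup>2 - 4)\<close>.\<close>

definition W :: "(complex \<times> complex) set" where
  "W = {c. fst c \<noteq> 0} \<inter> {c. (fst c)\<^sup>2 \<noteq> 1} \<inter> {c. snd c \<noteq> 0}"

definition Bf :: "complex \<Rightarrow> complex \<Rightarrow> complex" where
  "Bf l A = ((l + 1 / l)\<^sup>2 - \<mu>) / ((l - 1 / l)\<^sup>2 * A)"

definition chart :: "complex \<times> complex \<Rightarrow> complex \<times> complex \<times> complex" where
  "chart c = (fst c + 1 / fst c, snd c + Bf (fst c) (snd c),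
     snd c * fst c + Bf (fst c) (snd c) / fst c)"

lemma W_iff: "(l, A) \<in> W \<longleftrightarrow> l \<noteq> 0 \<and> l\<^sup>2 \<noteq> 1 \<and> A \<noteq> 0"
  by (auto simp: W_def)

lemma W_nz: "c \<in> W \<Longrightarrow> fst c \<noteq> 0 \<and> snd c \<noteq> 0 \<and> fst c - 1 / fst c \<noteq> 0"
  by (auto simp: W_def field_simps power2_eq_square)

lemma open_W: "open W"
  unfolding W_def by (intro open_Int open_Collect_neq continuous_intros)

lemma kappa_chart: "c \<in> W \<Longrightarrow> kappa (chart c) = \<mu>"
proof -
  assume c: "c \<in> W"
  obtain l A where lA: "c = (l, A)" by fastforce
  define m where "m = 1 / l"
  define B where "B = Bf l A"
  have lm: "l * m = 1" and d: "l - m \<noteq> 0" and A: "A \<noteq> 0"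
    using W_nz[OF c] by (auto simp: lA m_def)
  have "A * B * (l - m)\<^sup>2 = (l + m)\<^sup>2 - \<mu>"
    using d A by (simp add: B_def Bf_def m_def)
  moreover have "kappa (l + m, A + B, A * l + B * m) =
      (l + m)\<^sup>2 - A * B * (l - m)\<^sup>2"
  proof -
    have 1: "(A * l + B * m)\<^sup>2 = A\<^sup>2 * l\<^sup>2 + B\<^sup>2 * m\<^sup>2 + 2 * A * B * (l * m)"
      by (simp add: power2_eq_square algebra_simps)
    have 2: "(l + m) * (A + B) * (A * l + B * m) =
      A\<^sup>2 * l\<^sup>2 + A * A * (l * m) + A * B * l\<^sup>2 + A * B * m\<^sup>2 + B * B * (l * m) + B\<^sup>2 * m\<^sup>2 + 2 * A * B * (l * m)"
      by (simp add: power2_eq_square algebra_simps)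
    have 3: "A * B * (l - m)\<^sup>2 = A * B * l\<^sup>2 + A * B * m\<^sup>2 - 2 * A * B * (l * m)"
      by (simp add: power2_eq_square algebra_simps)
    show ?thesis unfolding kappa_def split_conv 1 2 3 lm by (simp add: power2_eq_square algebra_simps)
  qed
  ultimately show ?thesis by (simp add: lA chart_def B_def m_def divide_inverse)
qed

lemma continuous_chart: "continuous_on W chart"
  unfolding chart_def Bf_def
  by (intro continuous_intros) (auto dest: W_nz)

text \<open>For given l, the numbers A and B are the components of (y, z) along the eigenvectors of
  the twist. If A vanishes, replacing l by 1 / l exchanges the two; both vanish only for y = 0,
  which \<open>D_BQ1\<close> excludes because 0 lies in the segment.\<close>

lemma chart_surj:
  assumes p: "p \<in> D"
  obtains c where "c \<in> W" "chart c = p"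
proof -
  obtain x y z where xyz: "p = (x, y, z)" by (cases p)
  have k: "x\<^sup>2 + y\<^sup>2 + z\<^sup>2 - x * y * z = \<mu>" using p by (simp add: xyz D_def kappa_def)
  have "prim (1, 0)" "prim (0, 1)" by (auto simp: prim_def)
  then have ns: "x \<notin> seg" "y \<notin> seg" using D_BQ1[OF p] Phi_base by (metis xyz)+
  have "(0::complex) = complex_of_real 0" by simp
  then have "0 \<in> seg" unfolding seg_def by (intro image_eqI[of _ _ 0]) auto
  then have y0: "y \<noteq> 0" using ns by auto
  obtain l where l: "cmod l > 1" "l + 1 / l = x" using joukowski[OF ns(1)] by blast
  have key: "\<exists>c. c \<in> W \<and> chart c = p"
    if l0: "l \<noteq> 0" and l2: "l\<^sup>2 \<noteq> 1" and lx: "l + 1 / l = x" and nz: "z - y / l \<noteq> 0" for l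
  proof -
    define m where "m = 1 / l"
    have lm: "l * m = 1" using l0 by (simp add: m_def)
    have d: "l - m \<noteq> 0" using l0 l2 by (auto simp: m_def field_simps power2_eq_square)
    define A where "A = (z - y * m) / (l - m)"
    define B where "B = (l * y - z) / (l - m)"
    have A0: "A \<noteq> 0" using nz d by (simp add: A_def m_def)
    have AB: "A * (l - m) = z - y * m" "B * (l - m) = l * y - z" using d by (auto simp: A_def B_def)
    have "A * B * (l - m)\<^sup>2 = (z - y * m) * (l * y - z)"
      unfolding AB[symmetric] by (simp add: power2_eq_square)
    also have "\<dots> = (l + m) * y * z - z\<^sup>2 - y\<^sup>2 * (l * m)" by (simp add: power2_eq_square algebra_simps)
    also have "\<dots> = x * y * z - z\<^sup>2 - y\<^sup>2" using lx lm by (simp add: m_def)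
    also have "\<dots> = x\<^sup>2 - \<mu>" unfolding k[symmetric] by simp
    finally have "B * ((l - m)\<^sup>2 * A) = x\<^sup>2 - \<mu>" by (simp add: mult_ac)
    then have B: "Bf l A = B" using d A0 lx unfolding Bf_def m_def[symmetric] by (simp add: field_simps m_def)
    have "(A + B) * (l - m) = y * (l - m)" unfolding distrib_right AB by (simp add: algebra_simps)
    then have 1: "A + B = y" using d by simp
    have "(A * l + B * m) * (l - m) = l * (A * (l - m)) + m * (B * (l - m))" by (simp add: algebra_simps)
    also have "\<dots> = z * (l - m)" unfolding AB using lm by (simp add: algebra_simps)
    finally have 2: "A * l + B * m = z" using d by simp
    have "chart (l, A) = p" using 1 2 lx by (simp add: chart_def B xyz m_def)
    moreover have "(l, A) \<in> W" using l0 l2 A0 by (simp add: W_iff)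
    ultimately show ?thesis by blast
  qed
  have l0: "l \<noteq> 0" using l by auto
  have l2: "l\<^sup>2 \<noteq> 1"
  proof
    assume "l\<^sup>2 = 1"
    then have "(cmod l)\<^sup>2 = 1" by (metis norm_power norm_one)
    then show False using l(1) by (simp add: power2_eq_1_iff)
  qed
  show ?thesis
  proof (cases "z - y / l = 0")
    case False
    then show ?thesis using key[OF l0 l2 l(2)] that by blast
  next
    case True
    have "z - y / (1 / l) \<noteq> 0"
    proof
      assume "z - y / (1 / l) = 0"
      then have "y / l = y * l" using True by simp
      then have "l\<^sup>2 = 1" using y0 l0 by (simp add: field_simps power2_eq_square)
      then show False using l2 by simp
    qed
    moreover have "(1 / l)\<^sup>2 \<noteq> 1" using l2 l0 by (simp add: power_divide)
    moreover have "1 / l + 1 / (1 / l) = x" using l(2) by (simp add: add.commute)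
    ultimately show ?thesis using key[of "1 / l"] l0 that by force
  qed
qed

text \<open>Holomorphy is demanded only along complex lines through \<open>c\<close>; together with the bound of
  \<open>avoid_seg_bound\<close> this gives quadratic remainder estimates from one-variable Cauchy estimates.\<close>

definition line_holo :: "complex \<times> complex \<Rightarrow> (complex \<times> complex \<Rightarrow> complex) \<Rightarrow> complex \<Rightarrow> complex \<Rightarrow> bool" where
  "line_holo c f \<alpha> \<beta> \<longleftrightarrow> (\<forall>h k.
     (\<lambda>t. f (fst c + t * h, snd c + t * k)) holomorphic_on {t. (fst c + t * h, snd c + t * k) \<in> W} \<and>
     ((\<lambda>t. f (fst c + t * h, snd c + t * k)) has_field_derivative (\<alpha> * h + \<beta> * k)) (at 0))"

lemma line_holo_mult_diff:
  assumes f: "line_holo c f \<alpha> \<beta>" and g: "line_holo c g \<alpha>' \<beta>'" and e: "line_holo c e \<alpha>'' \<beta>''"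
  shows "line_holo c (\<lambda>c. f c * g c - e c)
    (\<alpha> * g c + f c * \<alpha>' - \<alpha>'') (\<beta> * g c + f c * \<beta>' - \<beta>'')"
  unfolding line_holo_def
proof (intro allI conjI)
  fix h k
  let ?L = "\<lambda>t. (fst c + t * h, snd c + t * k)"
  show "(\<lambda>t. f (?L t) * g (?L t) - e (?L t)) holomorphic_on {t. ?L t \<in> W}"
    using f g e unfolding line_holo_def by (intro holomorphic_intros) auto
  have "((\<lambda>t. f (?L t) * g (?L t) - e (?L t)) has_field_derivative
     (f (?L 0) * (\<alpha>' * h + \<beta>' * k) + (\<alpha> * h + \<beta> * k) * g (?L 0)) - (\<alpha>'' * h + \<beta>'' * k)) (at 0)"
    using f g e unfolding line_holo_def by (intro DERIV_diff DERIV_mult') auto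
  then show "((\<lambda>t. f (?L t) * g (?L t) - e (?L t)) has_field_derivative
     ((\<alpha> * g c + f c * \<alpha>' - \<alpha>'') * h + (\<beta> * g c + f c * \<beta>' - \<beta>'') * k)) (at 0)"
    by (simp add: algebra_simps)
qed

text \<open>The triples of functions whose gradients satisfy \<open>dx \<and> dy = \<omega> (2 z - x y)\<close> and its cyclic
  permutations; the moves preserve this relation (it expresses the invariance of the area form
  of the cubic surface).\<close>

definition area_triple :: "complex \<times> complex \<Rightarrow> complex \<Rightarrow> (complex \<times> complex \<Rightarrow> complex \<times> complex \<times> complex) \<Rightarrow> bool" where
  "area_triple c \<omega> F \<longleftrightarrow> (\<exists>a1 b1 a2 b2 a3 b3.
     line_holo c (\<lambda>c. fst (F c)) a1 b1 \<and> line_holo c (\<lambda>c. fst (snd (F c))) a2 b2 \<and>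
     line_holo c (\<lambda>c. snd (snd (F c))) a3 b3 \<and>
     a1 * b2 - a2 * b1 = \<omega> * (2 * snd (snd (F c)) - fst (F c) * fst (snd (F c))) \<and>
     a2 * b3 - a3 * b2 = \<omega> * (2 * fst (F c) - fst (snd (F c)) * snd (snd (F c))) \<and>
     a3 * b1 - a1 * b3 = \<omega> * (2 * fst (snd (F c)) - fst (F c) * snd (snd (F c))))"

lemma area_triple_moves:
  assumes "area_triple c \<omega> F"
  shows "area_triple c \<omega> (\<lambda>c. mv_add (F c))" "area_triple c \<omega> (\<lambda>c. mv_sub (F c))"
    "area_triple c \<omega> (\<lambda>c. mv_rot (F c))"
proof -
  obtain a1 b1 a2 b2 a3 b3 where l: "line_holo c (\<lambda>c. fst (F c)) a1 b1"
     "line_holo c (\<lambda>c. fst (snd (F c))) a2 b2" "line_holo c (\<lambda>c. snd (snd (F c))) a3 b3"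
    and w: "a1 * b2 - a2 * b1 = \<omega> * (2 * snd (snd (F c)) - fst (F c) * fst (snd (F c)))"
     "a2 * b3 - a3 * b2 = \<omega> * (2 * fst (F c) - fst (snd (F c)) * snd (snd (F c)))"
     "a3 * b1 - a1 * b3 = \<omega> * (2 * fst (snd (F c)) - fst (F c) * snd (snd (F c)))"
    using assms unfolding area_triple_def by blast
  let ?x = "fst (F c)" and ?y = "fst (snd (F c))" and ?z = "snd (snd (F c))"
  have m: "fst (mv_add q) = fst q" "fst (snd (mv_add q)) = snd (snd q)"
    "snd (snd (mv_add q)) = fst q * snd (snd q) - fst (snd q)"
    "fst (mv_sub q) = fst q" "fst (snd (mv_sub q)) = fst q * fst (snd q) - snd (snd q)"
    "snd (snd (mv_sub q)) = fst (snd q)"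
    "fst (mv_rot q) = fst (snd q)" "fst (snd (mv_rot q)) = fst q"
    "snd (snd (mv_rot q)) = fst q * fst (snd q) - snd (snd q)" for q
    by (cases q; simp add: mv_add_def mv_sub_def mv_rot_def)+
  have d: "line_holo c (\<lambda>c. fst (F c) * snd (snd (F c)) - fst (snd (F c)))
     (a1 * ?z + ?x * a3 - a2) (b1 * ?z + ?x * b3 - b2)"
    "line_holo c (\<lambda>c. fst (F c) * fst (snd (F c)) - snd (snd (F c)))
     (a1 * ?y + ?x * a2 - a3) (b1 * ?y + ?x * b2 - b3)"
    by (intro line_holo_mult_diff l)+
  show "area_triple c \<omega> (\<lambda>c. mv_add (F c))" unfolding area_triple_def m
    by (rule exI[of _ a1], rule exI[of _ b1], rule exI[of _ a3], rule exI[of _ b3],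
        rule exI[of _ "a1 * ?z + ?x * a3 - a2"], rule exI[of _ "b1 * ?z + ?x * b3 - b2"],
        intro conjI l d) (use w in Groebner_Basis.algebra)+
  show "area_triple c \<omega> (\<lambda>c. mv_sub (F c))" unfolding area_triple_def m
    by (rule exI[of _ a1], rule exI[of _ b1], rule exI[of _ "a1 * ?y + ?x * a2 - a3"],
        rule exI[of _ "b1 * ?y + ?x * b2 - b3"], rule exI[of _ a2], rule exI[of _ b2],
        intro conjI l d) (use w in Groebner_Basis.algebra)+
  show "area_triple c \<omega> (\<lambda>c. mv_rot (F c))" unfolding area_triple_def m
    by (rule exI[of _ a2], rule exI[of _ b2], rule exI[of _ a1], rule exI[of _ b1],
        rule exI[of _ "a1 * ?y + ?x * a2 - a3"], rule exI[of _ "b1 * ?y + ?x * b2 - b3"],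
        intro conjI l d) (use w in Groebner_Basis.algebra)+
qed

text \<open>In these coordinates the area form dx dy / (2 z - x y) becomes dl dA / (l A); this is
  the factor.\<close>

lemma area_triple_chart:
  assumes c: "c \<in> W"
  shows "area_triple c (1 / (fst c * snd c)) chart"
proof -
  obtain l A where lA: "c = (l, A)" by fastforce
  define m where "m = 1 / l"
  define B where "B = Bf l A"
  have nz: "l \<noteq> 0" "A \<noteq> 0" "l - m \<noteq> 0" using W_nz[OF c] by (auto simp: lA m_def)
  have lm: "l * m = 1" using nz by (simp add: m_def)
  \<comment> \<open>The derivative of \<open>Bf\<close> in its first argument; in the second it is -
    B / A.\<close>
  define b where "b = 2 * (l + m) * (1 - A * B) * m / (A * (l - m))"
  have holo: "(\<lambda>t. fst (chart (l + t * h, A + t * k))) holomorphic_on {t. (l + t * h, A + t * k) \<in> W}"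
     "(\<lambda>t. Bf (l + t * h) (A + t * k)) holomorphic_on {t. (l + t * h, A + t * k) \<in> W}"
     "(\<lambda>t. fst (snd (chart (l + t * h, A + t * k)))) holomorphic_on {t. (l + t * h, A + t * k) \<in> W}"
     "(\<lambda>t. snd (snd (chart (l + t * h, A + t * k)))) holomorphic_on {t. (l + t * h, A + t * k) \<in> W}" for h k
    unfolding chart_def Bf_def fst_conv snd_conv
    by (intro holomorphic_intros; auto dest: W_nz)+
  have dl: "((\<lambda>t. l + t * h) has_field_derivative h) (at 0)" for h
    by (auto intro!: derivative_eq_intros)
  have dA: "((\<lambda>t. A + t * k) has_field_derivative k) (at 0)" for k
    by (auto intro!: derivative_eq_intros)
  have dm: "((\<lambda>t. 1 / (l + t * h)) has_field_derivative (- m * m * h)) (at 0)" for h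
    using nz by (auto intro!: derivative_eq_intros simp: m_def)
  have dB: "((\<lambda>t. Bf (l + t * h) (A + t * k)) has_field_derivative (b * h + (- B / A) * k)) (at 0)" for h k
  proof -
    define P where "P = (l + m)\<^sup>2 - \<mu>"
    define Q where "Q = (l - m)\<^sup>2"
    have Q: "Q \<noteq> 0" using nz by (simp add: Q_def)
    have PB: "P = B * (Q * A)" using nz Q by (simp add: P_def Q_def B_def Bf_def m_def)
    have i1: "h + - m * m * h = m * (l - m) * h"
      using lm by (simp add: algebra_simps)
    have i2: "h - - m * m * h = m * (l + m) * h"
      using lm by (simp add: algebra_simps)
    let ?p = "\<lambda>t. l + t * h + 1 / (l + t * h)" and ?q = "\<lambda>t. l + t * h - 1 / (l + t * h)"
    have dp: "(?p has_field_derivative m * (l - m) * h) (at 0)"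
      using DERIV_add[OF dl dm, of h h] unfolding i1 .
    have dq: "(?q has_field_derivative m * (l + m) * h) (at 0)"
      using DERIV_diff[OF dl dm, of h h] unfolding i2 .
    have pq0: "?p 0 = l + m" "?q 0 = l - m" by (simp_all add: m_def)
    have dP: "((\<lambda>t. ?p t * ?p t - \<mu>) has_field_derivative 2 * (l + m) * (m * (l - m) * h)) (at 0)"
      using DERIV_diff[OF DERIV_mult'[OF dp dp] DERIV_const[of \<mu>]] unfolding pq0
      by (rule DERIV_cong) (simp add: algebra_simps)
    have dQA: "((\<lambda>t. ?q t * ?q t * (A + t * k)) has_field_derivative
        2 * (l - m) * (m * (l + m) * h) * A + Q * k) (at 0)"
      using DERIV_mult'[OF DERIV_mult'[OF dq dq] dA[of k]] unfolding pq0
      by (rule DERIV_cong) (simp add: algebra_simps Q_def power2_eq_square)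
    have "?q 0 * ?q 0 * (A + 0 * k) \<noteq> 0" unfolding pq0 using nz by simp
    from DERIV_divide[OF dP dQA this]
    have "((\<lambda>t. (?p t * ?p t - \<mu>) / (?q t * ?q t * (A + t * k))) has_field_derivative
      ((2 * (l + m) * (m * (l - m) * h)) * (Q * A) - P * (2 * (l - m) * (m * (l + m) * h) * A + Q * k)) / (Q * A)\<^sup>2) (at 0)"
      unfolding pq0 by (rule DERIV_cong) (simp add: P_def Q_def power2_eq_square)
    also have "((2 * (l + m) * (m * (l - m) * h)) * (Q * A) - P * (2 * (l - m) * (m * (l + m) * h) * A + Q * k)) / (Q * A)\<^sup>2
      = b * h + (- B / A) * k"
    proof -
      have "(2 * (l + m) * (m * (l - m) * h)) * (Q * A) - P * (2 * (l - m) * (m * (l + m) * h) * A + Q * k)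
        = (Q * A) * (2 * (l + m) * (l - m) * m * h * (1 - A * B) - B * Q * k)"
        unfolding PB by (simp add: algebra_simps)
      then have "((2 * (l + m) * (m * (l - m) * h)) * (Q * A) - P * (2 * (l - m) * (m * (l + m) * h) * A + Q * k)) / (Q * A)\<^sup>2
        = (2 * (l + m) * (l - m) * m * h * (1 - A * B) - B * Q * k) / (Q * A)"
        using Q nz by (simp add: power2_eq_square)
      also have "\<dots> = b * h + (- B / A) * k"
        using Q nz unfolding b_def Q_def power2_eq_square by (simp add: divide_simps) (simp add: algebra_simps)
      finally show ?thesis .
    qed
    finally show ?thesis unfolding Bf_def power2_eq_square .
  qed
  have L1: "line_holo c (\<lambda>c. fst (chart c)) (1 - m * m) 0"
    unfolding line_holo_def lA fst_conv snd_conv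
  proof (intro allI conjI holo)
    fix h k :: complex
    show "((\<lambda>t. fst (chart (l + t * h, A + t * k))) has_field_derivative (1 - m * m) * h + 0 * k) (at 0)"
      unfolding chart_def fst_conv snd_conv
      by (rule DERIV_cong, rule DERIV_add[OF dl dm]) (simp add: algebra_simps)
  qed
  have L2: "line_holo c (\<lambda>c. fst (snd (chart c))) b (1 - B / A)"
    unfolding line_holo_def lA fst_conv snd_conv
  proof (intro allI conjI holo)
    fix h k :: complex
    show "((\<lambda>t. fst (snd (chart (l + t * h, A + t * k)))) has_field_derivative b * h + (1 - B / A) * k) (at 0)"
      unfolding chart_def fst_conv snd_conv
      by (rule DERIV_cong, rule DERIV_add[OF dA dB]) (simp add: algebra_simps)
  qed
  have L3: "line_holo c (\<lambda>c. snd (snd (chart c))) (A + b * m - B * m * m) (l - B / A * m)"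
    unfolding line_holo_def lA fst_conv snd_conv
  proof (intro allI conjI holo)
    fix h k :: complex
    have "((\<lambda>t. Bf (l + t * h) (A + t * k) * (1 / (l + t * h))) has_field_derivative
        Bf (l + 0 * h) (A + 0 * k) * (- m * m * h) + (b * h + (- B / A) * k) * (1 / (l + 0 * h))) (at 0)"
      by (rule DERIV_mult'[OF dB dm])
    then have "((\<lambda>t. Bf (l + t * h) (A + t * k) * (1 / (l + t * h))) has_field_derivative
        B * (- m * m * h) + (b * h + (- B / A) * k) * m) (at 0)"
      by (simp add: B_def m_def)
    then have "((\<lambda>t. (A + t * k) * (l + t * h) + Bf (l + t * h) (A + t * k) * (1 / (l + t * h))) has_field_derivative
        ((A + 0 * k) * h + k * (l + 0 * h)) + (B * (- m * m * h) + (b * h + (- B / A) * k) * m)) (at 0)"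
      by (intro DERIV_add DERIV_mult' dA dl)
    then have "((\<lambda>t. (A + t * k) * (l + t * h) + Bf (l + t * h) (A + t * k) / (l + t * h)) has_field_derivative
        (A + b * m - B * m * m) * h + (l - B / A * m) * k) (at 0)"
      by (simp add: algebra_simps)
    then show "((\<lambda>t. snd (snd (chart (l + t * h, A + t * k)))) has_field_derivative
        (A + b * m - B * m * m) * h + (l - B / A * m) * k) (at 0)"
      unfolding chart_def fst_conv snd_conv .
  qed
  have ch: "fst (chart c) = l + m" "fst (snd (chart c)) = A + B" "snd (snd (chart c)) = A * l + B * m"
    by (simp_all add: chart_def lA B_def m_def)
  have om: "1 / (fst c * snd c) = m / A" by (simp add: lA m_def)
  define D where "D = B / A"
  have BD: "B = A * D" using nz by (simp add: D_def)
  have bA: "b * (l - m) = 2 * (l + m) * (1 / A - B) * m" using nz by (simp add: b_def field_simps)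
  have bl: "b * (l\<^sup>2 - 1) = 2 * (l + m) * (1 / A - B)"
  proof -
    have "l\<^sup>2 - 1 = l * (l - m)" using lm by (simp add: power2_eq_square algebra_simps)
    then have "b * (l\<^sup>2 - 1) = l * (b * (l - m))" by simp
    also have "\<dots> = (l * m) * (2 * (l + m) * (1 / A - B))" unfolding bA by (simp add: mult_ac)
    finally show ?thesis using lm by simp
  qed
  have ll: "l * (m * x) = x" for x using lm by (metis mult.assoc mult_1)
  show ?thesis unfolding area_triple_def ch om
  proof (rule exI[of _ "1 - m * m"], rule exI[of _ 0], rule exI[of _ b], rule exI[of _ "1 - B / A"],
      rule exI[of _ "A + b * m - B * m * m"], rule exI[of _ "l - B / A * m"], intro conjI L1 L2 L3)
    show "(1 - m * m) * (1 - B / A) - b * 0 = m / A * (2 * (A * l + B * m) - (l + m) * (A + B))"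
    proof -
      have "2 * (A * l + B * m) - (l + m) * (A + B) = A * ((l - m) * (1 - D))"
        unfolding BD by (simp add: algebra_simps)
      then have "m / A * (2 * (A * l + B * m) - (l + m) * (A + B)) = m * (l - m) * (1 - D)"
        using nz by simp
      also have "m * (l - m) = 1 - m * m" using lm by (simp add: algebra_simps)
      finally show ?thesis by (simp add: D_def)
    qed
    show "(A + b * m - B * m * m) * 0 - (1 - m * m) * (l - B / A * m) =
      m / A * (2 * (A + B) - (l + m) * (A * l + B * m))"
    proof -
      have "2 * (A + B) - (l + m) * (A * l + B * m) = A * (2 + 2 * D - l * l - D * (l * m) - l * m - D * m * m)"
        unfolding BD by (simp add: algebra_simps)
      also have "\<dots> = A * (1 + D - l * l - D * m * m)" unfolding lm by simp
      finally have "m / A * (2 * (A + B) - (l + m) * (A * l + B * m)) = m * (1 + D - l * l - D * m * m)"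
        using nz by simp
      also have "\<dots> = m + m * D - (l * m) * l - D * m * m * m" by (simp add: algebra_simps)
      also have "\<dots> = m + (m * D) - l - D * m * m * m" unfolding lm by simp
      also have "\<dots> = - ((1 - m * m) * (l - D * m))"
      proof -
        have "(1 - m * m) * (l - D * m) = l - D * m - m * (l * m) + D * m * m * m" by (simp add: algebra_simps)
        then show ?thesis unfolding lm by simp
      qed
      finally show ?thesis by (simp add: D_def)
    qed
    show "b * (l - B / A * m) - (A + b * m - B * m * m) * (1 - B / A) =
      m / A * (2 * (l + m) - (A + B) * (A * l + B * m))"
    proof -
      have "l * (b * (l - D * m) - (A + b * m - B * m * m) * (1 - D))
        = b * (l\<^sup>2 - (l * m)) - A * l * (1 - D) + B * m * (l * m) * (1 - D)
          + b * (D * (l * m) - (l * m) * D) "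
        by (simp add: power2_eq_square algebra_simps)
      also have "\<dots> = b * (l\<^sup>2 - 1) - (A * l - B * m) * (1 - D)" unfolding lm by (simp add: algebra_simps)
      also have "\<dots> = 2 * (l + m) * (1 / A - B) - (A * l - B * m) * (1 - D)" unfolding bl ..
      also have "\<dots> = (1 / A) * (2 * (l + m) - (A + B) * (A * l + B * m))"
      proof -
        have "A * (2 * (l + m) * (1 / A - B) - (A * l - B * m) * (1 - D)) = 2 * (l + m) * (1 - A * B) - (A * l - B * m) * (A - B)"
        proof -
          have q: "A * (1 / A - B) = 1 - A * B" "A * (1 - D) = A - B"
            using nz by (simp_all add: D_def algebra_simps)
          have "A * (2 * (l + m) * (1 / A - B) - (A * l - B * m) * (1 - D))
            = 2 * (l + m) * (A * (1 / A - B)) - (A * l - B * m) * (A * (1 - D))"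
            by (simp only: right_diff_distrib mult_ac)
          then show ?thesis unfolding q .
        qed
        also have "\<dots> = 2 * (l + m) - (A + B) * (A * l + B * m)" by (simp add: algebra_simps)
        finally have "A * (2 * (l + m) * (1 / A - B) - (A * l - B * m) * (1 - D))
          = 2 * (l + m) - (A + B) * (A * l + B * m)" .
        then show ?thesis using nz by (metis nonzero_mult_div_cancel_left times_divide_eq_left mult_1)
      qed
      finally have "m * (l * (b * (l - D * m) - (A + b * m - B * m * m) * (1 - D))) =
        m / A * (2 * (l + m) - (A + B) * (A * l + B * m))" by simp
      then show ?thesis using ll by (simp add: D_def mult.left_commute)
    qed
  qed
qed

text \<open>The factor is the same for all (u, v), so the Jacobian of two coordinates of a translate
  is known from its three values, whatever the mapping class.\<close>

lemma area_triple_act: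
  assumes "c \<in> W" "det2 u v = 1"
  shows "area_triple c (1 / (fst c * snd c)) (\<lambda>c. act u v (chart c))"
  using assms(2)
proof (induction rule: act_induct)
  case base show ?case using area_triple_chart[OF assms(1)] .
qed (rule area_triple_moves, assumption)+

end

section \<open>Uniform estimates in the chart, and an open mapping argument\<close>

lemma norm_scaled_pair: "norm (t * a, t * b) = cmod t * norm (a, b)" for t a b :: complex
  by (simp add: norm_Pair norm_mult power_mult_distrib real_sqrt_mult flip: distrib_left)

context discontinuity_domain
begin

text \<open>C depends only on r and on a bound at the centre, so it serves all mapping classes whose
  translates of the centre are bounded. Directions are normalized and scaled by r, which turns the
  part of a complex line inside the ball into the unit disk.\<close>

lemma line_holo_estimate:
  assumes r: "r > 0" and ball: "ball c r \<subseteq> W" and f: "line_holo c f \<alpha> \<beta>"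
    and avoid: "\<And>c'. c' \<in> ball c r \<Longrightarrow> f c' \<notin> seg" and M: "cmod (f c) \<le> M"
  defines "B \<equiv> 1 + (M + 1) ^ 3"
  defines "C \<equiv> 128 * B / r\<^sup>2 + 4 * B / r"
  shows "cmod \<alpha> \<le> C" and "cmod \<beta> \<le> C"
    and "norm h \<le> r / 4 \<Longrightarrow> cmod (f (c + h) - f c - (\<alpha> * fst h + \<beta> * snd h)) \<le> C * (norm h)\<^sup>2"
proof -
  have M0: "M \<ge> 0" using M norm_ge_zero order_trans by blast
  have B0: "B \<ge> 0" using M0 by (simp add: B_def)
  have CB: "128 * B / r\<^sup>2 \<le> C" "4 * B / r \<le> C" using B0 r by (auto simp: C_def)
  have key: "cmod (\<alpha> * fst e + \<beta> * snd e) \<le> 4 * B / r \<and>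
     (cmod z \<le> 1 / 4 \<longrightarrow> cmod (f (fst c + z * (of_real r * fst e), snd c + z * (of_real r * snd e)) - f c
        - of_real r * (\<alpha> * fst e + \<beta> * snd e) * z) \<le> 128 * B * (cmod z)\<^sup>2)"
    if e: "norm e = 1" for e :: "complex \<times> complex" and z :: complex
  proof -
    let ?g = "\<lambda>t. f (fst c + t * (of_real r * fst e), snd c + t * (of_real r * snd e))"
    have inb: "(fst c + t * (of_real r * fst e), snd c + t * (of_real r * snd e)) \<in> ball c r"
      if "t \<in> ball 0 1" for t
    proof -
      have "dist c (fst c + t * (of_real r * fst e), snd c + t * (of_real r * snd e))
        = norm ((t * of_real r) * fst e, (t * of_real r) * snd e)"
        unfolding dist_commute[of c] by (cases c) (simp add: dist_norm mult.assoc)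
      also have "\<dots> = cmod (t * of_real r)" unfolding norm_scaled_pair using e by simp
      also have "\<dots> < r" using that r by (simp add: norm_mult)
      finally show ?thesis by simp
    qed
    have "?g holomorphic_on {t. (fst c + t * (of_real r * fst e), snd c + t * (of_real r * snd e)) \<in> W}"
      using f unfolding line_holo_def by blast
    then have holo: "?g holomorphic_on ball 0 1"
      by (rule holomorphic_on_subset) (use inb ball in blast)
    have g0: "?g 0 = f c" by simp
    have der: "deriv ?g 0 = of_real r * (\<alpha> * fst e + \<beta> * snd e)"
    proof -
      have "(?g has_field_derivative (\<alpha> * (of_real r * fst e) + \<beta> * (of_real r * snd e))) (at 0)"
        using f unfolding line_holo_def by blast
      from DERIV_imp_deriv[OF this] show ?thesis by (simp add: algebra_simps)
    qed
    have bound: "cmod (?g t) \<le> B" if "cmod t \<le> 1 / 2" for t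
      unfolding B_def by (rule avoid_seg_bound[OF holo _ _ that]) (use avoid inb M in auto)
    have "cmod (of_real r * (\<alpha> * fst e + \<beta> * snd e)) \<le> 4 * B"
      using quadratic_remainder(2)[OF holo bound, of 0] unfolding der by simp
    then have "cmod (\<alpha> * fst e + \<beta> * snd e) \<le> 4 * B / r"
    proof -
      assume "cmod (of_real r * (\<alpha> * fst e + \<beta> * snd e)) \<le> 4 * B"
      then have "r * cmod (\<alpha> * fst e + \<beta> * snd e) \<le> 4 * B"
        using r by (simp only: norm_mult norm_of_real abs_of_pos)
      then show ?thesis unfolding pos_le_divide_eq[OF r] by (simp only: mult.commute)
    qed
    then show ?thesis using quadratic_remainder(1)[OF holo bound, of z] unfolding der g0 by blast
  qed
  have "cmod \<alpha> \<le> 4 * B / r" using key[of "(1, 0)" 0] by (simp add: norm_Pair)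
  then show "cmod \<alpha> \<le> C" using CB by linarith
  have "cmod \<beta> \<le> 4 * B / r" using key[of "(0, 1)" 0] by (simp add: norm_Pair)
  then show "cmod \<beta> \<le> C" using CB by linarith
  show "cmod (f (c + h) - f c - (\<alpha> * fst h + \<beta> * snd h)) \<le> C * (norm h)\<^sup>2" if h: "norm h \<le> r / 4"
  proof (cases "h = 0")
    case True then show ?thesis by simp
  next
    case False
    define n where "n = norm h"
    have n: "n > 0" using False by (simp add: n_def)
    define e where "e = (fst h / of_real n, snd h / of_real n)"
    define z where "z = complex_of_real (n / r)"
    have "e = (of_real (1 / n) * fst h, of_real (1 / n) * snd h)" by (simp add: e_def)
    then have e1: "norm e = 1" using norm_scaled_pair[of "of_real (1 / n)" "fst h" "snd h"] n
      by (simp add: norm_divide n_def)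
    have nz: "cmod z = n / r" using n r by (simp add: z_def norm_divide)
    have z4: "cmod z \<le> 1 / 4" unfolding nz using h r by (simp add: n_def field_simps)
    have s: "z * (of_real r * fst e) = fst h" "z * (of_real r * snd e) = snd h"
      using n r by (simp_all add: z_def e_def)
    have s2: "of_real r * (\<alpha> * fst e + \<beta> * snd e) * z = \<alpha> * fst h + \<beta> * snd h"
      unfolding s[symmetric] by (simp add: algebra_simps)
    have "cmod (f (c + h) - f c - (\<alpha> * fst h + \<beta> * snd h)) \<le> 128 * B * (n / r)\<^sup>2"
      using key[OF e1, of z] z4 unfolding s s2 nz by (simp add: plus_prod_def)
    also have "\<dots> = 128 * B / r\<^sup>2 * n\<^sup>2" by (simp add: power_divide)
    also have "\<dots> \<le> C * n\<^sup>2" using CB by (intro mult_right_mono) auto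
    finally show ?thesis by (simp add: n_def)
  qed
qed

text \<open>Brouwer's theorem for \<open>h \<mapsto> h - L\<inverse> (F (c + h) - q)\<close>, where \<open>L\<close> is the linear part of \<open>F\<close>.\<close>

lemma quantitative_surjectivity:
  fixes fx fy :: "complex \<times> complex \<Rightarrow> complex"
  assumes rho: "\<rho> > 0" and cont: "continuous_on (cball c \<rho>) fx" "continuous_on (cball c \<rho>) fy"
    and fx: "\<And>h. norm h \<le> \<rho> \<Longrightarrow> cmod (fx (c + h) - fx c - (a1 * fst h + b1 * snd h)) \<le> C * (norm h)\<^sup>2"
    and fy: "\<And>h. norm h \<le> \<rho> \<Longrightarrow> cmod (fy (c + h) - fy c - (a2 * fst h + b2 * snd h)) \<le> C * (norm h)\<^sup>2"
    and ab: "cmod a1 \<le> C" "cmod b1 \<le> C" "cmod a2 \<le> C" "cmod b2 \<le> C"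
    and J: "0 < j" "j \<le> cmod (a1 * b2 - a2 * b1)" and C: "C > 0" and small: "8 * C\<^sup>2 * \<rho> \<le> j"
    and xy: "cmod (fx c - x) \<le> C * \<rho>\<^sup>2" "cmod (fy c - y) \<le> C * \<rho>\<^sup>2"
  obtains h where "norm h \<le> \<rho>" "fx (c + h) = x" "fy (c + h) = y"
proof -
  define K where "K = a1 * b2 - a2 * b1"
  have K: "K \<noteq> 0" "cmod K \<ge> j" using J by (auto simp: K_def)
  define s t where "s h = fx (c + h) - x" and "t h = fy (c + h) - y" for h
  \<comment> \<open>The inverse of the linear part by Cramer's rule, with K its determinant; a fixed
    point of T solves both equations.\<close>
  define T where "T h = (fst h - (b2 * s h - b1 * t h) / K, snd h - (a1 * t h - a2 * s h) / K)" for h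
  have im: "(+) c ` cball 0 \<rho> \<subseteq> cball c \<rho>" by (auto simp: dist_norm)
  have cs: "continuous_on (cball 0 \<rho>) (\<lambda>h. fx (c + h))" "continuous_on (cball 0 \<rho>) (\<lambda>h. fy (c + h))"
    by (rule continuous_on_compose2[OF cont(1) _ im] continuous_on_compose2[OF cont(2) _ im];
        intro continuous_intros)+
  have cT: "continuous_on (cball 0 \<rho>) T"
    unfolding T_def s_def t_def using K cs by (intro continuous_intros) auto
  have mapsto: "T h \<in> cball 0 \<rho>" if "h \<in> cball 0 \<rho>" for h
  proof -
    have h: "norm h \<le> \<rho>" using that by simp
    define s' t' where "s' = s h - (a1 * fst h + b1 * snd h)" and "t' = t h - (a2 * fst h + b2 * snd h)"
    have h2: "C * (norm h)\<^sup>2 \<le> C * \<rho>\<^sup>2" using h C by (intro mult_left_mono power_mono) auto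
    have st: "cmod s' \<le> 2 * C * \<rho>\<^sup>2" "cmod t' \<le> 2 * C * \<rho>\<^sup>2"
    proof -
      have "s' = (fx (c + h) - fx c - (a1 * fst h + b1 * snd h)) + (fx c - x)" by (simp add: s'_def s_def)
      then show "cmod s' \<le> 2 * C * \<rho>\<^sup>2"
        using fx[OF h] xy(1) h2 norm_triangle_ineq[of "fx (c + h) - fx c - (a1 * fst h + b1 * snd h)" "fx c - x"]
        by simp
      have "t' = (fy (c + h) - fy c - (a2 * fst h + b2 * snd h)) + (fy c - y)" by (simp add: t'_def t_def)
      then show "cmod t' \<le> 2 * C * \<rho>\<^sup>2"
        using fy[OF h] xy(2) h2 norm_triangle_ineq[of "fy (c + h) - fy c - (a2 * fst h + b2 * snd h)" "fy c - y"]
        by simp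
    qed
    have sh: "s h = s' + (a1 * fst h + b1 * snd h)" "t h = t' + (a2 * fst h + b2 * snd h)"
      by (simp_all add: s'_def t'_def)
    have "b2 * s h - b1 * t h = K * fst h + (b2 * s' - b1 * t')"
      "a1 * t h - a2 * s h = K * snd h + (a1 * t' - a2 * s')"
      unfolding sh K_def by (simp_all add: algebra_simps)
    then have Th: "T h = (- ((b2 * s' - b1 * t') / K), - ((a1 * t' - a2 * s') / K))"
      using K(1) by (simp add: T_def add_divide_distrib)
    have comp: "cmod ((p * s' - q * t') / K) \<le> \<rho> / 2" "cmod ((p * t' - q * s') / K) \<le> \<rho> / 2"
      if "cmod p \<le> C" "cmod q \<le> C" for p q
    proof -
      have b: "cmod p * cmod s' \<le> C * (2 * C * \<rho>\<^sup>2)" "cmod q * cmod t' \<le> C * (2 * C * \<rho>\<^sup>2)"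
        "cmod p * cmod t' \<le> C * (2 * C * \<rho>\<^sup>2)" "cmod q * cmod s' \<le> C * (2 * C * \<rho>\<^sup>2)"
        using that st C by (intro mult_mono; simp)+
      \<comment> \<open>Here the smallness of \<rho> enters: two terms of size 2 C^2 \<rho>^2,
        divided by K, give at most \<rho> / 2 for each component.\<close>
      have "4 * C\<^sup>2 * \<rho>\<^sup>2 \<le> \<rho> / 2 * j"
        using mult_right_mono[OF small, of "\<rho> / 2"] rho by (simp add: power2_eq_square algebra_simps)
      also have "\<dots> \<le> \<rho> / 2 * cmod K" using K rho by (intro mult_left_mono) auto
      finally have k: "4 * C\<^sup>2 * \<rho>\<^sup>2 \<le> \<rho> / 2 * cmod K" .
      have "cmod (p * s' - q * t') \<le> cmod p * cmod s' + cmod q * cmod t'"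
        "cmod (p * t' - q * s') \<le> cmod p * cmod t' + cmod q * cmod s'"
        using norm_triangle_ineq4 by (metis norm_mult)+
      then have "cmod (p * s' - q * t') \<le> \<rho> / 2 * cmod K" "cmod (p * t' - q * s') \<le> \<rho> / 2 * cmod K"
        using b k by (simp_all add: power2_eq_square)
      then show "cmod ((p * s' - q * t') / K) \<le> \<rho> / 2" "cmod ((p * t' - q * s') / K) \<le> \<rho> / 2"
        using K(1) by (simp_all add: norm_divide divide_le_eq)
    qed
    have "norm (T h) \<le> cmod ((b2 * s' - b1 * t') / K) + cmod ((a1 * t' - a2 * s') / K)"
      unfolding Th using norm_Pair_le[of "- ((b2 * s' - b1 * t') / K)" "- ((a1 * t' - a2 * s') / K)"]
      by (simp only: norm_minus_cancel)
    then have "norm (T h) \<le> \<rho> / 2 + \<rho> / 2" using comp(1)[OF ab(4,2)] comp(2)[OF ab(1,3)] by linarith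
    then show ?thesis by simp
  qed
  obtain h where h: "h \<in> cball 0 \<rho>" "T h = h"
    using brouwer_ball[OF rho cT] mapsto by blast
  have z: "b2 * s h - b1 * t h = 0" "a1 * t h - a2 * s h = 0"
    using h(2) K(1) unfolding T_def by (auto simp: prod_eq_iff)
  have "K * s h = a1 * (b2 * s h - b1 * t h) + b1 * (a1 * t h - a2 * s h)"
    "K * t h = a2 * (b2 * s h - b1 * t h) + b2 * (a1 * t h - a2 * s h)"
    by (simp_all add: K_def algebra_simps)
  then have "s h = 0" "t h = 0" unfolding z using K(1) by simp_all
  then show ?thesis using that[of h] h(1) by (simp add: s_def t_def)
qed

section \<open>Limit points of an orbit\<close>

lemma kappa_limit:
  assumes p: "p \<in> D" and det: "\<And>n. det2 (u n) (v n) = 1"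
    and lim: "(\<lambda>n. act (u n) (v n) p) \<longlonglongrightarrow> q"
  shows "kappa q = \<mu>"
proof -
  have "(\<lambda>n. kappa (act (u n) (v n) p)) \<longlonglongrightarrow> kappa q"
    using continuous_on_tendsto_compose[OF continuous_kappa lim] by simp
  moreover have "(\<lambda>n. kappa (act (u n) (v n) p)) = (\<lambda>n. \<mu>)"
    using kappa_act[OF det] p by (simp add: D_def)
  ultimately have "(\<lambda>n::nat. \<mu>) \<longlonglongrightarrow> kappa q" by simp
  from LIMSEQ_unique[OF this tendsto_const] show ?thesis .
qed

text \<open>A late mapping class takes the values x and y exactly at some point of a fixed
  neighbourhood of p, because its Jacobian is bounded below where 2 z - x y is. On the surface the
  third value can then only be z or x y - z. These differ by 2 z - x y, and the third value is
  closer to z than that.\<close>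

lemma limit_in_D:
  assumes p: "p \<in> D" and det: "\<And>n. det2 (u n) (v n) = 1"
    and lim: "(\<lambda>n. act (u n) (v n) p) \<longlonglongrightarrow> (x, y, z)" and d: "2 * z - x * y \<noteq> 0"
  shows "(x, y, z) \<in> D"
proof -
  obtain c where c: "c \<in> W" "chart c = p" using chart_surj[OF p] by blast
  obtain r where r: "r > 0" "ball c r \<subseteq> W" "chart ` ball c r \<subseteq> D"
  proof -
    obtain S0 where S0: "open S0" "S0 \<inter> W = chart -` S \<inter> W"
      using continuous_chart open_S unfolding continuous_on_open_invariant by blast
    have "p \<in> S" using p by (simp add: D_def)
    then have "c \<in> S0 \<inter> W" using S0 c by auto
    then obtain r where "r > 0" "ball c r \<subseteq> S0 \<inter> W"
      using open_Int[OF S0(1) open_W] open_contains_ball by metis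
    moreover from this have "chart ` ball c r \<subseteq> D" using S0 kappa_chart by (fastforce simp: D_def)
    ultimately show ?thesis using that by blast
  qed
  have lims: "(\<lambda>n. \<Phi> p (u n)) \<longlonglongrightarrow> x" "(\<lambda>n. \<Phi> p (v n)) \<longlonglongrightarrow> y" "(\<lambda>n. \<Phi> p (u n + v n)) \<longlonglongrightarrow> z"
    using tendsto_fst[OF lim] tendsto_fst[OF tendsto_snd[OF lim]] tendsto_snd[OF tendsto_snd[OF lim]]
    by (simp_all add: act_def)
  define M where "M = cmod x + cmod y + cmod z + 1"
  define B where "B = 1 + (M + 1) ^ 3"
  define C where "C = 128 * B / r\<^sup>2 + 4 * B / r"
  have "M \<ge> 1" by (simp add: M_def)
  then have "B > 0" by (simp add: B_def add_pos_nonneg)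
  then have C: "C > 0" using r by (simp add: C_def add_pos_pos)
  define \<omega> where "\<omega> = 1 / (fst c * snd c)"
  have om: "\<omega> \<noteq> 0" using W_nz[OF c(1)] by (simp add: \<omega>_def)
  define e where "e = cmod (2 * z - x * y)"
  have e: "e > 0" using d by (simp add: e_def)
  define j where "j = cmod \<omega> * (e / 2)"
  have j: "j > 0" using om e by (simp add: j_def)
  \<comment> \<open>In order: the range of the remainder estimate, \<rho>^2 \<le> \<rho>, the
    smallness required by \<open>quantitative_surjectivity\<close>, and 4 C \<rho> \<le> e / 2 to
    tell z from x y - z.\<close>
  define \<rho> where "\<rho> = min (r / 4) (min 1 (min (j / (8 * C\<^sup>2)) (e / (8 * C))))"
  have rho: "\<rho> > 0" "\<rho> \<le> r / 4" "\<rho> \<le> 1" "\<rho> \<le> j / (8 * C\<^sup>2)" "\<rho> \<le> e / (8 * C)"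
    using r j e C by (auto simp: \<rho>_def)
  define \<epsilon> where "\<epsilon> = min 1 (C * \<rho>\<^sup>2)"
  have eps: "\<epsilon> > 0" "\<epsilon> \<le> 1" "\<epsilon> \<le> C * \<rho>\<^sup>2" using C rho by (auto simp: \<epsilon>_def)
  have "(\<lambda>n. cmod (2 * \<Phi> p (u n + v n) - \<Phi> p (u n) * \<Phi> p (v n))) \<longlonglongrightarrow> e"
    unfolding e_def by (intro tendsto_norm tendsto_diff tendsto_mult tendsto_const lims)
  then have "\<forall>\<^sub>F n in sequentially. cmod (2 * \<Phi> p (u n + v n) - \<Phi> p (u n) * \<Phi> p (v n)) > e / 2"
    using e by (intro order_tendstoD(1)) auto
  moreover have "\<forall>\<^sub>F n in sequentially. dist (\<Phi> p (u n)) x < \<epsilon>" "\<forall>\<^sub>F n in sequentially. dist (\<Phi> p (v n)) y < \<epsilon>"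
    "\<forall>\<^sub>F n in sequentially. dist (\<Phi> p (u n + v n)) z < \<epsilon>"
    using lims eps(1) by (auto intro: tendstoD)
  ultimately have "\<forall>\<^sub>F n in sequentially. cmod (2 * \<Phi> p (u n + v n) - \<Phi> p (u n) * \<Phi> p (v n)) > e / 2 \<and>
    dist (\<Phi> p (u n)) x < \<epsilon> \<and> dist (\<Phi> p (v n)) y < \<epsilon> \<and> dist (\<Phi> p (u n + v n)) z < \<epsilon>"
    by (intro eventually_conj)
  then obtain n where n: "cmod (2 * \<Phi> p (u n + v n) - \<Phi> p (u n) * \<Phi> p (v n)) > e / 2"
    "cmod (\<Phi> p (u n) - x) < \<epsilon>" "cmod (\<Phi> p (v n) - y) < \<epsilon>" "cmod (\<Phi> p (u n + v n) - z) < \<epsilon>"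
    unfolding dist_norm using eventually_happens by fastforce
  define fx fy fz where "fx c = \<Phi> (chart c) (u n)" and "fy c = \<Phi> (chart c) (v n)"
    and "fz c = \<Phi> (chart c) (u n + v n)" for c
  have act: "act (u n) (v n) (chart c') = (fx c', fy c', fz c')" for c'
    by (simp add: act_def fx_def fy_def fz_def)
  have fc: "fx c = \<Phi> p (u n)" "fy c = \<Phi> p (v n)" "fz c = \<Phi> p (u n + v n)"
    by (simp_all add: fx_def fy_def fz_def c(2))
  obtain a1 b1 a2 b2 a3 b3 where L: "line_holo c fx a1 b1" "line_holo c fy a2 b2" "line_holo c fz a3 b3"
    and J: "a1 * b2 - a2 * b1 = \<omega> * (2 * fz c - fx c * fy c)"
    using area_triple_act[OF c(1) det[of n]] unfolding area_triple_def act fst_conv snd_conv \<omega>_def by blast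
  have pr: "prim (u n)" "prim (v n)" "prim (u n + v n)"
    using det[of n] det2_prim[of "u n" "v n"] det2_prim[of "u n" "u n + v n"] by auto
  have av: "\<Phi> (chart c') w \<notin> seg" if "c' \<in> ball c r" "prim w" for c' w
    using D_BQ1 r(3) that by blast
  have bd: "cmod (w - w') < \<epsilon> \<Longrightarrow> cmod w' \<le> M - 1 \<Longrightarrow> cmod w \<le> M" for w w'
    using norm_triangle_sub[of w w'] eps by simp
  have Mc: "cmod (fx c) \<le> M" "cmod (fy c) \<le> M" "cmod (fz c) \<le> M"
    unfolding fc by (rule bd[OF n(2)] bd[OF n(3)] bd[OF n(4)]; simp add: M_def)+
  have EX: "cmod a1 \<le> C" "cmod b1 \<le> C"
     "\<And>h. norm h \<le> r / 4 \<Longrightarrow> cmod (fx (c + h) - fx c - (a1 * fst h + b1 * snd h)) \<le> C * (norm h)\<^sup>2"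
    unfolding C_def B_def
    by (rule line_holo_estimate[OF r(1,2) L(1) _ Mc(1)]; (simp add: fx_def av pr)?)+
  have EY: "cmod a2 \<le> C" "cmod b2 \<le> C"
     "\<And>h. norm h \<le> r / 4 \<Longrightarrow> cmod (fy (c + h) - fy c - (a2 * fst h + b2 * snd h)) \<le> C * (norm h)\<^sup>2"
    unfolding C_def B_def
    by (rule line_holo_estimate[OF r(1,2) L(2) _ Mc(2)]; (simp add: fy_def av pr)?)+
  have EZ: "cmod a3 \<le> C" "cmod b3 \<le> C"
     "\<And>h. norm h \<le> r / 4 \<Longrightarrow> cmod (fz (c + h) - fz c - (a3 * fst h + b3 * snd h)) \<le> C * (norm h)\<^sup>2"
    unfolding C_def B_def
    by (rule line_holo_estimate[OF r(1,2) L(3) _ Mc(3)]; (simp add: fz_def av pr)?)+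
  have cb: "cball c \<rho> \<subseteq> ball c r" using rho r by auto
  have cch: "continuous_on (cball c \<rho>) chart"
    by (rule continuous_on_subset[OF continuous_chart]) (use cb r in blast)
  have cont: "continuous_on (cball c \<rho>) (\<lambda>c. \<Phi> (chart c) w)" if "prim w" for w
    by (rule continuous_on_compose2[OF continuous_Phi[OF that] cch]) simp
  obtain h where h: "norm h \<le> \<rho>" "fx (c + h) = x" "fy (c + h) = y"
  proof (rule quantitative_surjectivity[of \<rho> c fx fy a1 b1 C a2 b2 j x y])
    show "continuous_on (cball c \<rho>) fx" "continuous_on (cball c \<rho>) fy"
      unfolding fx_def fy_def by (intro cont pr)+
    show "j \<le> cmod (a1 * b2 - a2 * b1)"
      unfolding J norm_mult fc j_def using n(1) by (intro mult_left_mono) (auto simp: less_imp_le)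
    show "8 * C\<^sup>2 * \<rho> \<le> j" using rho(4) C by (simp add: field_simps)
    show "cmod (fx c - x) \<le> C * \<rho>\<^sup>2" "cmod (fy c - y) \<le> C * \<rho>\<^sup>2" unfolding fc using n eps by linarith+
  qed (use rho C j EX EY in \<open>auto intro: order_trans\<close>)
  have chb: "c + h \<in> ball c r"
  proof -
    have "dist c (c + h) = norm h" by (simp add: dist_norm)
    then show ?thesis using h(1) rho r by simp
  qed
  have inD: "chart (c + h) \<in> D" using chb r(3) by blast
  have img: "(x, y, fz (c + h)) \<in> D" using act_D[OF det[of n] inD] unfolding act h(2,3) .
  have dz: "cmod (fz (c + h) - z) < e"
  proof -
    have hf: "cmod (fst h) \<le> \<rho>" "cmod (snd h) \<le> \<rho>"
      using norm_fst_le[of "fst h" "snd h"] norm_snd_le[of "snd h" "fst h"] h(1) by auto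
    have "cmod (a3 * fst h + b3 * snd h) \<le> cmod a3 * cmod (fst h) + cmod b3 * cmod (snd h)"
      by (metis norm_mult norm_triangle_ineq)
    also have "\<dots> \<le> C * \<rho> + C * \<rho>" using EZ hf C rho by (intro add_mono mult_mono) auto
    finally have 1: "cmod (a3 * fst h + b3 * snd h) \<le> 2 * C * \<rho>" by simp
    have "C * (norm h)\<^sup>2 \<le> C * \<rho>\<^sup>2" using h C by (intro mult_left_mono power_mono) auto
    then have 2: "cmod (fz (c + h) - fz c - (a3 * fst h + b3 * snd h)) \<le> C * \<rho>\<^sup>2"
      using EZ(3)[of h] h(1) rho(2) by linarith
    have 3: "C * \<rho>\<^sup>2 \<le> C * \<rho>" using rho C by (simp add: power2_eq_square)
    have "fz (c + h) - z = (fz (c + h) - fz c - (a3 * fst h + b3 * snd h)) + (a3 * fst h + b3 * snd h) + (fz c - z)"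
      by simp
    then have "cmod (fz (c + h) - z) \<le> cmod (fz (c + h) - fz c - (a3 * fst h + b3 * snd h))
        + cmod (a3 * fst h + b3 * snd h) + cmod (fz c - z)"
      using norm_triangle_ineq[of "fz (c + h) - fz c - (a3 * fst h + b3 * snd h)" "a3 * fst h + b3 * snd h"]
        norm_triangle_ineq[of "(fz (c + h) - fz c - (a3 * fst h + b3 * snd h)) + (a3 * fst h + b3 * snd h)" "fz c - z"]
      by simp
    also have "\<dots> \<le> 4 * C * \<rho>" using 1 2 3 n(4) eps(3) unfolding fc by linarith
    also have "\<dots> \<le> e / 2" using rho(5) C by (simp add: field_simps)
    also have "\<dots> < e" using e by simp
    finally show ?thesis .
  qed
  have kz: "kappa (x, y, z) = \<mu>" using kappa_limit[OF p det lim] .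
  have "(fz (c + h) - z) * (fz (c + h) - z + (2 * z - x * y)) = kappa (x, y, fz (c + h)) - kappa (x, y, z)"
    by (simp add: kappa_def power2_eq_square algebra_simps)
  also have "\<dots> = 0" using img kz by (simp add: D_def)
  finally have "fz (c + h) = z \<or> fz (c + h) - z = - (2 * z - x * y)"
    by (simp only: mult_eq_0_iff eq_neg_iff_add_eq_0 right_minus_eq)
  moreover have "fz (c + h) - z \<noteq> - (2 * z - x * y)"
  proof
    assume "fz (c + h) - z = - (2 * z - x * y)"
    then have "cmod (fz (c + h) - z) = e" unfolding e_def by (simp only: norm_minus_cancel)
    then show False using dz by simp
  qed
  ultimately show ?thesis using img by simp
qed

lemma limit_contradiction:
  assumes p: "p \<in> D" and det: "\<And>n. det2 (u n) (v n) = 1" and inj: "inj (\<lambda>n::nat. (u n, v n))"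
    and lim: "(\<lambda>n. act (u n) (v n) p) \<longlonglongrightarrow> q" and qD: "q \<in> D"
  shows False
proof -
  obtain r where r: "r > 0" "cball q r \<inter> {q. kappa q = \<mu>} \<subseteq> D" using D_ball[OF qD] by blast
  have "\<forall>\<^sub>F n in sequentially. dist (act (u n) (v n) p) q < r" using lim r(1) by (rule tendstoD)
  then obtain n0 where n0: "\<And>n. n \<ge> n0 \<Longrightarrow> dist (act (u n) (v n) p) q < r"
    by (auto simp: eventually_sequentially)
  define T where "T = (\<lambda>n. (u n, v n)) ` {n0..}"
  have "infinite T" unfolding T_def
    using finite_imageD[OF _ inj_on_subset[OF inj subset_UNIV]] infinite_Ici by blast
  show False
  proof (rule no_recurrence[OF compact_ball_kappa r(2) \<open>infinite T\<close>, of p])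
    fix u' v' assume "(u', v') \<in> T"
    then obtain n where n: "n \<ge> n0" "u' = u n" "v' = v n" by (auto simp: T_def)
    show "det2 u' v' = 1 \<and> act u' v' p \<in> cball q r \<inter> {q. kappa q = \<mu>}"
      using n0[OF n(1)] det[of n] kappa_act[OF det, of n p] p
      by (simp add: n(2,3) dist_commute D_def less_imp_le)
  qed
qed

text \<open>The change of basis from (u, v) to (v, - u - v) permutes the three coordinates
  cyclically, so it is enough that one partial derivative of \<open>kappa\<close> is nonzero at q.
  If all vanish, one coordinate being 0 makes all of them 0, and otherwise the squares are 4 and
  \<open>kappa\<close> is 4.\<close>

lemma nonzero_limit_contradiction:
  assumes p: "p \<in> D" and det: "\<And>n. det2 (u n) (v n) = 1" and inj: "inj (\<lambda>n::nat. (u n, v n))"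
    and lim: "(\<lambda>n. act (u n) (v n) p) \<longlonglongrightarrow> q" and q0: "q \<noteq> 0"
  shows False
proof -
  obtain x y z where q: "q = (x, y, z)" by (cases q)
  have lims: "(\<lambda>n. \<Phi> p (u n)) \<longlonglongrightarrow> x" "(\<lambda>n. \<Phi> p (v n)) \<longlonglongrightarrow> y" "(\<lambda>n. \<Phi> p (u n + v n)) \<longlonglongrightarrow> z"
    using tendsto_fst[OF lim] tendsto_fst[OF tendsto_snd[OF lim]] tendsto_snd[OF tendsto_snd[OF lim]]
    by (simp_all add: act_def q)
  have kz: "kappa (x, y, z) = \<mu>" using kappa_limit[OF p det lim] by (simp add: q)
  have fin: False if "2 * z - x * y \<noteq> 0" "\<And>n. det2 (u n) (v n) = 1" "inj (\<lambda>n::nat. (u n, v n))"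
    "(\<lambda>n. act (u n) (v n) p) \<longlonglongrightarrow> (x, y, z)" for x y z and u v :: "nat \<Rightarrow> int \<times> int"
    using limit_contradiction[OF p that(2-4) limit_in_D[OF p that(2,4,1)]] .
  consider "2 * z - x * y \<noteq> 0" | "2 * x - y * z \<noteq> 0" | "2 * y - z * x \<noteq> 0"
    | "2 * z = x * y" "2 * x = y * z" "2 * y = z * x" by auto
  then show False
  proof cases
    case 1
    then show ?thesis using fin[OF 1 det inj] lim q by simp
  next
    case 2
    have "inj (\<lambda>n. (v n, - u n - v n))" using inj by (auto simp: inj_on_def)
    moreover have "det2 (v n) (- u n - v n) = 1" for n using det[of n] det2_swap[of "v n" "u n"] by simp
    moreover have "(\<lambda>n. act (v n) (- u n - v n) p) \<longlonglongrightarrow> (y, z, x)"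
    proof -
      have "act (v n) (- u n - v n) p = (\<Phi> p (v n), \<Phi> p (u n + v n), \<Phi> p (u n))" for n
        using Phi_uminus[of p "u n + v n"] by (simp add: act_def)
      then show ?thesis using lims by (simp only:) (intro tendsto_Pair)
    qed
    ultimately show ?thesis using fin[OF 2, of v "\<lambda>n. - u n - v n"] by blast
  next
    case 3
    have "inj (\<lambda>n. (- u n - v n, u n))" using inj by (auto simp: inj_on_def)
    moreover have "det2 (- u n - v n) (u n) = 1" for n using det[of n] det2_swap[of "v n" "u n"] by simp
    moreover have "(\<lambda>n. act (- u n - v n) (u n) p) \<longlonglongrightarrow> (z, x, y)"
    proof -
      have "act (- u n - v n) (u n) p = (\<Phi> p (u n + v n), \<Phi> p (u n), \<Phi> p (v n))" for n
        using Phi_uminus[of p "u n + v n"] by (simp add: act_def)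
      then show ?thesis using lims by (simp only:) (intro tendsto_Pair)
    qed
    ultimately show ?thesis using fin[OF 3, of "\<lambda>n. - u n - v n" u] by blast
  next
    case 4
    have e: "(4 - x\<^sup>2) * y = 0" "(4 - y\<^sup>2) * z = 0" "(4 - z\<^sup>2) * x = 0"
      using 4 by Groebner_Basis.algebra+
    show ?thesis
    proof (cases "x = 0 \<or> y = 0 \<or> z = 0")
      case True
      then have "x = 0 \<and> y = 0 \<and> z = 0" using 4 by auto
      then show ?thesis using q0 q by (simp add: zero_prod_def)
    next
      case False
      then have sq: "x\<^sup>2 = 4" "y\<^sup>2 = 4" "z\<^sup>2 = 4" using e by auto
      have "x * y * z = 2 * z\<^sup>2" using 4(1) by (simp add: power2_eq_square flip: 4(1))
      then have "kappa (x, y, z) = 4" using sq by (simp add: kappa_def)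
      then show ?thesis using kz mu by simp
    qed
  qed
qed

text \<open>The traces of v and of its neighbour cannot lie on the decaying line for both directions
  of the twist about u unless the trace of v is 0, so one direction is unbounded. At the first
  member above 1 / 10 the previous one is still small, and \<open>third_coordinate_bound\<close>
  limits the new one. One member of the new pair still has the trace of u, which later distinguishes
  infinitely many pairs.\<close>

lemma twist_away_from_0:
  assumes det: "det2 u v = 1" and ns: "\<Phi> p u \<notin> seg" and y0: "\<Phi> p v \<noteq> 0"
    and small: "cmod (\<Phi> p u) \<le> 1 / 10" "cmod (\<Phi> p v) \<le> 1 / 10"
  obtains u' v' where "det2 u' v' = 1" "\<Phi> p u' = \<Phi> p u \<or> \<Phi> p v' = \<Phi> p u"
    "cmod (\<Phi> p u') \<le> 2" "cmod (\<Phi> p v') \<le> 2" "cmod (\<Phi> p (u' + v')) \<le> 12 + cmod (kappa p)"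
    "1 / 10 \<le> cmod (\<Phi> p (u' + v'))"
proof -
  obtain l where l: "cmod l > 1" "l + 1 / l = \<Phi> p u" using joukowski[OF ns] by blast
  have l0: "l \<noteq> 0" using l by auto
  have "\<exists>w. (w = u \<or> w = - u) \<and> (\<exists>k. 1 / 10 < cmod (\<Phi> p (fan w v k)))"
  proof (cases "\<Phi> p (u + v) = \<Phi> p v / l")
    case False
    then show ?thesis using fan_unbounded[OF _ l False, of "1 / 10"] det by (intro exI[of _ u]) simp
  next
    case True
    have "\<Phi> p (- u + v) \<noteq> \<Phi> p v / l"
    proof
      assume "\<Phi> p (- u + v) = \<Phi> p v / l"
      then have "\<Phi> p (u - v) = \<Phi> p v / l" using Phi_diff[of p u v] by simp
      then have "2 * (\<Phi> p v / l) = (l + 1 / l) * \<Phi> p v" using Phi_rel1[OF det, of p] True l(2) by simp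
      then have "\<Phi> p v * (l - 1 / l) = 0" using l0 by (simp add: field_simps)
      then show False using y0 joukowski_diff_nonzero[OF l(1)] by simp
    qed
    moreover have "\<bar>det2 (- u) v\<bar> = 1" using det by simp
    moreover have "l + 1 / l = \<Phi> p (- u)" using l(2) by simp
    ultimately show ?thesis using fan_unbounded[of "- u" v l p "1 / 10"] l(1)
      by (intro exI[of _ "- u"]) simp
  qed
  then obtain w where w: "w = u \<or> w = - u" "\<exists>k. 1 / 10 < cmod (\<Phi> p (fan w v k))" by blast
  define k where "k = (LEAST k. 1 / 10 < cmod (\<Phi> p (fan w v k)))"
  have k: "1 / 10 < cmod (\<Phi> p (fan w v k))" unfolding k_def using w(2) by (rule LeastI_ex)
  have kl: "cmod (\<Phi> p (fan w v i)) \<le> 1 / 10" if "i < k" for i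
    using not_less_Least[OF that[unfolded k_def]] by simp
  obtain i where i: "k = Suc i" using k small by (cases k) auto
  define y where "y = fan w v i"
  have y: "cmod (\<Phi> p y) \<le> 2" using kl[of i] i by (simp add: y_def)
  have sum: "w + y = fan w v k" by (simp add: y_def i fan_Suc)
  have Pw: "\<Phi> p w = \<Phi> p u" using w(1) by auto
  have x: "cmod (\<Phi> p w) \<le> 2" using small Pw by simp
  have dw: "det2 w y = det2 w v" by (simp add: y_def)
  then have "\<bar>det2 w y\<bar> = 1" using w(1) det by auto
  then have up: "cmod (\<Phi> p (w + y)) \<le> 12 + cmod (kappa p)"
    by (intro third_coordinate_bound[OF x y] Phi_kappa)
  show ?thesis
  proof (cases "w = u")
    case True
    then show ?thesis using that[of w y] dw det Pw x y up k sum by simp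
  next
    case False
    then have "det2 y w = 1" using w(1) dw det det2_swap[of y w] by simp
    then show ?thesis using that[of y w] Pw x y up k sum by (simp add: add.commute)
  qed
qed

lemma convergent_subsequence:
  assumes inf: "infinite T"
    and T: "\<And>u v. (u, v) \<in> T \<Longrightarrow> cmod (\<Phi> p u) \<le> C \<and> cmod (\<Phi> p v) \<le> C \<and> cmod (\<Phi> p (u + v)) \<le> C"
  obtains u v q where "inj (\<lambda>n::nat. (u n, v n))" "\<And>n. (u n, v n) \<in> T" "(\<lambda>n. act (u n) (v n) p) \<longlonglongrightarrow> q"
proof -
  obtain f :: "nat \<Rightarrow> _" where f: "inj f" "range f \<subseteq> T" using infinite_countable_subset[OF inf] by blast
  have fT: "(fst (f n), snd (f n)) \<in> T" for n using f(2) by auto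
  have "act (fst (f n)) (snd (f n)) p \<in> cball 0 (3 * C)" for n
  proof -
    let ?u = "fst (f n)" and ?v = "snd (f n)"
    have "norm (act ?u ?v p) \<le> cmod (\<Phi> p ?u) + norm (\<Phi> p ?v, \<Phi> p (?u + ?v))"
      "norm (\<Phi> p ?v, \<Phi> p (?u + ?v)) \<le> cmod (\<Phi> p ?v) + cmod (\<Phi> p (?u + ?v))"
      unfolding act_def by (rule norm_Pair_le)+
    then show ?thesis using T[OF fT[of n]] by simp
  qed
  then obtain q r where r: "strict_mono r" "((\<lambda>n. act (fst (f n)) (snd (f n)) p) \<circ> r) \<longlonglongrightarrow> q"
    using seq_compactE[OF compact_imp_seq_compact[OF compact_cball[of "0 :: complex \<times> complex \<times> complex" "3 * C"]],
        of "\<lambda>n. act (fst (f n)) (snd (f n)) p"] by blast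
  show ?thesis
  proof (rule that[of "\<lambda>n. fst (f (r n))" "\<lambda>n. snd (f (r n))" q])
    have "inj (f \<circ> r)" using f(1) strict_mono_imp_inj_on[OF r(1)] by (rule inj_compose)
    then show "inj (\<lambda>n. (fst (f (r n)), snd (f (r n))))" by (simp add: comp_def)
  qed (use r(2) fT in \<open>auto simp: comp_def\<close>)
qed

theorem D_BQ:
  assumes p: "p \<in> D" shows "BQ p"
proof (rule ccontr)
  assume "\<not> BQ p"
  have ns: "\<And>u. prim u \<Longrightarrow> \<Phi> p u \<notin> seg" using D_BQ1[OF p] .
  have "(0::complex) = complex_of_real 0" by simp
  then have "0 \<in> seg" unfolding seg_def by (intro image_eqI[of _ _ 0]) auto
  then have nz: "\<Phi> p u \<noteq> 0" if "prim u" for u using ns[OF that] by auto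
  have kp: "kappa p = \<mu>" using p by (simp add: D_def)
  have "infinite {u. prim u \<and> cmod (\<Phi> p u) \<le> 2}" using \<open>\<not> BQ p\<close> ns by (auto simp: BQ_def)
  then obtain C where inf: "infinite {(u, v). det2 u v = 1 \<and> cmod (\<Phi> p u) \<le> C \<and> cmod (\<Phi> p v) \<le> C \<and>
      cmod (\<Phi> p (u + v)) \<le> C}" (is "infinite ?T")
    using infinitely_many_bounded_triples[OF ns] kp mu by blast
  obtain u v q where uv: "inj (\<lambda>n::nat. (u n, v n))" "\<And>n. (u n, v n) \<in> ?T"
    and lim: "(\<lambda>n. act (u n) (v n) p) \<longlonglongrightarrow> q"
    using convergent_subsequence[OF inf, of p C] by blast
  have det: "det2 (u n) (v n) = 1" for n using uv(2)[of n] by simp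
  show False
  proof (cases "q = 0")
    case False
    then show ?thesis using nonzero_limit_contradiction[OF p det uv(1) lim] by blast
  next
    \<comment> \<open>The traces of \<open>u n\<close> and \<open>v n\<close> tend to 0; such pairs
      are twisted until the third trace is at least 1 / 10.\<close>
    case True
    have lims: "(\<lambda>n. \<Phi> p (u n)) \<longlonglongrightarrow> 0" "(\<lambda>n. \<Phi> p (v n)) \<longlonglongrightarrow> 0"
      using tendsto_fst[OF lim] tendsto_fst[OF tendsto_snd[OF lim]] by (simp_all add: act_def True)
    have pr: "prim (u n)" "prim (v n)" for n using det2_prim[of "u n" "v n"] det[of n] by auto
    have "\<forall>\<^sub>F n in sequentially. dist (\<Phi> p (u n)) 0 < 1 / 10" "\<forall>\<^sub>F n in sequentially. dist (\<Phi> p (v n)) 0 < 1 / 10"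
      by (rule tendstoD[OF lims(1)] tendstoD[OF lims(2)], simp)+
    then have "\<forall>\<^sub>F n in sequentially. dist (\<Phi> p (u n)) 0 < 1 / 10 \<and> dist (\<Phi> p (v n)) 0 < 1 / 10"
      by (rule eventually_conj)
    then obtain n0 where "\<forall>n\<ge>n0. dist (\<Phi> p (u n)) 0 < 1 / 10 \<and> dist (\<Phi> p (v n)) 0 < 1 / 10"
      unfolding eventually_sequentially by blast
    then have n0: "cmod (\<Phi> p (u n)) \<le> 1 / 10 \<and> cmod (\<Phi> p (v n)) \<le> 1 / 10" if "n \<ge> n0" for n
      using that by (simp add: less_imp_le)
    define C' where "C' = 12 + cmod (kappa p)"
    define good where "good n w \<longleftrightarrow> det2 (fst w) (snd w) = 1 \<and> (\<Phi> p (fst w) = \<Phi> p (u n) \<or> \<Phi> p (snd w) = \<Phi> p (u n)) \<and>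
      cmod (\<Phi> p (fst w)) \<le> C' \<and> cmod (\<Phi> p (snd w)) \<le> C' \<and> cmod (\<Phi> p (fst w + snd w)) \<le> C' \<and>
      1 / 10 \<le> cmod (\<Phi> p (fst w + snd w))" for n w
    have C': "2 \<le> C'" by (simp add: C'_def)
    have "\<exists>w. good n w" if n: "n \<ge> n0" for n
    proof -
      have s: "cmod (\<Phi> p (u n)) \<le> 1 / 10" "cmod (\<Phi> p (v n)) \<le> 1 / 10" using n0[OF n] by auto
      obtain u' v' where w: "det2 u' v' = 1" "\<Phi> p u' = \<Phi> p (u n) \<or> \<Phi> p v' = \<Phi> p (u n)"
        "cmod (\<Phi> p u') \<le> 2" "cmod (\<Phi> p v') \<le> 2" "cmod (\<Phi> p (u' + v')) \<le> 12 + cmod (kappa p)"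
        "1 / 10 \<le> cmod (\<Phi> p (u' + v'))"
        by (rule twist_away_from_0[OF det[of n] ns[OF pr(1)] nz[OF pr(2)] s])
      have "good n (u', v')" unfolding good_def fst_conv snd_conv
        using w order_trans[OF w(3) C'] order_trans[OF w(4) C'] by (simp add: C'_def)
      then show ?thesis by blast
    qed
    then have "\<forall>n. \<exists>w. n \<ge> n0 \<longrightarrow> good n w" by blast
    from choice[OF this] obtain g where g: "\<And>n. n \<ge> n0 \<Longrightarrow> good n (g n)" by blast
    define T' where "T' = g ` {n0..}"
    have T'd: "det2 (fst w) (snd w) = 1" if "w \<in> T'" for w using that g by (auto simp: T'_def good_def)
    \<comment> \<open>A good pair for n has a member with the trace of \<open>u n\<close>. These
      traces are nonzero and tend to 0, so they cannot all come from finitely many pairs.\<close>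
    have "infinite T'"
    proof
      assume fin: "finite T'"
      define R where "R = (\<lambda>w. cmod (\<Phi> p w)) ` (fst ` T' \<union> snd ` T')"
      have R: "finite R" "R \<noteq> {}" using fin by (auto simp: R_def T'_def)
      have "m > 0" if mR: "m \<in> R" for m
      proof -
        obtain w where w: "w \<in> T'" "m = cmod (\<Phi> p (fst w)) \<or> m = cmod (\<Phi> p (snd w))"
          using mR unfolding R_def by blast
        have "prim (fst w)" "prim (snd w)" using T'd[OF w(1)] det2_prim[of "fst w" "snd w"] by auto
        from nz[OF this(1)] nz[OF this(2)] show ?thesis using w(2) by auto
      qed
      then have m: "Min R > 0" using R by simp
      have "\<forall>\<^sub>F n in sequentially. dist (\<Phi> p (u n)) 0 < Min R" using lims(1) m by (rule tendstoD)
      then obtain n1 where n1: "\<And>n. n \<ge> n1 \<Longrightarrow> cmod (\<Phi> p (u n)) < Min R"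
        by (auto simp: eventually_sequentially)
      define n where "n = max n0 n1"
      have gn: "good n (g n)" "g n \<in> T'" using g by (auto simp: n_def T'_def)
      have "cmod (\<Phi> p (fst (g n))) \<in> R" "cmod (\<Phi> p (snd (g n))) \<in> R"
        unfolding R_def using gn(2) by blast+
      moreover have "\<Phi> p (fst (g n)) = \<Phi> p (u n) \<or> \<Phi> p (snd (g n)) = \<Phi> p (u n)"
        using gn(1) by (simp add: good_def)
      ultimately have "cmod (\<Phi> p (u n)) \<in> R" by auto
      then have "Min R \<le> cmod (\<Phi> p (u n))" using R(1) by simp
      then show False using n1[of n] by (simp add: n_def)
    qed
    obtain u' v' q' where uv': "inj (\<lambda>n::nat. (u' n, v' n))" "\<And>n. (u' n, v' n) \<in> T'"
      and lim': "(\<lambda>n. act (u' n) (v' n) p) \<longlonglongrightarrow> q'"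
    proof (rule convergent_subsequence[OF \<open>infinite T'\<close>, of p C'])
      fix u v assume "(u, v) \<in> T'"
      then obtain n where "n \<ge> n0" "(u, v) = g n" by (auto simp: T'_def)
      then show "cmod (\<Phi> p u) \<le> C' \<and> cmod (\<Phi> p v) \<le> C' \<and> cmod (\<Phi> p (u + v)) \<le> C'"
        using g[of n] by (simp add: good_def flip: \<open>(u, v) = g n\<close>)
    qed blast
    have det': "det2 (u' n) (v' n) = 1" for n using T'd[OF uv'(2)[of n]] by simp
    have "q' \<noteq> 0"
    proof
      assume q': "q' = 0"
      have "(\<lambda>n. \<Phi> p (u' n + v' n)) \<longlonglongrightarrow> 0"
        using tendsto_snd[OF tendsto_snd[OF lim']] by (simp add: act_def q')
      then have "\<forall>\<^sub>F n in sequentially. dist (\<Phi> p (u' n + v' n)) 0 < 1 / 10" by (rule tendstoD) simp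
      then obtain n where "cmod (\<Phi> p (u' n + v' n)) < 1 / 10" by (auto simp: eventually_sequentially)
      moreover obtain i where "i \<ge> n0" "(u' n, v' n) = g i" using uv'(2)[of n] by (auto simp: T'_def)
      then have "1 / 10 \<le> cmod (\<Phi> p (u' n + v' n))"
        using g[of i] by (simp add: good_def flip: \<open>(u' n, v' n) = g i\<close>)
      ultimately show False by simp
    qed
    then show ?thesis using nonzero_limit_contradiction[OF p det' uv'(1) lim'] by blast
  qed
qed

end

section \<open>Free groups of rank two\<close>

definition letter_inv :: "letter \<Rightarrow> letter" where
  "letter_inv l = (fst l, \<not> snd l)"

lemma letter_inv_inv [simp]: "letter_inv (letter_inv l) = l"
  by (simp add: letter_inv_def)

lemma letter_inv_neq [simp]: "letter_inv l \<noteq> l" "l \<noteq> letter_inv l"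
  by (cases l; simp add: letter_inv_def)+

lemma not_cancelling_iff: "\<not> (fst l = fst m \<and> snd l \<noteq> snd m) \<longleftrightarrow> m \<noteq> letter_inv l"
  by (cases l; cases m; auto simp: letter_inv_def)

lemma reduced_words_iff: "w \<in> reduced_words \<longleftrightarrow> successively (\<lambda>l m. m \<noteq> letter_inv l) w"
  unfolding reduced_words_def not_cancelling_iff by simp

fun red_cons :: "letter \<Rightarrow> letter list \<Rightarrow> letter list" where
  "red_cons l [] = [l]"
| "red_cons l (m # w) = (if m = letter_inv l then w else l # m # w)"

lemma red_cons_reduced: "w \<in> reduced_words \<Longrightarrow> red_cons l w \<in> reduced_words"
  by (cases w) (auto simp: reduced_words_iff successively_Cons)

lemma length_red_cons_le: "length (red_cons l w) \<le> Suc (length w)"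
  by (cases w) auto

lemma word_value_Nil [simp]: "word_value G x y [] = \<one>\<^bsub>G\<^esub>"
  by (simp add: word_value_def)

lemma word_value_Cons [simp]:
  "word_value G x y (l # w) = letter_value G x y l \<otimes>\<^bsub>G\<^esub> word_value G x y w"
  by (simp add: word_value_def)

context group
begin

lemma letter_value_closed [simp]:
  "x \<in> carrier G \<Longrightarrow> y \<in> carrier G \<Longrightarrow> letter_value G x y l \<in> carrier G"
  by (simp add: letter_value_def Let_def)

lemma word_value_closed [simp]:
  "x \<in> carrier G \<Longrightarrow> y \<in> carrier G \<Longrightarrow> word_value G x y w \<in> carrier G"
  by (induction w) auto

lemma letter_value_inv:
  "x \<in> carrier G \<Longrightarrow> y \<in> carrier G \<Longrightarrow>
     letter_value G x y (letter_inv l) = inv (letter_value G x y l)"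
  by (cases l) (auto simp: letter_value_def letter_inv_def)

lemma word_value_append:
  "x \<in> carrier G \<Longrightarrow> y \<in> carrier G \<Longrightarrow>
     word_value G x y (v @ w) = word_value G x y v \<otimes> word_value G x y w"
  by (induction v) (auto simp: m_assoc)

lemma inv_cancel_left:
  "x \<in> carrier G \<Longrightarrow> y \<in> carrier G \<Longrightarrow> x \<otimes> (inv x \<otimes> y) = y"
  by (simp add: m_assoc[symmetric])

lemma inv_cancel_left':
  "x \<in> carrier G \<Longrightarrow> y \<in> carrier G \<Longrightarrow> inv x \<otimes> (x \<otimes> y) = y"
  by (simp add: m_assoc[symmetric])

lemmas group_cancel = m_assoc inv_mult_group inv_cancel_left inv_cancel_left'

lemma word_value_red_cons:
  assumes "x \<in> carrier G" "y \<in> carrier G"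
  shows "word_value G x y (red_cons l w) = letter_value G x y l \<otimes> word_value G x y w"
  using assms by (cases w) (auto simp: letter_value_inv inv_cancel_left)

definition reduce :: "letter list \<Rightarrow> letter list" where
  "reduce w = foldr red_cons w []"

lemma reduce_reduced: "reduce w \<in> reduced_words"
proof (induction w)
  case Nil show ?case by (simp add: reduce_def reduced_words_iff)
next
  case (Cons l w) then show ?case using red_cons_reduced by (simp add: reduce_def)
qed

lemma word_value_reduce:
  "x \<in> carrier G \<Longrightarrow> y \<in> carrier G \<Longrightarrow> word_value G x y (reduce w) = word_value G x y w"
proof (induction w)
  case Nil show ?case by (simp add: reduce_def)
next
  case (Cons l w) then show ?case by (simp add: reduce_def word_value_red_cons)
qed

definition inv_word :: "letter list \<Rightarrow> letter list" where
  "inv_word w = rev (map letter_inv w)"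

lemma word_value_inv_word:
  assumes "x \<in> carrier G" "y \<in> carrier G"
  shows "word_value G x y (inv_word w) = inv (word_value G x y w)"
  using assms
  by (induction w) (auto simp: inv_word_def word_value_append letter_value_inv inv_mult_group)

lemma inv_word_reduced: "w \<in> reduced_words \<Longrightarrow> inv_word w \<in> reduced_words"
proof -
  show "w \<in> reduced_words \<Longrightarrow> inv_word w \<in> reduced_words"
    unfolding reduced_words_iff inv_word_def successively_rev successively_map
    by (erule successively_mono) (metis letter_inv_inv)
qed

end

subsection \<open>Normal forms and the universal property\<close>

locale free2 = group G for G :: "('g, 'm) monoid_scheme" (structure) +
  fixes a b :: 'g
  assumes free_basis_ab: "free_basis G a b"
begin

lemma a_closed [simp]: "a \<in> carrier G" and b_closed [simp]: "b \<in> carrier G"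
  using free_basis_ab by (auto simp: free_basis_def)

lemma bij_word_value: "bij_betw (word_value G a b) reduced_words (carrier G)"
  using free_basis_ab by (auto simp: free_basis_def)

definition nf :: "'g \<Rightarrow> letter list" where
  "nf = inv_into reduced_words (word_value G a b)"

lemma nf_reduced: "g \<in> carrier G \<Longrightarrow> nf g \<in> reduced_words"
  using bij_word_value unfolding nf_def by (metis bij_betw_def inv_into_into)

lemma word_value_nf [simp]: "g \<in> carrier G \<Longrightarrow> word_value G a b (nf g) = g"
  using bij_word_value unfolding nf_def by (metis bij_betw_inv_into_right)

lemma nf_word_value: "w \<in> reduced_words \<Longrightarrow> nf (word_value G a b w) = w"
  using bij_word_value unfolding nf_def by (metis bij_betw_inv_into_left)

lemma nf_letter_mult:
  "g \<in> carrier G \<Longrightarrow> nf (letter_value G a b l \<otimes> g) = red_cons l (nf g)"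
  by (metis a_closed b_closed nf_reduced nf_word_value red_cons_reduced word_value_nf
      word_value_red_cons)

definition lift :: "('h, 'n) monoid_scheme \<Rightarrow> 'h \<Rightarrow> 'h \<Rightarrow> 'g \<Rightarrow> 'h" where
  "lift T x y = (\<lambda>g\<in>carrier G. word_value T x y (nf g))"

text \<open>The induction runs over arbitrary words for the left factor: prefixing a letter changes
  a normal form by \<open>red_cons\<close>, and the value in T follows.\<close>

lemma lift_hom:
  assumes T: "group T" and x: "x \<in> carrier T" and y: "y \<in> carrier T"
  shows "lift T x y \<in> hom G T"
proof -
  interpret T: group T by fact
  have *: "word_value T x y (nf (word_value G a b w \<otimes> h)) =
      word_value T x y w \<otimes>\<^bsub>T\<^esub> word_value T x y (nf h)" if "h \<in> carrier G" for w h
  proof (induction w)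
    case Nil then show ?case using that x y by simp
  next
    case (Cons l w)
    then show ?case using that x y
      by (simp add: m_assoc nf_letter_mult T.word_value_red_cons T.m_assoc)
  qed
  show ?thesis
  proof (rule homI)
    fix g h assume g: "g \<in> carrier G" and h: "h \<in> carrier G"
    show "lift T x y (g \<otimes> h) = lift T x y g \<otimes>\<^bsub>T\<^esub> lift T x y h"
      using *[OF h, of "nf g"] g h by (simp add: lift_def)
  qed (use x y in \<open>simp add: lift_def\<close>)
qed

lemma lift_extensional: "lift T x y \<in> extensional (carrier G)"
  by (simp add: lift_def)

lemma nf_letter: "nf (letter_value G a b l) = [l]"
  using nf_word_value[of "[l]"] by (simp add: reduced_words_iff)

lemma letter_value_a: "letter_value T x y (False, False) = x"
  and letter_value_b: "letter_value T x y (True, False) = y"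
  by (auto simp: letter_value_def)

lemma nf_a: "nf a = [(False, False)]" and nf_b: "nf b = [(True, False)]"
  using nf_letter[of "(False, False)"] nf_letter[of "(True, False)"]
  by (auto simp: letter_value_a letter_value_b)

lemma lift_a:
  assumes T: "group T" and x: "x \<in> carrier T" and y: "y \<in> carrier T"
  shows "lift T x y a = x"
proof -
  interpret T: group T by fact
  show ?thesis using x y by (simp add: lift_def nf_a letter_value_a)
qed

lemma lift_b:
  assumes T: "group T" and x: "x \<in> carrier T" and y: "y \<in> carrier T"
  shows "lift T x y b = y"
proof -
  interpret T: group T by fact
  show ?thesis using x y by (simp add: lift_def nf_b letter_value_b)
qed

end

lemma (in group) hom_word_value:
  assumes T: "group T" and f: "f \<in> hom G T" and x: "x \<in> carrier G" and y: "y \<in> carrier G"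
  shows "f (word_value G x y w) = word_value T (f x) (f y) w"
proof -
  interpret T: group T by fact
  interpret h: group_hom G T f by unfold_locales (use f in simp)
  have "f (letter_value G x y l) = letter_value T (f x) (f y) l" for l
    using x y by (simp add: letter_value_def Let_def)
  then show ?thesis using x y by (induction w) auto
qed

context free2
begin

lemma hom_eqI:
  assumes T: "group T" and f: "f \<in> hom G T" and f': "f' \<in> hom G T"
    and "f a = f' a" "f b = f' b" and g: "g \<in> carrier G"
  shows "f g = f' g"
  using assms hom_word_value[OF T f, of a b "nf g"] hom_word_value[OF T f', of a b "nf g"]
  by simp

subsection \<open>Abelianization\<close>

definition Z2 :: "(int \<times> int) monoid" where
  "Z2 = \<lparr>carrier = UNIV, mult = (+), one = 0\<rparr>"

lemma group_Z2: "group Z2"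
proof (rule groupI)
  fix x assume "x \<in> carrier Z2"
  show "\<exists>y\<in>carrier Z2. y \<otimes>\<^bsub>Z2\<^esub> x = \<one>\<^bsub>Z2\<^esub>"
    by (rule bexI[of _ "- x"]) (auto simp: Z2_def)
qed (auto simp: Z2_def)

lemma Z2_simps [simp]: "carrier Z2 = UNIV" "x \<otimes>\<^bsub>Z2\<^esub> y = x + y" "\<one>\<^bsub>Z2\<^esub> = 0"
  by (auto simp: Z2_def)

lemma Z2_inv [simp]: "inv\<^bsub>Z2\<^esub> x = - x"
  by (rule group.inv_equality[OF group_Z2]) auto

definition ab :: "'g \<Rightarrow> int \<times> int" where
  "ab = lift Z2 (1, 0) (0, 1)"

lemma ab_hom: "ab \<in> hom G Z2"
  unfolding ab_def by (rule lift_hom) (auto simp: group_Z2)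

lemma ab_mult [simp]: "g \<in> carrier G \<Longrightarrow> h \<in> carrier G \<Longrightarrow> ab (g \<otimes> h) = ab g + ab h"
  using ab_hom by (auto simp: hom_def)

lemma ab_a [simp]: "ab a = (1, 0)" and ab_b [simp]: "ab b = (0, 1)"
  unfolding ab_def by (simp_all add: lift_a lift_b group_Z2)

interpretation ab: group_hom G Z2 ab
  by (simp add: group_Z2 group_hom_axioms.intro group_hom_def is_group ab_hom)

lemma ab_one [simp]: "ab \<one> = 0"
  using ab.hom_one by simp

lemma ab_inv [simp]: "g \<in> carrier G \<Longrightarrow> ab (inv g) = - ab g"
  using ab.hom_inv by simp

end

section \<open>Nielsen reduction in rank two\<close>

fun lcp :: "'a list \<Rightarrow> 'a list \<Rightarrow> nat" where
  "lcp (x # xs) (y # ys) = (if x = y then Suc (lcp xs ys) else 0)"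
| "lcp _ _ = 0"

lemma lcp_sym: "lcp xs ys = lcp ys xs"
  by (induction xs ys rule: lcp.induct) auto

text \<open>The ultrametric inequality of a tree: prefixes that ys shares with xs and with zs are
  comparable.\<close>

lemma lcp_ultra: "min (lcp xs ys) (lcp ys zs) \<le> lcp xs zs"
proof (induction xs ys arbitrary: zs rule: lcp.induct)
  case (1 x xs y ys)
  show ?case
  proof (cases zs)
    case (Cons z zs')
    then show ?thesis using 1[of zs'] by (auto simp: min_def split: if_splits)
  qed simp
qed auto

lemma lcp_le: "lcp xs ys \<le> length xs"
  by (induction xs ys rule: lcp.induct) auto

lemma lcp_decomp:
  "\<exists>p s t. xs = p @ s \<and> ys = p @ t \<and> length p = lcp xs ys \<and> (s = [] \<or> t = [] \<or> hd s \<noteq> hd t)"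
proof (induction xs ys rule: lcp.induct)
  case (1 x xs y ys)
  show ?case
  proof (cases "x = y")
    case True
    with 1 obtain p s t where "xs = p @ s \<and> ys = p @ t \<and> length p = lcp xs ys \<and> (s = [] \<or> t = [] \<or> hd s \<noteq> hd t)"
      by blast
    then show ?thesis using True by (intro exI[of _ "x # p"] exI[of _ s] exI[of _ t]) auto
  next
    case False
    then show ?thesis by (intro exI[of _ "[]"] exI[of _ "x # xs"] exI[of _ "y # ys"]) auto
  qed
qed auto

lemma lcp_nth: "i < lcp xs ys \<Longrightarrow> xs ! i = ys ! i"
proof (induction xs ys arbitrary: i rule: lcp.induct)
  case (1 x xs y ys) then show ?case by (cases i) (auto split: if_splits)
qed auto

lemma lcp_take: "h \<le> lcp xs ys \<Longrightarrow> take h xs = take h ys"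
proof (induction xs ys arbitrary: h rule: lcp.induct)
  case (1 x xs y ys) then show ?case by (cases h) (auto split: if_splits)
qed auto

context group
begin

lemma inv_word_inv_word [simp]: "inv_word (inv_word w) = w"
  by (simp add: inv_word_def rev_map comp_def)

lemma length_inv_word [simp]: "length (inv_word w) = length w"
  by (simp add: inv_word_def)

lemma inv_word_append: "inv_word (v @ w) = inv_word w @ inv_word v"
  by (simp add: inv_word_def)

lemma length_reduce: "length (reduce w) \<le> length w"
proof (induction w)
  case (Cons l w)
  then show ?case using length_red_cons_le[of l "reduce w"] by (simp add: reduce_def)
qed (simp add: reduce_def)

text \<open>Simultaneous conjugation counts as a move; it is what shortens a pair in which an
  element is cancelled by half on either side.\<close>

inductive nielsen :: "'a \<Rightarrow> 'a \<Rightarrow> 'a \<Rightarrow> 'a \<Rightarrow> bool" for u0 v0 where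
  base: "nielsen u0 v0 u0 v0"
| mult: "nielsen u0 v0 u v \<Longrightarrow> nielsen u0 v0 u (u \<otimes> v)"
| swap: "nielsen u0 v0 u v \<Longrightarrow> nielsen u0 v0 v u"
| inv: "nielsen u0 v0 u v \<Longrightarrow> nielsen u0 v0 (inv u) v"
| conj: "nielsen u0 v0 u v \<Longrightarrow> k \<in> carrier G \<Longrightarrow>
           nielsen u0 v0 (k \<otimes> u \<otimes> inv k) (k \<otimes> v \<otimes> inv k)"

lemma nielsen_trans:
  assumes "nielsen u v u2 v2" "nielsen u1 v1 u v" shows "nielsen u1 v1 u2 v2"
  using assms by induction (auto intro: nielsen.intros)

lemma nielsen_closed:
  assumes "nielsen u v u' v'" "u \<in> carrier G" "v \<in> carrier G"
  shows "u' \<in> carrier G \<and> v' \<in> carrier G"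
  using assms by induction auto

lemma nielsen_inv2: "nielsen u0 v0 u v \<Longrightarrow> nielsen u0 v0 u (inv v)"
  by (meson nielsen.swap nielsen.inv)

lemma nielsen_sym:
  assumes "nielsen u v u' v'" "u \<in> carrier G" "v \<in> carrier G"
  shows "nielsen u' v' u v"
  using assms
proof induction
  case base show ?case by (rule nielsen.base)
next
  case (mult x y)
  have c: "x \<in> carrier G" "y \<in> carrier G" using nielsen_closed[OF mult.hyps] mult.prems by auto
  have "nielsen x (x \<otimes> y) (inv (inv x)) (inv x \<otimes> (x \<otimes> y))"
    by (intro nielsen.inv nielsen.mult nielsen.base)
  then have "nielsen x (x \<otimes> y) x y" using c by (simp add: inv_cancel_left')
  then show ?case using mult nielsen_trans by blast
next
  case (swap x y)
  then show ?case by (meson nielsen.swap nielsen.base nielsen_trans)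
next
  case (inv x y)
  have c: "x \<in> carrier G" "y \<in> carrier G" using nielsen_closed[OF inv.hyps] inv.prems by auto
  have "nielsen (inv x) y (inv (inv x)) y" by (intro nielsen.inv nielsen.base)
  then have "nielsen (inv x) y x y" using c by simp
  then show ?case using inv nielsen_trans by blast
next
  case (conj x y k)
  have c: "x \<in> carrier G" "y \<in> carrier G" using nielsen_closed[OF conj.hyps(1)] conj.prems by auto
  have "nielsen (k \<otimes> x \<otimes> inv k) (k \<otimes> y \<otimes> inv k)
     (inv k \<otimes> (k \<otimes> x \<otimes> inv k) \<otimes> inv (inv k)) (inv k \<otimes> (k \<otimes> y \<otimes> inv k) \<otimes> inv (inv k))"
    by (intro nielsen.conj nielsen.base) (use conj in auto)
  then have "nielsen (k \<otimes> x \<otimes> inv k) (k \<otimes> y \<otimes> inv k) x y" using c conj.hyps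
    by (simp add: group_cancel)
  then show ?case using conj nielsen_trans by blast
qed

lemma nielsen_letters:
  assumes "u \<in> carrier G" "v \<in> carrier G" "fst l \<noteq> fst m"
  shows "nielsen u v (letter_value G u v l) (letter_value G u v m)"
proof -
  have 1: "nielsen u v (letter_value G u v (False, e)) v" for e
    by (auto simp: letter_value_def intro: nielsen.intros)
  have 2: "nielsen u v (letter_value G u v (False, e)) (letter_value G u v (True, f))" for e f
    using 1[of e] by (auto simp: letter_value_def intro: nielsen_inv2)
  show ?thesis
  proof (cases "fst l")
    case True then show ?thesis using 2[of "snd m" "snd l"] assms
      by (cases l; cases m) (auto intro: nielsen.swap)
  next
    case False then show ?thesis using 2[of "snd l" "snd m"] assms
      by (cases l; cases m) auto
  qed
qed

text \<open>Words need not be unique here; that a generating pair is a basis is the outcome of the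
  reduction, in \<open>gens_imp_free_basis\<close>.\<close>

definition gens :: "'a \<Rightarrow> 'a \<Rightarrow> bool" where
  "gens u v \<longleftrightarrow> u \<in> carrier G \<and> v \<in> carrier G \<and>
     (\<forall>g\<in>carrier G. \<exists>w. g = word_value G u v w)"

lemma gens_reduced:
  assumes "gens u v" "g \<in> carrier G"
  obtains w where "w \<in> reduced_words" "g = word_value G u v w"
  using assms unfolding gens_def by (metis reduce_reduced word_value_reduce)

lemma word_value_substitute:
  assumes "u \<in> carrier G" "v \<in> carrier G"
    and x: "x = word_value G u v w1" and y: "y = word_value G u v w2"
  shows "\<exists>w'. word_value G x y w = word_value G u v w'"
proof (induction w)
  case Nil show ?case by (rule exI[of _ "[]"]) simp
next
  case (Cons l w)
  then obtain w' where w': "word_value G x y w = word_value G u v w'" by blast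
  let ?z = "if fst l then w2 else w1"
  have "letter_value G x y l = word_value G u v (if snd l then inv_word ?z else ?z)"
    using assms by (auto simp: letter_value_def word_value_inv_word)
  then show ?case using w' assms by (metis word_value_Cons word_value_append)
qed

lemma gens_substitute:
  assumes "gens x y" "u \<in> carrier G" "v \<in> carrier G"
    and "x = word_value G u v w1" and "y = word_value G u v w2"
  shows "gens u v"
  using assms word_value_substitute[of u v x w1 y w2] unfolding gens_def by metis

lemma nielsen_gens:
  assumes "nielsen u v u' v'" "gens u v" shows "gens u' v'"
  using assms
proof induction
  case (mult x y)
  then have g: "gens x y" by simp
  then have c: "x \<in> carrier G" "y \<in> carrier G" by (auto simp: gens_def)
  show ?case
    by (rule gens_substitute[OF g, of _ _ "[(False, False)]" "[(False, True), (True, False)]"])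
      (use c in \<open>auto simp: letter_value_def group_cancel\<close>)
next
  case (swap x y)
  then have g: "gens x y" by simp
  then have c: "x \<in> carrier G" "y \<in> carrier G" by (auto simp: gens_def)
  show ?case
    by (rule gens_substitute[OF g, of _ _ "[(True, False)]" "[(False, False)]"])
      (use c in \<open>auto simp: letter_value_def\<close>)
next
  case (inv x y)
  then have g: "gens x y" by simp
  then have c: "x \<in> carrier G" "y \<in> carrier G" by (auto simp: gens_def)
  show ?case
    by (rule gens_substitute[OF g, of _ _ "[(False, True)]" "[(True, False)]"])
      (use c in \<open>auto simp: letter_value_def\<close>)
next
  case (conj x y k)
  then have g: "gens x y" by simp
  then have c: "x \<in> carrier G" "y \<in> carrier G" by (auto simp: gens_def)
  have k: "k \<in> carrier G" by fact
  have *: "word_value G (k \<otimes> x \<otimes> inv k) (k \<otimes> y \<otimes> inv k) w = k \<otimes> word_value G x y w \<otimes> inv k" for w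
  proof (induction w)
    case Nil then show ?case using k by simp
  next
    case (Cons l w)
    have "letter_value G (k \<otimes> x \<otimes> inv k) (k \<otimes> y \<otimes> inv k) l = k \<otimes> letter_value G x y l \<otimes> inv k"
      using c k by (auto simp: letter_value_def group_cancel)
    then show ?case using Cons c k by (simp add: group_cancel)
  qed
  show ?case unfolding gens_def
  proof (intro conjI ballI)
    fix h assume h: "h \<in> carrier G"
    then obtain w where w: "inv k \<otimes> h \<otimes> k = word_value G x y w"
      using g k unfolding gens_def by (metis inv_closed m_closed)
    have "h = k \<otimes> (inv k \<otimes> h \<otimes> k) \<otimes> inv k" using h k by (simp add: group_cancel)
    then show "\<exists>w. h = word_value G (k \<otimes> x \<otimes> inv k) (k \<otimes> y \<otimes> inv k) w" using * w by metis
  qed (use c k in auto)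
qed simp

end

section \<open>Length and cancellation of normal forms\<close>

context free2
begin

definition len :: "'g \<Rightarrow> nat" where "len g = length (nf g)"
text \<open>The Gromov product at the identity in the Cayley tree: the number of letters that each
  factor loses in the product of \<open>inv g\<close> and h.\<close>

definition gp :: "'g \<Rightarrow> 'g \<Rightarrow> nat" where "gp g h = lcp (nf g) (nf h)"

lemma gp_sym: "gp g h = gp h g" by (simp add: gp_def lcp_sym)

lemma gp_ultra: "min (gp f g) (gp g h) \<le> gp f h" unfolding gp_def by (rule lcp_ultra)

lemma gp_ultra_eq: "gp f g < gp g h \<Longrightarrow> gp f h = gp f g"
  using gp_ultra[of f g h] gp_ultra[of f h g] by (simp add: gp_sym[of h g])

lemma nf_inv: "g \<in> carrier G \<Longrightarrow> nf (inv g) = inv_word (nf g)"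
  by (metis a_closed b_closed inv_word_reduced nf_reduced nf_word_value word_value_inv_word word_value_nf)

lemma len_inv [simp]: "g \<in> carrier G \<Longrightarrow> len (inv g) = len g"
  by (simp add: len_def nf_inv)

lemma len_eq_0: "g \<in> carrier G \<Longrightarrow> len g = 0 \<Longrightarrow> g = \<one>"
  by (metis len_def length_0_conv word_value_Nil word_value_nf)

lemma len_word_value_le: "len (word_value G a b w) \<le> length w"
  by (metis a_closed b_closed len_def length_reduce nf_word_value reduce_reduced word_value_reduce)

lemma len_one [simp]: "len \<one> = 0"
  using len_word_value_le[of "[]"] by simp

lemma len_inv_mult:
  assumes g: "g \<in> carrier G" and h: "h \<in> carrier G"
  shows "len (inv g \<otimes> h) + 2 * gp g h = len g + len h"
proof -
  obtain p s t where d: "nf g = p @ s" "nf h = p @ t" "length p = gp g h"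
      "s = [] \<or> t = [] \<or> hd s \<noteq> hd t"
    unfolding gp_def using lcp_decomp by blast
  have r: "p @ s \<in> reduced_words" "p @ t \<in> reduced_words"
    using nf_reduced[OF g] nf_reduced[OF h] d by auto
  then have rs: "s \<in> reduced_words" "t \<in> reduced_words"
    by (auto simp: reduced_words_iff successively_append_iff)
  have "inv_word s @ t \<in> reduced_words"
  proof (cases "s = [] \<or> t = []")
    case True then show ?thesis using rs inv_word_reduced[OF rs(1)] by (auto simp: inv_word_def)
  next
    case False
    then have "last (inv_word s) = letter_inv (hd s)"
      by (simp add: inv_word_def last_rev hd_map)
    then show ?thesis using False d(4) rs inv_word_reduced[OF rs(1)]
      by (auto simp: reduced_words_iff successively_append_iff)
  qed
  then have "nf (word_value G a b (inv_word s @ t)) = inv_word s @ t" by (rule nf_word_value)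
  moreover have "word_value G a b (inv_word s @ t) = inv g \<otimes> h"
  proof -
    have "g = word_value G a b p \<otimes> word_value G a b s" "h = word_value G a b p \<otimes> word_value G a b t"
      using d g h by (metis a_closed b_closed word_value_append word_value_nf)+
    then show ?thesis by (simp add: word_value_append word_value_inv_word group_cancel)
  qed
  ultimately have "len (inv g \<otimes> h) = length s + length t" by (simp add: len_def)
  then show ?thesis using d by (simp add: len_def)
qed

lemma len_mult:
  assumes g: "g \<in> carrier G" and h: "h \<in> carrier G"
  shows "len (g \<otimes> h) + 2 * gp (inv g) h = len g + len h"
  using len_inv_mult[of "inv g" h] assms by simp

lemma gp_mult:
  assumes g: "g \<in> carrier G" and h: "h \<in> carrier G"
  shows "gp g (g \<otimes> h) + gp (inv g) h = len g"
  using len_mult[OF g h] len_inv_mult[of g "g \<otimes> h"] assms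
  by (simp add: inv_cancel_left')

text \<open>Otherwise the word agrees with its inverse up to the middle: for even length the two
  middle letters would cancel, for odd length the middle letter would be its own inverse.\<close>

lemma gp_inv_self:
  assumes g: "g \<in> carrier G" and "g \<noteq> \<one>"
  shows "2 * gp (inv g) g < len g"
proof (rule ccontr)
  assume "\<not> ?thesis"
  then have c: "len g \<le> 2 * gp (inv g) g" by simp
  have n: "len g > 0" using assms len_eq_0 by blast
  let ?w = "nf g" and ?n = "len g"
  have eq: "letter_inv (?w ! (?n - 1 - i)) = ?w ! i" if "i < gp (inv g) g" for i
  proof -
    have "i < ?n" using that lcp_le[of "nf (inv g)" "nf g"] g by (simp add: gp_def len_def nf_inv)
    then have "nf (inv g) ! i = letter_inv (?w ! (?n - 1 - i))"
      using g by (simp add: nf_inv inv_word_def rev_nth len_def)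
    then show ?thesis using lcp_nth[of i "nf (inv g)" "nf g"] that by (simp add: gp_def)
  qed
  show False
  proof (cases "even ?n")
    case True
    then obtain m where "?n = 2 * m" by blast
    with n obtain j where j: "?n = 2 * Suc j" by (cases m) auto
    then have "j < gp (inv g) g" using c by auto
    from eq[OF this] have "letter_inv (?w ! Suc j) = ?w ! j"
      using j by (simp add: mult_2)
    moreover have "?w ! Suc j \<noteq> letter_inv (?w ! j)"
      using nf_reduced[OF g] j
      unfolding reduced_words_iff successively_conv_nth by (simp add: len_def)
    ultimately show False by (metis letter_inv_inv)
  next
    case False
    then obtain m where m: "?n = 2 * m + 1" by (auto elim: oddE)
    then have "m < gp (inv g) g" using c by simp
    from eq[OF this] show False using m by (simp add: mult_2)
  qed
qed

text \<open>If the halves of \<open>m\<close> cancel on either side in \<open>x m x\<close>, then conjugating \<open>(m, m x)\<close> by the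
  first half of \<open>m\<close> shortens the pair.\<close>

lemma half_cancellation:
  assumes m: "m \<in> carrier G" and x: "x \<in> carrier G" and m1: "m \<noteq> \<one>"
    and h: "2 * gp (inv x) m = len m" "2 * gp (inv m) x = len m" and le: "len m \<le> len x"
  shows "\<exists>u' v'. nielsen m x u' v' \<and> len u' + len v' < len m + len x"
proof -
  define P where "P = take (gp (inv x) m) (nf m)"
  define T where "T = drop (gp (inv x) m) (nf m)"
  let ?h = "gp (inv x) m"
  have hh: "gp (inv m) x = ?h" using h by simp
  have PT: "nf m = P @ T" "length P = ?h" "length T = ?h"
    using h(1) by (auto simp: P_def T_def len_def)
  have hpos: "?h > 0" using h(1) len_eq_0[OF m] m1 by linarith
  have P1: "take ?h (inv_word (nf x)) = P"
    using lcp_take[of ?h "nf (inv x)" "nf m"] x by (simp add: gp_def nf_inv P_def)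
  have T1: "take ?h (nf x) = inv_word T"
    using lcp_take[of ?h "nf (inv m)" "nf x"] m hh PT
    by (simp add: gp_def nf_inv inv_word_append)
  define R where "R = drop ?h (nf x)"
  have R: "nf x = inv_word T @ R" using T1 unfolding R_def by (metis append_take_drop_id)
  have lR: "length R \<ge> ?h" using R le h(1) PT by (simp add: len_def)
  have "take ?h (inv_word R @ T) = P" using P1 R by (simp add: inv_word_append)
  then have "take ?h (inv_word R) = P" using lR by simp
  then have "inv_word R = P @ drop ?h (inv_word R)" by (metis append_take_drop_id)
  then have "R = inv_word (drop ?h (inv_word R)) @ inv_word P"
    by (metis inv_word_append inv_word_inv_word)
  then obtain S where S: "R = S @ inv_word P" by blast
  define p where "p = word_value G a b P"
  define t where "t = word_value G a b T"
  define s where "s = word_value G a b S"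
  have c: "p \<in> carrier G" "t \<in> carrier G" "s \<in> carrier G" by (auto simp: p_def t_def s_def)
  have mpt: "m = p \<otimes> t" using m PT unfolding p_def t_def
    by (metis a_closed b_closed word_value_append word_value_nf)
  have xst: "x = inv t \<otimes> (s \<otimes> inv p)"
    using x R S unfolding p_def t_def s_def
    by (metis a_closed b_closed word_value_append word_value_inv_word word_value_nf)
  \<comment> \<open>With m = p t and x = inv t s inv p, conjugation takes (m, m x) to (t p, s): the
    first is no longer than m, and s is x without both halves.\<close>
  have "nielsen m x (inv p \<otimes> m \<otimes> inv (inv p)) (inv p \<otimes> (m \<otimes> x) \<otimes> inv (inv p))"
    by (intro nielsen.conj nielsen.mult nielsen.base) (use c in auto)
  moreover have "inv p \<otimes> m \<otimes> inv (inv p) = t \<otimes> p" using mpt c by (simp add: group_cancel)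
  moreover have "inv p \<otimes> (m \<otimes> x) \<otimes> inv (inv p) = s" using mpt xst c by (simp add: group_cancel)
  moreover have "len (t \<otimes> p) \<le> len m"
    using len_word_value_le[of "T @ P"] PT by (simp add: t_def p_def word_value_append len_def)
  moreover have "len s < len x"
  proof -
    have "len s \<le> length S" unfolding s_def by (rule len_word_value_le)
    moreover have "length (nf x) = 2 * ?h + length S" using R S PT by simp
    ultimately show ?thesis using hpos by (simp add: len_def)
  qed
  ultimately show ?thesis by (metis add_le_less_mono)
qed

lemma ab_word_value:
  assumes "u \<in> carrier G" "v \<in> carrier G"
  shows "\<exists>x. ab (word_value G u v w) = lin (ab u) (ab v) x"
proof (induction w)
  case Nil show ?case by (rule exI[of _ 0]) (simp add: lin_def zero_prod_def)
next
  case (Cons l w)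
  then obtain x where x: "ab (word_value G u v w) = lin (ab u) (ab v) x" by blast
  have "\<exists>y. ab (letter_value G u v l) = lin (ab u) (ab v) y"
  proof -
    let ?y = "if fst l then (0, 1) else (1, 0)"
    have "ab (letter_value G u v l) = lin (ab u) (ab v) (if snd l then - ?y else ?y)"
      using assms lin_simps(4)[of "ab u" "ab v" "(1, 0)"] lin_simps(4)[of "ab u" "ab v" "(0, 1)"]
      by (auto simp: letter_value_def simp del: lin_simps(4) uminus_Pair)
    then show ?thesis by blast
  qed
  then obtain y where "ab (letter_value G u v l) = lin (ab u) (ab v) y" by blast
  then show ?case using x assms by (intro exI[of _ "y + x"]) simp
qed

lemma gens_det:
  assumes "gens u v" shows "\<bar>det2 (ab u) (ab v)\<bar> = 1"
proof -
  have c: "u \<in> carrier G" "v \<in> carrier G" using assms by (auto simp: gens_def)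
  obtain w1 w2 where "a = word_value G u v w1" "b = word_value G u v w2"
    using assms unfolding gens_def by (metis a_closed b_closed)
  then obtain x y where "lin (ab u) (ab v) x = (1, 0)" "lin (ab u) (ab v) y = (0, 1)"
    using ab_word_value[OF c] ab_a ab_b by metis
  then have "det2 (ab u) (ab v) * det2 x y = 1"
    using det2_lin[of "ab u" "ab v" x y] by simp
  then show ?thesis by (auto simp: zmult_eq_1_iff)
qed

text \<open>In a shortest pair a letter loses at most half of itself to either neighbour and not
  exactly half to both, so a piece of every letter survives in a reduced word. Hence elements of
  length 1, in particular a and b, are single letters of the pair.\<close>

lemma nielsen_minimal_basis:
  assumes gen: "gens u v"
    and min: "\<And>u' v'. nielsen u v u' v' \<Longrightarrow> len u + len v \<le> len u' + len v'"
  shows "nielsen u v a b"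
proof -
  have c: "u \<in> carrier G" "v \<in> carrier G" using gen by (auto simp: gens_def)
  define lv where "lv = letter_value G u v"
  have lvc [simp]: "lv l \<in> carrier G" for l using c by (simp add: lv_def)
  have lvi [simp]: "lv (letter_inv l) = inv (lv l)" for l
    using c by (simp add: lv_def letter_value_inv)
  have det: "det2 (ab u) (ab v) \<noteq> 0" using gens_det[OF gen] by auto
  then have "u \<noteq> \<one>" "v \<noteq> \<one>" by (auto simp: det2_def)
  then have ne1: "lv l \<noteq> \<one>" for l using c by (auto simp: lv_def letter_value_def)
  have pos: "len (lv l) > 0" for l using len_eq_0[OF lvc ne1[THEN notE]] ne1 len_eq_0 lvc by blast
  have sum: "len (lv l) + len (lv m) = len u + len v" if "fst l \<noteq> fst m" for l m
    using that c by (auto simp: lv_def letter_value_def)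
  \<comment> \<open>Replacing either letter by the product is a Nielsen move, so by minimality the
    product is no shorter than either of them.\<close>
  have M1: "2 * gp (inv (lv l)) (lv m) \<le> len (lv l) \<and> 2 * gp (inv (lv l)) (lv m) \<le> len (lv m)"
    if "fst l \<noteq> fst m" for l m
  proof -
    have "nielsen u v (lv l) (lv m)" unfolding lv_def by (rule nielsen_letters) (use c that in auto)
    then have "len u + len v \<le> len (lv l) + len (lv l \<otimes> lv m)" by (intro min nielsen.mult)
    moreover have "len u + len v \<le> len (lv m) + len (lv l \<otimes> lv m)"
    proof -
      have "nielsen u v (lv (letter_inv m)) (lv (letter_inv l))" unfolding lv_def
        by (rule nielsen_letters) (use c that in \<open>auto simp: letter_inv_def\<close>)
      then have "nielsen u v (inv (lv m)) (inv (lv m) \<otimes> inv (lv l))"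
        by (intro nielsen.mult) simp
      then have "nielsen u v (inv (lv m)) (inv (inv (lv m) \<otimes> inv (lv l)))"
        by (rule nielsen_inv2)
      then have "nielsen u v (inv (lv m)) (lv l \<otimes> lv m)" by (simp add: inv_mult_group)
      from min[OF this] show ?thesis by simp
    qed
    ultimately show ?thesis using sum[OF that] len_mult[OF lvc lvc, of l m] by simp
  qed
  have M3: "\<not> (2 * gp (inv (lv l)) (lv m) = len (lv m) \<and> 2 * gp (inv (lv m)) (lv l) = len (lv m))"
    if "fst l \<noteq> fst m" for l m
  proof
    assume *: "2 * gp (inv (lv l)) (lv m) = len (lv m) \<and> 2 * gp (inv (lv m)) (lv l) = len (lv m)"
    have "len (lv m) \<le> len (lv l)" using M1[OF that] * by simp
    then obtain u' v' where uv: "nielsen (lv m) (lv l) u' v'" "len u' + len v' < len (lv m) + len (lv l)"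
      using half_cancellation[of "lv m" "lv l"] * ne1 by auto
    have "nielsen u v (lv m) (lv l)" unfolding lv_def by (rule nielsen_letters) (use c that in auto)
    then have "nielsen u v u' v'" using uv nielsen_trans by blast
    from min[OF this] uv(2) sum[OF that] show False by simp
  qed
  have half: "2 * gp (inv (lv l)) (lv m) \<le> len (lv l) \<and> 2 * gp (inv (lv l)) (lv m) \<le> len (lv m)"
    if "m \<noteq> letter_inv l" for l m
  proof (cases "fst l = fst m")
    case True
    then have "l = m" using that by (cases l; cases m) (auto simp: letter_inv_def)
    then show ?thesis using gp_inv_self[OF lvc ne1, of m] by simp
  qed (use M1 in blast)
  \<comment> \<open>Only a loss of exactly half on both sides has to be excluded. For distinct
    generators n is then l or its inverse. The first case is \<open>M3\<close>; in the second, m and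
    its inverse would share half of m by the ultrametric inequality, against
    \<open>gp_inv_self\<close>.\<close>
  have chain: "gp (inv (lv l)) (lv m) + gp (inv (lv m)) (lv n) < len (lv m)"
    if lm: "m \<noteq> letter_inv l" and mn: "n \<noteq> letter_inv m" for l m n
  proof (cases "l = m \<or> n = m")
    case True
    then show ?thesis
      using half[OF lm] half[OF mn] gp_inv_self[OF lvc ne1, of m] by auto
  next
    case False
    then have ne: "fst l \<noteq> fst m" "fst n \<noteq> fst m"
      using lm mn by (cases l; cases m; cases n; auto simp: letter_inv_def)+
    show ?thesis
    proof (rule ccontr)
      assume "\<not> ?thesis"
      then have e: "2 * gp (inv (lv l)) (lv m) = len (lv m)" "2 * gp (inv (lv m)) (lv n) = len (lv m)"
        using half[OF lm] half[OF mn] by auto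
      have "n = l \<or> n = letter_inv l" using ne by (cases l; cases n) (auto simp: letter_inv_def)
      then show False
      proof
        assume "n = l" then show False using e M3[OF ne(1)] by simp
      next
        assume "n = letter_inv l"
        then have "gp (lv m) (lv n) = gp (inv (lv l)) (lv m)" by (simp add: gp_sym)
        then have "2 * gp (lv m) (inv (lv m)) \<ge> len (lv m)"
          using gp_ultra[of "lv m" "lv n" "inv (lv m)"] e by (simp add: gp_sym[of "lv n"])
        then show False using gp_inv_self[OF lvc ne1, of m] by (simp add: gp_sym)
      qed
    qed
  qed
  \<comment> \<open>Both claims are needed together: the overlap with a preceding letter depends on
    the first letter only, and so every further letter adds to the length.\<close>
  have main: "m # w \<in> reduced_words \<Longrightarrow> m \<noteq> letter_inv l \<Longrightarrow>
      gp (inv (lv l)) (word_value G u v (m # w)) = gp (inv (lv l)) (lv m) \<and>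
      length (m # w) + gp (inv (lv l)) (lv m) \<le> len (word_value G u v (m # w))" for l m w
  proof (induction w arbitrary: l m)
    case Nil
    have "gp (inv (lv l)) (lv m) < len (lv m)" using half[OF Nil(2)] pos[of m] by linarith
    then show ?case using lvc[of m] by (simp flip: lv_def)
  next
    case (Cons n w)
    have r: "n # w \<in> reduced_words" "n \<noteq> letter_inv m"
      using Cons.prems(1) by (auto simp: reduced_words_iff)
    let ?V = "word_value G u v (n # w)"
    have Vc: "?V \<in> carrier G" using c by simp
    note IH = Cons.IH[OF r]
    have ch: "gp (inv (lv l)) (lv m) + gp (inv (lv m)) (lv n) < len (lv m)"
      by (rule chain) (use Cons.prems r in auto)
    have eq: "word_value G u v (m # n # w) = lv m \<otimes> ?V" by (simp add: lv_def)
    have "gp (lv m) (lv m \<otimes> ?V) + gp (inv (lv m)) (lv n) = len (lv m)"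
      using gp_mult[OF lvc Vc, of m] IH by simp
    then have "gp (inv (lv l)) (lv m) < gp (lv m) (lv m \<otimes> ?V)" using ch by simp
    then have "gp (inv (lv l)) (lv m \<otimes> ?V) = gp (inv (lv l)) (lv m)" by (rule gp_ultra_eq)
    moreover have "len (lv m \<otimes> ?V) + 2 * gp (inv (lv m)) (lv n) = len (lv m) + len ?V"
      using len_mult[OF lvc Vc, of m] IH by simp
    ultimately show ?case using IH ch unfolding eq by simp
  qed
  have letter: "\<exists>l. g = lv l" if g: "g \<in> carrier G" "len g = 1" for g
  proof -
    obtain w where w: "w \<in> reduced_words" "g = word_value G u v w"
      using gens_reduced[OF gen g(1)] by blast
    show ?thesis
    proof (cases w)
      case Nil then show ?thesis using w g by simp
    next
      case (Cons m w')
      then have "length w \<le> 1" using main[of m w' m] w g by simp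
      then have "w' = []" using Cons by simp
      then show ?thesis using w Cons lvc[of m] unfolding lv_def by (intro exI[of _ m]) (use c in simp)
    qed
  qed
  have "len a = 1" "len b = 1" by (simp_all add: len_def nf_a nf_b)
  then obtain l m where lm: "a = lv l" "b = lv m" using letter by (metis a_closed b_closed)
  have "fst l \<noteq> fst m"
  proof
    assume "fst l = fst m"
    then have "m = l \<or> m = letter_inv l" by (cases l; cases m) (auto simp: letter_inv_def)
    then have "b = a \<or> b = inv a" using lm by auto
    then have "ab b = ab a \<or> ab b = - ab a" using ab_inv[OF a_closed] by metis
    then show False by simp
  qed
  from nielsen_letters[OF c this] show ?thesis using lm by (simp add: lv_def)
qed

theorem nielsen_reduction: "gens u v \<Longrightarrow> nielsen u v a b"
proof (induction "len u + len v" arbitrary: u v rule: less_induct)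
  case less
  show ?case
  proof (cases "\<exists>u' v'. nielsen u v u' v' \<and> len u' + len v' < len u + len v")
    case True
    then obtain u' v' where uv: "nielsen u v u' v'" "len u' + len v' < len u + len v" by blast
    from less.hyps[OF uv(2) nielsen_gens[OF uv(1) less.prems]] uv(1)
    show ?thesis using nielsen_trans by blast
  next
    case False
    then show ?thesis using nielsen_minimal_basis[OF less.prems] by (meson not_le)
  qed
qed

lemma gens_ab: "gens a b"
  unfolding gens_def by (metis a_closed b_closed word_value_nf)

lemma free_basis_gens: "free_basis G u v \<Longrightarrow> gens u v"
  unfolding free_basis_def gens_def bij_betw_def by blast

lemma gens_iff_nielsen: "gens u v \<longleftrightarrow> nielsen a b u v"
  using nielsen_reduction nielsen_sym nielsen_gens gens_ab
  by (metis a_closed b_closed gens_def)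

subsection \<open>Automorphisms\<close>

lemma lift_closed:
  "u \<in> carrier G \<Longrightarrow> v \<in> carrier G \<Longrightarrow> g \<in> carrier G \<Longrightarrow> lift G u v g \<in> carrier G"
  by (simp add: lift_def)

lemma lift_mult:
  "u \<in> carrier G \<Longrightarrow> v \<in> carrier G \<Longrightarrow> g \<in> carrier G \<Longrightarrow> h \<in> carrier G \<Longrightarrow>
    lift G u v (g \<otimes> h) = lift G u v g \<otimes> lift G u v h"
  using lift_hom[OF is_group, of u v] by (auto simp: hom_def)

text \<open>Injectivity is the Hopf property of the free group. It comes from an endomorphism that
  takes u, v back to a, b and is carried along the Nielsen moves.\<close>

lemma gens_lift_bij:
  assumes "gens u v" shows "bij_betw (lift G u v) (carrier G) (carrier G)"
proof -
  have c: "u \<in> carrier G" "v \<in> carrier G" using assms by (auto simp: gens_def)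
  have surj: "lift G u v ` carrier G = carrier G"
  proof
    show "lift G u v ` carrier G \<subseteq> carrier G" using c lift_closed by blast
    show "carrier G \<subseteq> lift G u v ` carrier G"
    proof
      fix g assume "g \<in> carrier G"
      then obtain w where "w \<in> reduced_words" "g = word_value G u v w"
        using gens_reduced[OF assms] by blast
      then have "g = lift G u v (word_value G a b w)" by (simp add: lift_def nf_word_value)
      then show "g \<in> lift G u v ` carrier G" by simp
    qed
  qed
  have key: "\<exists>f\<in>hom G G. f u = a \<and> f v = b" if "nielsen a b u v" for u v
    using that
  proof induction
    case base show ?case
      by (rule bexI[of _ "lift G a b"]) (auto simp: lift_a lift_b is_group lift_hom)
  next
    case (mult x y)
    then obtain f where f: "f \<in> hom G G" "f x = a" "f y = b" by blast
    have xy: "x \<in> carrier G" "y \<in> carrier G" using nielsen_closed[OF mult.hyps] by auto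
    let ?e = "lift G a (inv a \<otimes> b)"
    have e: "?e \<in> hom G G" "?e a = a" "?e b = inv a \<otimes> b"
      by (auto simp: lift_a lift_b is_group lift_hom)
    show ?case
      by (rule bexI[of _ "compose (carrier G) ?e f"])
        (use e f xy hom_compose[OF f(1) e(1)] in
          \<open>auto simp: compose_def lift_mult group_cancel hom_mult[OF f(1)] hom_def\<close>)
  next
    case (swap x y)
    then obtain f where f: "f \<in> hom G G" "f x = a" "f y = b" by blast
    have xy: "x \<in> carrier G" "y \<in> carrier G" using nielsen_closed[OF swap.hyps] by auto
    let ?e = "lift G b a"
    have e: "?e \<in> hom G G" "?e a = b" "?e b = a"
      by (auto simp: lift_a lift_b is_group lift_hom)
    show ?case
      by (rule bexI[of _ "compose (carrier G) ?e f"])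
        (use e f xy in \<open>auto simp: compose_def hom_def\<close>)
  next
    case (inv x y)
    then obtain f where f: "f \<in> hom G G" "f x = a" "f y = b" by blast
    have xy: "x \<in> carrier G" "y \<in> carrier G" using nielsen_closed[OF inv.hyps] by auto
    let ?e = "lift G (inv a) b"
    have e: "?e \<in> hom G G" "?e a = inv a" "?e b = b"
      by (auto simp: lift_a lift_b is_group lift_hom)
    interpret f: group_hom G G f by unfold_locales (use f in simp)
    interpret e: group_hom G G ?e by unfold_locales (use e in simp)
    show ?case
      by (rule bexI[of _ "compose (carrier G) ?e f"])
        (use e f xy in \<open>auto simp: compose_def hom_def\<close>)
  next
    case (conj x y k)
    then obtain f where f: "f \<in> hom G G" "f x = a" "f y = b" by blast
    have xy: "x \<in> carrier G" "y \<in> carrier G" using nielsen_closed[OF conj.hyps(1)] by auto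
    interpret f: group_hom G G f by unfold_locales (use f in simp)
    have k: "k \<in> carrier G" by fact
    show ?case
      by (rule bexI[of _ "\<lambda>g. inv (f k) \<otimes> f g \<otimes> f k"])
        (use f xy k in \<open>auto simp: hom_def group_cancel\<close>)
  qed
  from assms have "nielsen a b u v" by (simp add: gens_iff_nielsen)
  then obtain f where f: "f \<in> hom G G" "f u = a" "f v = b" using key by blast
  have "f (lift G u v g) = g" if "g \<in> carrier G" for g
  proof -
    have "f (lift G u v g) = word_value G (f u) (f v) (nf g)"
      using hom_word_value[OF is_group f(1) c] that by (simp add: lift_def)
    then show ?thesis using f that by simp
  qed
  then have "inj_on (lift G u v) (carrier G)" by (metis inj_onI)
  then show ?thesis using surj by (simp add: bij_betw_def)
qed

lemma gens_lift_auto: "gens u v \<Longrightarrow> lift G u v \<in> auto G"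
  using gens_lift_bij lift_hom[OF is_group] lift_extensional
  by (auto simp: auto_def Bij_def gens_def)

lemma gens_imp_free_basis:
  assumes "gens u v" shows "free_basis G u v"
proof -
  have c: "u \<in> carrier G" "v \<in> carrier G" using assms by (auto simp: gens_def)
  have "bij_betw (lift G u v \<circ> word_value G a b) reduced_words (carrier G)"
    using bij_betw_trans[OF bij_word_value gens_lift_bij[OF assms]] .
  moreover have "(lift G u v \<circ> word_value G a b) w = word_value G u v w" if "w \<in> reduced_words" for w
    using that by (simp add: lift_def nf_word_value)
  ultimately have "bij_betw (word_value G u v) reduced_words (carrier G)"
    by (metis (no_types, lifting) bij_betw_cong)
  then show ?thesis using c by (simp add: free_basis_def)
qed

lemma free_basis_iff_gens: "free_basis G u v \<longleftrightarrow> gens u v"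
  using gens_imp_free_basis free_basis_gens by blast

section \<open>Bases with equal abelianization are conjugate\<close>

inductive pos :: "'g \<Rightarrow> 'g \<Rightarrow> 'g \<Rightarrow> bool" for e where
  base: "pos e e b"
| left: "pos e x y \<Longrightarrow> pos e x (x \<otimes> y)"
| right: "pos e x y \<Longrightarrow> pos e (x \<otimes> y) y"

inductive std :: "'g \<Rightarrow> 'g \<Rightarrow> bool" where
  pos: "e = a \<or> e = inv a \<Longrightarrow> pos e x y \<Longrightarrow> std x y"
| swap: "std u v \<Longrightarrow> std v u"
| inv: "std u v \<Longrightarrow> std (inv u) v"
| conj: "std u v \<Longrightarrow> k \<in> carrier G \<Longrightarrow> std (k \<otimes> u \<otimes> inv k) (k \<otimes> v \<otimes> inv k)"

lemma pos_closed: "pos e x y \<Longrightarrow> e \<in> carrier G \<Longrightarrow> x \<in> carrier G \<and> y \<in> carrier G"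
  by (induction rule: pos.induct) auto

lemma std_closed: "std u v \<Longrightarrow> u \<in> carrier G \<and> v \<in> carrier G"
proof (induction rule: std.induct)
  case (pos e x y) then show ?case using pos_closed[OF pos(2)] by auto
qed auto

lemma std_inv2: "std u v \<Longrightarrow> std u (inv v)"
  by (rule std.swap, rule std.inv, rule std.swap)

lemma std_conj':
  assumes "std u v" "k \<in> carrier G" "u' = k \<otimes> u \<otimes> inv k" "v' = k \<otimes> v \<otimes> inv k"
  shows "std u' v'"
  using std.conj[OF assms(1,2)] assms(3,4) by simp

text \<open>Closure under products is what makes every basis standard. For a positive pair only inv
  x y needs an argument. If the last step replaced y, it is undone; if it replaced x, the quotient
  is conjugate to the inverse of the old x; at the initial pair, e turns into its inverse.\<close>

lemma std_products:
  assumes "std u v"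
  shows "std u (u \<otimes> v) \<and> std u (inv u \<otimes> v) \<and> std v (u \<otimes> v) \<and> std v (inv u \<otimes> v)"
  using assms
proof induction
  case (pos e x y)
  have e: "e \<in> carrier G" using pos by auto
  have c: "x \<in> carrier G" "y \<in> carrier G" using pos_closed[OF pos(2) e] by auto
  have 1: "std x (x \<otimes> y)" "std y (x \<otimes> y)"
    using std.pos[OF pos(1) pos.left[OF pos(2)]] std.swap[OF std.pos[OF pos(1) pos.right[OF pos(2)]]]
    by simp_all
  from pos(2) have 2: "std x (inv x \<otimes> y) \<and> std y (inv x \<otimes> y)"
  proof cases
    case base
    have e': "inv e = a \<or> inv e = inv a" using pos(1) by auto
    have "std (inv e) (inv e \<otimes> b)" by (rule std.pos[OF e'], rule pos.left, rule pos.base)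
    then have "std (inv (inv e)) (inv e \<otimes> b)" by (rule std.inv)
    moreover have "std b (inv e \<otimes> b)"
      by (rule std.swap, rule std.pos[OF e'], rule pos.right, rule pos.base)
    ultimately show ?thesis using base e by simp
  next
    case (left y')
    then have c': "y' \<in> carrier G" using pos_closed e by blast
    have "std x y'" using pos(1) left(2) by (rule std.pos)
    moreover have "std (x \<otimes> y') y'" using pos(1) pos.right[OF left(2)] by (rule std.pos)
    ultimately show ?thesis using left(1) c c' by (simp add: inv_cancel_left')
  next
    case (right x')
    then have c': "x' \<in> carrier G" using pos_closed e by blast
    have b: "std x' y" "std x' (x' \<otimes> y)"
      using std.pos[OF pos(1) right(2)] std.pos[OF pos(1) pos.left[OF right(2)]] by simp_all
    have eq: "inv x \<otimes> y = inv y \<otimes> inv x' \<otimes> y" using right c c' by (simp add: group_cancel)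
    have "std y (inv x')" using std_inv2[OF std.swap[OF b(1)]] .
    then have "std y (inv y \<otimes> inv x' \<otimes> y)"
      by (rule std_conj'[where k = "inv y"]) (use c c' in \<open>auto simp: group_cancel\<close>)
    moreover have "std x (inv y \<otimes> inv x' \<otimes> y)"
    proof -
      have "std (x' \<otimes> y) (inv x')" using std_inv2[OF std.swap[OF b(2)]] .
      then have "std (inv (x' \<otimes> y) \<otimes> (x' \<otimes> y) \<otimes> inv (inv (x' \<otimes> y)))
          (inv (x' \<otimes> y) \<otimes> inv x' \<otimes> inv (inv (x' \<otimes> y)))"
        by (rule std.conj) (use c c' in auto)
      then show ?thesis using right c c' by (simp add: group_cancel)
    qed
    ultimately show ?thesis using eq by simp
  qed
  show ?case using 1 2 by blast
next
  case (swap u v)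
  have c: "u \<in> carrier G" "v \<in> carrier G" using std_closed[OF swap(1)] by auto
  have 1: "std v (v \<otimes> u)"
    by (rule std_conj'[where k = v and u = v and v = "u \<otimes> v"])
      (use swap c in \<open>auto simp: group_cancel\<close>)
  have 2: "std u (v \<otimes> u)"
    by (rule std_conj'[where k = "inv u" and u = u and v = "u \<otimes> v"])
      (use swap c in \<open>auto simp: group_cancel\<close>)
  have 3: "std v (inv v \<otimes> u)" "std u (inv v \<otimes> u)"
    using swap std_inv2[of v "inv u \<otimes> v"] std_inv2[of u "inv u \<otimes> v"] c
    by (auto simp: inv_mult_group)
  show ?case using 1 2 3 by blast
next
  case (inv u v)
  then show ?case using std_closed[OF inv(1)] by (simp add: std.inv)
next
  case (conj u v k)
  have c: "u \<in> carrier G" "v \<in> carrier G" using std_closed[OF conj(1)] by auto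
  have 1: "(k \<otimes> u \<otimes> inv k) \<otimes> (k \<otimes> v \<otimes> inv k) = k \<otimes> (u \<otimes> v) \<otimes> inv k"
    using c conj by (simp add: group_cancel)
  have 2: "inv (k \<otimes> u \<otimes> inv k) \<otimes> (k \<otimes> v \<otimes> inv k) = k \<otimes> (inv u \<otimes> v) \<otimes> inv k"
    using c conj by (simp add: group_cancel)
  show ?case unfolding 1 2 using conj.IH std.conj[OF _ conj.hyps(2)] by simp
qed

lemma nielsen_std: "nielsen a b u v \<Longrightarrow> std u v"
proof (induction rule: nielsen.induct)
  case base show ?case by (rule std.pos[of a]) (auto intro: pos.base)
next
  case (mult u v) show ?case using std_products[OF mult.IH] by simp
next
  case (swap u v) show ?case by (rule std.swap[OF swap.IH])
next
  case (inv u v) show ?case by (rule std.inv[OF inv.IH])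
next
  case (conj u v k) show ?case by (rule std.conj[OF conj.IH conj.hyps(2)])
qed

definition norm1 :: "int \<times> int \<Rightarrow> int" where "norm1 w = \<bar>fst w\<bar> + \<bar>snd w\<bar>"

definition quadrant :: "int \<Rightarrow> int \<times> int \<Rightarrow> bool" where
  "quadrant s w \<longleftrightarrow> s * fst w \<ge> 0 \<and> snd w \<ge> 0 \<and> norm1 w \<ge> 1"

lemma quadrant_add:
  assumes "s = 1 \<or> s = -1" "quadrant s w" "quadrant s w'"
  shows "quadrant s (w + w')" "norm1 (w + w') = norm1 w + norm1 w'"
proof -
  obtain p q p' q' where w: "w = (p, q)" "w' = (p', q')" by fastforce
  show "quadrant s (w + w')" "norm1 (w + w') = norm1 w + norm1 w'"
    using assms(1)
    by (elim disjE; use assms(2,3) in \<open>simp add: w quadrant_def norm1_def\<close>)+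
qed

text \<open>Within one quadrant \<open>norm1\<close> is additive, so every step increases the total
  and only the initial pair has total 2.\<close>

lemma pos_norm1:
  assumes "pos e x y" "e = a \<and> s = 1 \<or> e = inv a \<and> s = -1"
  shows "quadrant s (ab x) \<and> quadrant s (ab y)
    \<and> (norm1 (ab x) + norm1 (ab y) \<le> 2 \<longrightarrow> x = e \<and> y = b)"
proof -
  have s: "s = 1 \<or> s = -1" and e: "e \<in> carrier G" using assms(2) by auto
  show ?thesis using assms(1)
  proof (induction rule: pos.induct)
    case base
    have "ab e = (s, 0)" using assms(2) by auto
    then show ?case using s by (auto simp: quadrant_def norm1_def)
  next
    case (left x y)
    have "ab (x \<otimes> y) = ab x + ab y" using pos_closed[OF left(1) e] by simp
    moreover have "norm1 (ab x) \<ge> 1" "norm1 (ab y) \<ge> 1" using left.IH by (auto simp: quadrant_def)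
    ultimately show ?case using left.IH quadrant_add[OF s, of "ab x" "ab y"] by simp
  next
    case (right x y)
    have "ab (x \<otimes> y) = ab x + ab y" using pos_closed[OF right(1) e] by simp
    moreover have "norm1 (ab x) \<ge> 1" "norm1 (ab y) \<ge> 1" using right.IH by (auto simp: quadrant_def)
    ultimately show ?case using right.IH quadrant_add[OF s, of "ab x" "ab y"] by simp
  qed
qed

definition conj_letters :: "'g \<Rightarrow> 'g \<Rightarrow> bool" where
  "conj_letters u v \<longleftrightarrow> (\<exists>k l m. k \<in> carrier G \<and> fst l \<noteq> fst m \<and>
     u = k \<otimes> letter_value G a b l \<otimes> inv k \<and> v = k \<otimes> letter_value G a b m \<otimes> inv k)"

lemma conj_letters_swap: "conj_letters u v \<Longrightarrow> conj_letters v u"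
  unfolding conj_letters_def by metis

lemma conj_letters_inv: "conj_letters u v \<Longrightarrow> conj_letters (inv u) v"
proof -
  assume "conj_letters u v"
  then obtain k l m where k: "k \<in> carrier G" "fst l \<noteq> fst m"
    "u = k \<otimes> letter_value G a b l \<otimes> inv k" "v = k \<otimes> letter_value G a b m \<otimes> inv k"
    unfolding conj_letters_def by blast
  then have "inv u = k \<otimes> letter_value G a b (letter_inv l) \<otimes> inv k"
    by (simp add: group_cancel letter_value_inv)
  moreover have "fst (letter_inv l) \<noteq> fst m" using k by (simp add: letter_inv_def)
  ultimately show ?thesis using k unfolding conj_letters_def by blast
qed

lemma conj_letters_conj:
  assumes "conj_letters u v" "h \<in> carrier G"
  shows "conj_letters (h \<otimes> u \<otimes> inv h) (h \<otimes> v \<otimes> inv h)"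
proof -
  obtain k l m where k: "k \<in> carrier G" "fst l \<noteq> fst m"
    "u = k \<otimes> letter_value G a b l \<otimes> inv k" "v = k \<otimes> letter_value G a b m \<otimes> inv k"
    using assms unfolding conj_letters_def by blast
  show ?thesis unfolding conj_letters_def
    by (rule exI[of _ "h \<otimes> k"], rule exI[of _ l], rule exI[of _ m])
      (use k assms(2) in \<open>auto simp: group_cancel\<close>)
qed

lemma std_norm1:
  assumes "std u v" "norm1 (ab u) + norm1 (ab v) \<le> 2"
  shows "conj_letters u v"
  using assms
proof induction
  case (pos e x y)
  have "\<exists>s. e = a \<and> s = (1::int) \<or> e = inv a \<and> s = -1" using pos(1) by auto
  then have "x = e" "y = b" using pos_norm1[OF pos(2)] pos(3) by blast+
  then show ?case using pos(1) unfolding conj_letters_def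
    by (intro exI[of _ \<one>] exI[of _ "(False, e \<noteq> a)"] exI[of _ "(True, False)"])
      (auto simp: letter_value_def)
next
  case (swap u v)
  then show ?case using conj_letters_swap[of u v] by (simp add: add.commute)
next
  case (inv u v)
  then show ?case using std_closed[OF inv(1)] by (auto simp: norm1_def intro: conj_letters_inv)
next
  case (conj u v k)
  have "ab (k \<otimes> u \<otimes> inv k) = ab u" "ab (k \<otimes> v \<otimes> inv k) = ab v"
    using conj std_closed[OF conj(1)] by auto
  then show ?case using conj conj_letters_conj by simp
qed

text \<open>Nielsen's theorem that automorphisms acting trivially on the abelianization are inner,
  in terms of bases. The pair is standard of total norm 2, so it consists of conjugated letters,
  which the abelianization identifies.\<close>

lemma gens_ab_id:
  assumes gen: "gens u v" and u: "ab u = (1, 0)" and v: "ab v = (0, 1)"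
  shows "\<exists>k\<in>carrier G. u = k \<otimes> a \<otimes> inv k \<and> v = k \<otimes> b \<otimes> inv k"
proof -
  have "std u v" using gen nielsen_std gens_iff_nielsen by blast
  then have "conj_letters u v" by (rule std_norm1) (simp add: u v norm1_def)
  then obtain k l m where k: "k \<in> carrier G" "fst l \<noteq> fst m"
    "u = k \<otimes> letter_value G a b l \<otimes> inv k" "v = k \<otimes> letter_value G a b m \<otimes> inv k"
    unfolding conj_letters_def by blast
  have abl: "ab (k \<otimes> letter_value G a b n \<otimes> inv k) = ab (letter_value G a b n)" for n
    using k(1) by simp
  have ablv: "ab (letter_value G a b n) =
      (if fst n then (0, if snd n then -1 else 1) else (if snd n then -1 else 1, 0))" for n
    by (simp add: letter_value_def)
  have "l = (False, False)" "m = (True, False)"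
    using u v unfolding k(3,4) abl ablv by (cases l; cases m; simp split: if_splits)+
  then have "u = k \<otimes> a \<otimes> inv k \<and> v = k \<otimes> b \<otimes> inv k"
    using k(3,4) by (simp add: letter_value_def)
  then show ?thesis using k(1) by blast
qed

lemma ab_lift:
  assumes u: "u \<in> carrier G" and v: "v \<in> carrier G" and g: "g \<in> carrier G"
  shows "ab (lift G u v g) = lin (ab u) (ab v) (ab g)"
proof -
  have 1: "(\<lambda>g. ab (lift G u v g)) \<in> hom G Z2"
    by (rule homI) (simp_all add: lift_mult[OF u v] lift_closed[OF u v])
  have 2: "(\<lambda>g. lin (ab u) (ab v) (ab g)) \<in> hom G Z2"
    by (rule homI) simp_all
  show ?thesis
    by (rule hom_eqI[OF group_Z2 1 2 _ _ g]) (simp_all add: lift_a[OF is_group u v] lift_b[OF is_group u v])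
qed

text \<open>Undoing the automorphism that sends (a, b) to (u, v) reduces this to
  \<open>gens_ab_id\<close>.\<close>

theorem same_ab_conj:
  assumes g: "gens u v" and g': "gens u' v'" and eq: "ab u = ab u'" "ab v = ab v'"
  shows "\<exists>k\<in>carrier G. u' = k \<otimes> u \<otimes> inv k \<and> v' = k \<otimes> v \<otimes> inv k"
proof -
  have c: "u \<in> carrier G" "v \<in> carrier G" "u' \<in> carrier G" "v' \<in> carrier G"
    using g g' by (auto simp: gens_def)
  have surj: "lift G u v ` carrier G = carrier G" using gens_lift_bij[OF g] by (simp add: bij_betw_def)
  have inj: "inj_on (lift G u v) (carrier G)" using gens_lift_bij[OF g] by (simp add: bij_betw_def)
  obtain x y where xy: "x \<in> carrier G" "u' = lift G u v x" "y \<in> carrier G" "v' = lift G u v y"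
    using c surj by (metis imageE)
  have det: "det2 (ab u) (ab v) \<noteq> 0" using gens_det[OF g] by auto
  have "ab x = (1, 0)"
    by (rule lin_inject[OF det]) (metis lin_simps(1) eq(1) xy(2) ab_lift[OF c(1,2) xy(1)])
  moreover have "ab y = (0, 1)"
    by (rule lin_inject[OF det]) (metis lin_simps(2) eq(2) xy(4) ab_lift[OF c(1,2) xy(3)])
  moreover have "gens x y" unfolding gens_def
  proof (intro conjI ballI)
    fix h assume h: "h \<in> carrier G"
    then obtain w where w: "lift G u v h = word_value G u' v' w"
      using g' lift_closed[OF c(1,2) h] unfolding gens_def by blast
    also have "\<dots> = lift G u v (word_value G x y w)"
      unfolding xy(2,4)
      by (rule hom_word_value[OF is_group lift_hom[OF is_group c(1,2)] xy(1,3), symmetric])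
    finally have "h = word_value G x y w"
      by (rule inj_onD[OF inj]) (use h xy(1,3) in simp_all)
    then show "\<exists>w. h = word_value G x y w" by blast
  qed (use xy in auto)
  ultimately obtain k where k: "k \<in> carrier G" "x = k \<otimes> a \<otimes> inv k" "y = k \<otimes> b \<otimes> inv k"
    using gens_ab_id by blast
  let ?f = "lift G u v"
  interpret f: group_hom G G ?f by unfold_locales (use lift_hom[OF is_group] c in auto)
  have "?f a = u" "?f b = v" using c by (simp_all add: lift_a lift_b is_group)
  then have "u' = ?f k \<otimes> u \<otimes> inv (?f k)" "v' = ?f k \<otimes> v \<otimes> inv (?f k)"
    unfolding xy(2,4) k(2,3) using k(1) by simp_all
  moreover have "?f k \<in> carrier G" using k(1) by simp
  ultimately show ?thesis by blast
qed

section \<open>Slopes of primitive elements, and oriented bases\<close>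

lemma gens_moves:
  assumes "gens u v"
  shows "gens u (u \<otimes> v)" "gens u (inv u \<otimes> v)" "gens v u" "gens u (inv v)" "gens (inv u) v"
proof -
  have n: "nielsen a b u v" using assms by (simp add: gens_iff_nielsen)
  have c: "u \<in> carrier G" using assms by (simp add: gens_def)
  have "nielsen a b (inv u) (inv u \<otimes> v)" using n by (intro nielsen.mult nielsen.inv)
  from nielsen.inv[OF this] show "gens u (inv u \<otimes> v)" using c by (simp add: gens_iff_nielsen)
  show "gens u (u \<otimes> v)" "gens v u" "gens u (inv v)" "gens (inv u) v"
    using nielsen.mult[OF n] nielsen.swap[OF n] nielsen_inv2[OF n] nielsen.inv[OF n]
    by (simp_all add: gens_iff_nielsen)
qed

lemma gens_twist:
  assumes "gens u v"
  shows "\<exists>v'. gens u v' \<and> ab v' = lin (ab u) (ab v) (n, 1)"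
proof -
  have c: "u \<in> carrier G" using assms by (simp add: gens_def)
  have p: "\<exists>v'. gens u v' \<and> ab v' = lin (ab u) (ab v) (int k, 1)" for k
  proof (induction k)
    case 0 show ?case using assms by auto
  next
    case (Suc k)
    then obtain v' where v': "gens u v'" "ab v' = lin (ab u) (ab v) (int k, 1)" by blast
    moreover have "v' \<in> carrier G" using v' by (simp add: gens_def)
    ultimately show ?case using gens_moves(1)[OF v'(1)] c
      by (intro exI[of _ "u \<otimes> v'"]) (auto simp: lin_def algebra_simps prod_eq_iff)
  qed
  have m: "\<exists>v'. gens u v' \<and> ab v' = lin (ab u) (ab v) (- int k, 1)" for k
  proof (induction k)
    case 0 show ?case using assms by auto
  next
    case (Suc k)
    then obtain v' where v': "gens u v'" "ab v' = lin (ab u) (ab v) (- int k, 1)" by blast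
    moreover have "v' \<in> carrier G" using v' by (simp add: gens_def)
    ultimately show ?case using gens_moves(2)[OF v'(1)] c
      by (intro exI[of _ "inv u \<otimes> v'"]) (auto simp: lin_def algebra_simps prod_eq_iff)
  qed
  show ?thesis using p[of "nat n"] m[of "nat (- n)"] by (cases "n \<ge> 0") auto
qed

text \<open>The partner of u may be inverted and multiplied by powers of u. This is all the freedom
  a partner has in the abelianization, so it can be matched with v', and \<open>same_ab_conj\<close>
  applies.\<close>

theorem primitive_conj:
  assumes g: "gens u v" and g': "gens u' v'" and eq: "ab u = ab u'"
  shows "\<exists>k\<in>carrier G. u' = k \<otimes> u \<otimes> inv k"
proof -
  have c: "v \<in> carrier G" "v' \<in> carrier G" using g g' by (auto simp: gens_def)
  obtain v1 where v1: "gens u v1" "det2 (ab u) (ab v1) = det2 (ab u) (ab v')"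
  proof (cases "det2 (ab u) (ab v) = det2 (ab u) (ab v')")
    case True then show ?thesis using g that by blast
  next
    case False
    have "\<bar>det2 (ab u) (ab v)\<bar> = 1" "\<bar>det2 (ab u) (ab v')\<bar> = 1"
      using gens_det[OF g] gens_det[OF g'] eq by auto
    with False have "det2 (ab u) (ab v') = - det2 (ab u) (ab v)" by linarith
    then show ?thesis using that[of "inv v"] gens_moves(4)[OF g] c by simp
  qed
  define D where "D = det2 (ab u) (ab v1)"
  have D: "D * D = 1" using gens_det[OF v1(1)] unfolding D_def
    by (metis abs_mult abs_mult_self_eq mult_1)
  have z: "det2 (ab u) (ab v' - ab v1) = 0" using v1 by simp
  \<comment> \<open>The coordinate of ab v' - ab v1 along ab u; since D is 1 or -1, multiplying by D
    divides by it.\<close>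
  define n where "n = D * det2 (ab v' - ab v1) (ab v1)"
  have "fst (lin (ab u) (ab v1) (n, 1)) = fst (ab v') \<and> snd (lin (ab u) (ab v1) (n, 1)) = snd (ab v')"
  proof -
    obtain p q r s t w where *: "ab u = (p, q)" "ab v1 = (r, s)" "ab v' - ab v1 = (t, w)"
      by (metis surj_pair)
    have v': "ab v' = (r + t, s + w)" using * by (metis add_Pair diff_add_cancel add.commute)
    have zz: "p * w = q * t" using z unfolding *(1,3) by (simp add: det2_def)
    have DD: "D = p * s - q * r" using * by (simp add: D_def det2_def)
    have "det2 (ab v' - ab v1) (ab v1) = t * s - w * r"
      unfolding *(3) unfolding *(2) det2_def by simp
    then have n: "n = D * (t * s - w * r)" by (simp add: n_def)
    have "n * p = D * (t * s * p - w * r * p)" unfolding n by (simp add: algebra_simps)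
    also have "\<dots> = D * (t * (p * s) - (p * w) * r)" by (simp add: algebra_simps)
    also have "\<dots> = D * D * t" unfolding zz DD by (simp add: algebra_simps)
    finally have 1: "n * p = t" using D by simp
    have "n * q = D * ((q * t) * s - w * (q * r))" unfolding n by (simp add: algebra_simps)
    also have "\<dots> = D * D * w" unfolding zz[symmetric] DD by (simp add: algebra_simps)
    finally have 2: "n * q = w" using D by simp
    show ?thesis using 1 2 v' * by (simp add: lin_def)
  qed
  then have "ab v' = lin (ab u) (ab v1) (n, 1)" by (simp add: prod_eq_iff)
  then obtain v2 where "gens u v2" "ab v2 = ab v'" using gens_twist[OF v1(1)] by metis
  then show ?thesis using same_ab_conj[OF _ g' eq] by blast
qed

lemma commutator_closed [simp]:
  "u \<in> carrier G \<Longrightarrow> v \<in> carrier G \<Longrightarrow> commutator G u v \<in> carrier G"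
  by (simp add: commutator_def)

lemma commutator_moves:
  assumes "u \<in> carrier G" "v \<in> carrier G"
  shows "commutator G u (u \<otimes> v) = u \<otimes> commutator G u v \<otimes> inv u"
    "commutator G u (inv u \<otimes> v) = inv u \<otimes> commutator G u v \<otimes> u"
    "commutator G v (inv u) = inv u \<otimes> commutator G u v \<otimes> u"
  using assms by (simp_all add: commutator_def group_cancel)

text \<open>The images of (a, b) under the automorphisms in \<open>orientation_auts\<close>.\<close>

definition oriented :: "'g \<Rightarrow> 'g \<Rightarrow> bool" where
  "oriented u v \<longleftrightarrow> gens u v \<and>
    (\<exists>k\<in>carrier G. commutator G u v = k \<otimes> commutator G a b \<otimes> inv k)"

lemma oriented_moves:
  assumes "oriented u v"
  shows "oriented u (u \<otimes> v)" "oriented u (inv u \<otimes> v)" "oriented v (inv u)"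
proof -
  have g: "gens u v" using assms by (simp add: oriented_def)
  then have c: "u \<in> carrier G" "v \<in> carrier G" by (auto simp: gens_def)
  obtain k where k: "k \<in> carrier G" "commutator G u v = k \<otimes> commutator G a b \<otimes> inv k"
    using assms unfolding oriented_def by blast
  have "commutator G u (u \<otimes> v) = (u \<otimes> k) \<otimes> commutator G a b \<otimes> inv (u \<otimes> k)"
    using commutator_moves(1)[OF c] k c by (simp add: group_cancel)
  moreover have "u \<otimes> k \<in> carrier G" using c k by simp
  ultimately show "oriented u (u \<otimes> v)" using gens_moves(1)[OF g] unfolding oriented_def by blast
  have ik: "inv u \<otimes> k \<in> carrier G" using c k by simp
  have "inv u \<otimes> commutator G u v \<otimes> u = (inv u \<otimes> k) \<otimes> commutator G a b \<otimes> inv (inv u \<otimes> k)"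
    using k c by (simp add: group_cancel)
  then have "commutator G u (inv u \<otimes> v) = (inv u \<otimes> k) \<otimes> commutator G a b \<otimes> inv (inv u \<otimes> k)"
    "commutator G v (inv u) = (inv u \<otimes> k) \<otimes> commutator G a b \<otimes> inv (inv u \<otimes> k)"
    using commutator_moves(2,3)[OF c] by simp_all
  moreover have "gens v (inv u)" using gens_moves(3)[OF gens_moves(5)[OF g]] .
  ultimately show "oriented u (inv u \<otimes> v)" "oriented v (inv u)"
    using gens_moves(2)[OF g] ik unfolding oriented_def by blast+
qed

theorem oriented_basis_exists:
  assumes "det2 U V = 1"
  shows "\<exists>u v. oriented u v \<and> ab u = U \<and> ab v = V"
  using assms
proof (induction rule: sl2_induct)
  case base
  have "oriented a b" unfolding oriented_def using gens_ab by (auto intro!: bexI[of _ \<one>])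
  then show ?case using ab_a ab_b by blast
next
  case (add U V)
  from add(2) obtain u v where uv: "oriented u v" "ab u = U" "ab v = V" by blast
  then have "u \<in> carrier G" "v \<in> carrier G" by (auto simp: gens_def oriented_def)
  then have "ab (u \<otimes> v) = V + U" using uv by (simp add: add.commute)
  then show ?case using uv oriented_moves(1)[OF uv(1)] by blast
next
  case (sub U V)
  from sub(2) obtain u v where uv: "oriented u v" "ab u = U" "ab v = V" by blast
  then have "u \<in> carrier G" "v \<in> carrier G" by (auto simp: gens_def oriented_def)
  then have "ab (inv u \<otimes> v) = V - U" using uv by simp
  then show ?case using uv oriented_moves(2)[OF uv(1)] by blast
next
  case (rot U V)
  from rot(2) obtain u v where uv: "oriented u v" "ab u = U" "ab v = V" by blast
  then have "u \<in> carrier G" by (auto simp: gens_def oriented_def)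
  then have "ab (inv u) = - U" using uv by simp
  then show ?case using uv oriented_moves(3)[OF uv(1)] by blast
qed

end

section \<open>Traces in \<open>SL(2, \<complex>)\<close>\<close>

definition mat2 :: "complex \<Rightarrow> complex \<Rightarrow> complex \<Rightarrow> complex \<Rightarrow> complex^2^2" where
  "mat2 p q r s = vector [vector [p, q], vector [r, s]]"

lemma mat2_nth [simp]:
  "mat2 p q r s $ 1 $ 1 = p" "mat2 p q r s $ 1 $ 2 = q"
  "mat2 p q r s $ 2 $ 1 = r" "mat2 p q r s $ 2 $ 2 = s"
  by (simp_all add: mat2_def)

definition adj2 :: "complex^2^2 \<Rightarrow> complex^2^2" where
  "adj2 A = mat2 (A$2$2) (- (A$1$2)) (- (A$2$1)) (A$1$1)"

lemma trace_2: "trace (A :: complex^2^2) = A$1$1 + A$2$2"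
  by (simp add: trace_def sum_2)

lemma adj2_mult: "adj2 A ** A = mat (det A)"
  by (simp add: vec_eq_iff forall_2 adj2_def matrix_matrix_mult_def sum_2 mat_def det_2 algebra_simps)

lemma det_adj2: "det (adj2 A) = det A"
  by (simp add: adj2_def det_2 algebra_simps)

lemma trace_adj2: "trace (adj2 A) = trace A"
  by (simp add: adj2_def trace_2)

lemma trace_mult_adj2: "trace (A ** B) + trace (adj2 A ** B) = trace A * trace B"
  by (simp add: trace_2 adj2_def matrix_matrix_mult_def sum_2 algebra_simps)

lemma SL2C_simps [simp]:
  "A \<in> carrier SL2C \<longleftrightarrow> det A = 1" "A \<otimes>\<^bsub>SL2C\<^esub> B = A ** B" "\<one>\<^bsub>SL2C\<^esub> = mat 1"
  by (auto simp: SL2C_def)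

lemma group_SL2C: "group SL2C"
proof (rule groupI)
  fix A assume A: "A \<in> carrier SL2C"
  show "\<exists>B\<in>carrier SL2C. B \<otimes>\<^bsub>SL2C\<^esub> A = \<one>\<^bsub>SL2C\<^esub>"
    by (rule bexI[of _ "adj2 A"]) (use A in \<open>auto simp: adj2_mult det_adj2\<close>)
qed (auto simp: det_mul matrix_mul_assoc)

lemma SL2C_inv [simp]: "det A = 1 \<Longrightarrow> inv\<^bsub>SL2C\<^esub> A = adj2 A"
  by (rule group.inv_equality[OF group_SL2C]) (auto simp: adj2_mult det_adj2)

lemma trace_conj:
  fixes A M :: "complex^2^2"
  assumes "det A = 1" shows "trace (A ** M ** adj2 A) = trace M"
  by (subst trace_mul_sym) (simp add: matrix_mul_assoc adj2_mult assms)

context free2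
begin

lemma rho_mult:
  assumes "\<rho> \<in> hom G SL2C" "g \<in> carrier G" "h \<in> carrier G"
  shows "\<rho> (g \<otimes> h) = \<rho> g ** \<rho> h"
  using hom_mult[OF assms] by simp

lemma rho_det: "\<rho> \<in> hom G SL2C \<Longrightarrow> g \<in> carrier G \<Longrightarrow> det (\<rho> g) = 1"
  using hom_in_carrier[of \<rho> G SL2C g] by simp

lemma rho_inv:
  assumes r: "\<rho> \<in> hom G SL2C" and g: "g \<in> carrier G"
  shows "\<rho> (inv g) = adj2 (\<rho> g)"
proof -
  interpret h: group_hom G SL2C \<rho>
    using r by (simp add: group_hom_def group_hom_axioms_def is_group group_SL2C)
  show ?thesis using h.hom_inv[OF g] by (simp add: rho_det[OF r g])
qed

lemma tr_inv: "\<rho> \<in> hom G SL2C \<Longrightarrow> g \<in> carrier G \<Longrightarrow> trace (\<rho> (inv g)) = trace (\<rho> g)"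
  by (simp add: rho_inv trace_adj2)

lemma tr_mult:
  assumes r: "\<rho> \<in> hom G SL2C" and g: "g \<in> carrier G" and h: "h \<in> carrier G"
  shows "trace (\<rho> (g \<otimes> h)) + trace (\<rho> (inv g \<otimes> h)) = trace (\<rho> g) * trace (\<rho> h)"
  unfolding rho_mult[OF r g h] rho_mult[OF r inv_closed[OF g] h] rho_inv[OF r g]
  by (rule trace_mult_adj2)

lemma tr_comm:
  assumes r: "\<rho> \<in> hom G SL2C" and g: "g \<in> carrier G" and h: "h \<in> carrier G"
  shows "trace (\<rho> (g \<otimes> h)) = trace (\<rho> (h \<otimes> g))"
  unfolding rho_mult[OF r g h] rho_mult[OF r h g] by (rule trace_mul_sym)

lemma tr_conj:
  assumes r: "\<rho> \<in> hom G SL2C" and g: "g \<in> carrier G" and k: "k \<in> carrier G"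
  shows "trace (\<rho> (k \<otimes> g \<otimes> inv k)) = trace (\<rho> g)"
  unfolding rho_mult[OF r m_closed[OF k g] inv_closed[OF k]] rho_mult[OF r k g] rho_inv[OF r k]
  by (rule trace_conj[OF rho_det[OF r k]])

abbreviation coords :: "('g \<Rightarrow> complex^2^2) \<Rightarrow> complex \<times> complex \<times> complex" where
  "coords \<equiv> rep_coords G a b"

text \<open>Carrying the trace of the product along closes the induction: tr (g h) + tr (inv g h) =
  tr g tr h expresses the three traces of a new pair through those of the old one.\<close>

lemma nielsen_trace_eq:
  assumes "\<rho> \<in> hom G SL2C" "\<sigma> \<in> hom G SL2C" "coords \<rho> = coords \<sigma>" "nielsen a b u v"
  shows "trace (\<rho> u) = trace (\<sigma> u) \<and> trace (\<rho> v) = trace (\<sigma> v) \<and>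
    trace (\<rho> (u \<otimes> v)) = trace (\<sigma> (u \<otimes> v))"
  using assms(4)
proof induction
  case base then show ?case using assms(3) by (simp add: rep_coords_def)
next
  case (mult u v)
  have c: "u \<in> carrier G" "v \<in> carrier G" using nielsen_closed[OF mult.hyps] by auto
  have "trace (\<tau> (u \<otimes> (u \<otimes> v))) = trace (\<tau> u) * trace (\<tau> (u \<otimes> v)) - trace (\<tau> v)"
    if "\<tau> \<in> hom G SL2C" for \<tau>
    using tr_mult[OF that c(1) m_closed[OF c]] c by (simp add: inv_cancel_left' algebra_simps)
  then show ?case using mult.IH assms(1,2) by simp
next
  case (swap u v)
  have c: "u \<in> carrier G" "v \<in> carrier G" using nielsen_closed[OF swap.hyps] by auto
  then show ?case using swap.IH tr_comm[of _ v u] assms(1,2) by simp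
next
  case (inv u v)
  have c: "u \<in> carrier G" "v \<in> carrier G" using nielsen_closed[OF inv.hyps] by auto
  have "trace (\<tau> (inv u \<otimes> v)) = trace (\<tau> u) * trace (\<tau> v) - trace (\<tau> (u \<otimes> v))"
    if "\<tau> \<in> hom G SL2C" for \<tau>
    using tr_mult[OF that c] by (simp add: algebra_simps)
  then show ?case using inv.IH assms(1,2) c by (simp add: tr_inv)
next
  case (conj u v k)
  have c: "u \<in> carrier G" "v \<in> carrier G" using nielsen_closed[OF conj.hyps(1)] by auto
  have "(k \<otimes> u \<otimes> inv k) \<otimes> (k \<otimes> v \<otimes> inv k) = k \<otimes> (u \<otimes> v) \<otimes> inv k"
    using c conj.hyps by (simp add: group_cancel)
  then show ?case using conj.IH conj.hyps assms(1,2) c by (simp add: tr_conj)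
qed

text \<open>Every complex triple occurs, so \<open>Phi\<close> is defined on the whole ambient
  space. The product of the two explicit matrices has diagonal 1 / t, t.\<close>

lemma rep_exists: "\<exists>\<rho>. \<rho> \<in> hom G SL2C \<and> \<rho> \<in> extensional (carrier G) \<and> coords \<rho> = p"
proof -
  obtain x y z where p: "p = (x, y, z)" by (cases p)
  define t where "t = (z + csqrt (z\<^sup>2 - 4)) / 2"
  have "t * (z - t) = (z\<^sup>2 - (csqrt (z\<^sup>2 - 4))\<^sup>2) / 4"
    by (simp add: t_def field_simps power2_eq_square)
  then have e: "t * (z - t) = 1" by simp
  then have t0: "t \<noteq> 0" by auto
  then have tz: "t + 1 / t = z" using e by (simp add: field_simps)
  define A where "A = mat2 x (-1) 1 0"
  define B where "B = mat2 0 t (- 1 / t) y"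
  have "det A = 1" by (simp add: A_def det_2)
  moreover have "det B = 1" using t0 by (simp add: B_def det_2)
  ultimately have AB: "A \<in> carrier SL2C" "B \<in> carrier SL2C" by simp_all
  let ?\<rho> = "lift SL2C A B"
  have h: "?\<rho> \<in> hom G SL2C" by (rule lift_hom[OF group_SL2C AB])
  have tr: "trace A = x" "trace B = y" "trace (A ** B) = z"
    using tz by (simp_all add: A_def B_def trace_2 matrix_matrix_mult_def sum_2 add.commute)
  have "coords ?\<rho> = p"
    unfolding rep_coords_def rho_mult[OF h a_closed b_closed] lift_a[OF group_SL2C AB]
      lift_b[OF group_SL2C AB] tr p ..
  then show ?thesis using h lift_extensional[of SL2C A B] by blast
qed

definition rep_of :: "complex \<times> complex \<times> complex \<Rightarrow> 'g \<Rightarrow> complex^2^2" where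
  "rep_of p = (SOME \<rho>. \<rho> \<in> hom G SL2C \<and> \<rho> \<in> extensional (carrier G) \<and> coords \<rho> = p)"

lemma rep_of: "rep_of p \<in> hom G SL2C" "rep_of p \<in> extensional (carrier G)" "coords (rep_of p) = p"
proof -
  have "rep_of p \<in> hom G SL2C \<and> rep_of p \<in> extensional (carrier G) \<and> coords (rep_of p) = p"
    unfolding rep_of_def by (rule someI_ex[OF rep_exists])
  then show "rep_of p \<in> hom G SL2C" "rep_of p \<in> extensional (carrier G)" "coords (rep_of p) = p"
    by simp_all
qed

definition slope_elt :: "int \<times> int \<Rightarrow> 'g" where
  "slope_elt u = (SOME g. \<exists>h. gens g h \<and> ab g = u)"

text \<open>The value 0 at vectors that are not primitive is a default; it respects the symmetry
  under sign.\<close>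

definition Phi :: "complex \<times> complex \<times> complex \<Rightarrow> int \<times> int \<Rightarrow> complex" where
  "Phi p u = (if prim u then trace (rep_of p (slope_elt u)) else 0)"

lemma prim_gens: "prim u \<Longrightarrow> \<exists>g h. gens g h \<and> ab g = u"
proof -
  assume "prim u"
  then obtain v where "det2 u v = 1" using prim_complete by blast
  then show ?thesis using oriented_basis_exists unfolding oriented_def by blast
qed

lemma gens_prim: "gens g h \<Longrightarrow> prim (ab g)"
  using gens_det det2_prim by blast

lemma slope_elt: "prim u \<Longrightarrow> (\<exists>h. gens (slope_elt u) h) \<and> ab (slope_elt u) = u"
  using someI_ex[OF prim_gens[of u]] unfolding slope_elt_def by blast

text \<open>The slope determines the element up to conjugation by \<open>primitive_conj\<close>, and
  the coordinates determine its trace by \<open>nielsen_trace_eq\<close>; so the choices behind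
  \<open>Phi\<close> do not matter.\<close>

lemma Phi_eq:
  assumes r: "\<rho> \<in> hom G SL2C" and g: "gens g h"
  shows "trace (\<rho> g) = Phi (coords \<rho>) (ab g)"
proof -
  obtain h' where h': "gens (slope_elt (ab g)) h'" "ab (slope_elt (ab g)) = ab g"
    using slope_elt[OF gens_prim[OF g]] by blast
  then obtain k where k: "k \<in> carrier G" "g = k \<otimes> slope_elt (ab g) \<otimes> inv k"
    using primitive_conj[OF h'(1) g] by auto
  have c: "slope_elt (ab g) \<in> carrier G" using h' by (simp add: gens_def)
  have "trace (\<rho> g) = trace (\<rho> (slope_elt (ab g)))"
    using tr_conj[OF r c k(1)] k(2) by metis
  also have "\<dots> = trace (rep_of (coords \<rho>) (slope_elt (ab g)))"
    using nielsen_trace_eq[OF r rep_of(1) _, of "coords \<rho>" "slope_elt (ab g)" h'] h'(1) rep_of(3)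
    by (simp add: gens_iff_nielsen)
  finally show ?thesis using gens_prim[OF g] by (simp add: Phi_def)
qed

lemma trace_family_Phi: "trace_family Phi"
proof
  fix x y z :: complex
  let ?p = "(x, y, z)"
  note r = rep_of(1)[of ?p]
  have xyz: "trace (rep_of ?p a) = x" "trace (rep_of ?p b) = y" "trace (rep_of ?p (a \<otimes> b)) = z"
    using rep_of(3)[of ?p] by (auto simp: rep_coords_def)
  show "Phi ?p (1, 0) = x" using Phi_eq[OF r gens_ab] xyz rep_of(3) by simp
  show "Phi ?p (0, 1) = y" using Phi_eq[OF r gens_moves(3)[OF gens_ab]] xyz rep_of(3) by simp
  show "Phi ?p (1, 1) = z"
    using Phi_eq[OF r gens_moves(3)[OF gens_moves(1)[OF gens_ab]]] xyz rep_of(3) by simp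
next
  fix p u
  show "Phi p (- u) = Phi p u"
  proof (cases "prim u")
    case True
    then obtain g h where g: "gens g h" "ab g = u" using prim_gens by blast
    have c: "g \<in> carrier G" using g by (simp add: gens_def)
    show ?thesis
      using Phi_eq[OF rep_of(1) g(1), of p] Phi_eq[OF rep_of(1) gens_moves(5)[OF g(1)], of p]
        tr_inv[OF rep_of(1) c, of p] g(2) c by (simp add: rep_of(3))
  qed (simp add: Phi_def)
next
  fix u v p
  assume "det2 u v = 1"
  then obtain g h where gh: "gens g h" "ab g = u" "ab h = v"
    using oriented_basis_exists unfolding oriented_def by blast
  have c: "g \<in> carrier G" "h \<in> carrier G" using gh by (auto simp: gens_def)
  note P = Phi_eq[OF rep_of(1), of _ _ p, unfolded rep_of(3)]
  have 1: "trace (rep_of p (g \<otimes> h)) = Phi p (u + v)"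
    using P[OF gens_moves(3)[OF gens_moves(1)[OF gh(1)]]] c gh by simp
  have "gens (inv g \<otimes> h) g" using gens_moves(3)[OF gens_moves(2)[OF gh(1)]] .
  from gens_moves(5)[OF this] have 2: "trace (rep_of p (inv (inv g \<otimes> h))) = Phi p (u - v)"
    using P[OF gens_moves(5)[OF \<open>gens (inv g \<otimes> h) g\<close>]] c gh by simp
  have 3: "trace (rep_of p (inv (inv g \<otimes> h))) = trace (rep_of p (inv g \<otimes> h))"
    using c by (intro tr_inv rep_of) auto
  show "Phi p (u + v) + Phi p (u - v) = Phi p u * Phi p v"
    using tr_mult[OF rep_of(1) c, of p] 1 2 3 P[OF gh(1)] P[OF gens_moves(3)[OF gh(1)]] gh by simp
qed

end

sublocale free2 \<subseteq> trace_family Phi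
  by (rule trace_family_Phi)

context free2
begin

lemma trace_commutator:
  assumes r: "\<rho> \<in> hom G SL2C"
  shows "trace (\<rho> (commutator G a b)) = kappa (coords \<rho>) - 2"
proof -
  define x y z where "x = trace (\<rho> a)" and "y = trace (\<rho> b)" and "z = trace (\<rho> (a \<otimes> b))"
  have 0: "commutator G a b = a \<otimes> (b \<otimes> inv a \<otimes> inv b)"
    by (simp add: commutator_def m_assoc)
  have 1: "trace (\<rho> (a \<otimes> (b \<otimes> inv a \<otimes> inv b))) + trace (\<rho> (inv a \<otimes> (b \<otimes> inv a \<otimes> inv b))) = x * x"
    using tr_mult[OF r, of a "b \<otimes> inv a \<otimes> inv b"] tr_conj[OF r, of "inv a" b] tr_inv[OF r, of a]
    by (simp add: x_def)
  have 2: "trace (\<rho> (inv a \<otimes> (b \<otimes> inv a \<otimes> inv b))) + trace (\<rho> (inv (inv a \<otimes> b) \<otimes> (inv a \<otimes> inv b)))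
      = trace (\<rho> (inv a \<otimes> b)) * trace (\<rho> (inv a \<otimes> inv b))"
    using tr_mult[OF r, of "inv a \<otimes> b" "inv a \<otimes> inv b"] by (simp add: m_assoc)
  have 3: "trace (\<rho> (inv a \<otimes> b)) = x * y - z"
    using tr_mult[OF r, of a b] by (simp add: x_def y_def z_def algebra_simps)
  have 4: "trace (\<rho> (inv a \<otimes> inv b)) = z"
    using tr_inv[OF r, of "b \<otimes> a"] tr_comm[OF r, of a b] by (simp add: inv_mult_group z_def)
  have 5: "inv (inv a \<otimes> b) \<otimes> (inv a \<otimes> inv b) = inv b \<otimes> inv b"
    by (simp add: group_cancel)
  have 6: "trace (\<rho> (inv b \<otimes> inv b)) + 2 = y * y"
  proof -
    have "\<rho> \<one> = mat 1" using hom_one[OF r is_group group_SL2C] by simp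
    then have "trace (\<rho> \<one>) = 2" by (simp add: trace_2 mat_def)
    then show ?thesis using tr_mult[OF r, of "inv b" "inv b"] tr_inv[OF r, of b] by (simp add: y_def)
  qed
  have q: "trace (\<rho> (inv b \<otimes> inv b)) = y * y - 2" using 6 by (simp add: eq_diff_eq)
  have s: "trace (\<rho> (inv a \<otimes> (b \<otimes> inv a \<otimes> inv b))) = (x * y - z) * z - (y * y - 2)"
    using 2 unfolding 5 3 4 q by (simp only: eq_diff_eq)
  have "trace (\<rho> (commutator G a b)) = x * x - ((x * y - z) * z - (y * y - 2))"
    using 1 unfolding 0 s by (simp only: eq_diff_eq)
  then show ?thesis
    by (simp add: kappa_def rep_coords_def x_def y_def z_def power2_eq_square algebra_simps)
qed

lemma tau_reps_iff:
  "\<rho> \<in> tau_reps G a b \<tau> \<longleftrightarrow> \<rho> \<in> hom G SL2C \<and> \<rho> \<in> extensional (carrier G) \<and> kappa (coords \<rho>) = \<tau> + 2"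
proof (cases "\<rho> \<in> hom G SL2C")
  case True
  have "trace (\<rho> (commutator G a b)) = \<tau> \<longleftrightarrow> kappa (coords \<rho>) = \<tau> + 2"
    unfolding trace_commutator[OF True] by (rule diff_eq_eq)
  then show ?thesis by (simp add: tau_reps_def)
qed (simp add: tau_reps_def)

subsection \<open>The character space\<close>

definition cl :: "complex \<Rightarrow> ('g \<Rightarrow> complex^2^2) \<Rightarrow> ('g \<Rightarrow> complex^2^2) set" where
  "cl \<tau> \<rho> = rep_conj_rel G a b \<tau> `` {\<rho>}"

definition conj_rep :: "complex^2^2 \<Rightarrow> ('g \<Rightarrow> complex^2^2) \<Rightarrow> 'g \<Rightarrow> complex^2^2" where
  "conj_rep A \<rho> = (\<lambda>g\<in>carrier G. A ** \<rho> g ** adj2 A)"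

lemma conj_rep_hom:
  assumes A: "det A = 1" and r: "\<rho> \<in> hom G SL2C"
  shows "conj_rep A \<rho> \<in> hom G SL2C"
proof (rule homI)
  have Ai: "adj2 A ** A = mat 1" using A by (simp add: adj2_mult)
  fix g h assume gh: "g \<in> carrier G" "h \<in> carrier G"
  have "A ** \<rho> g ** adj2 A ** (A ** \<rho> h ** adj2 A) = A ** \<rho> g ** (adj2 A ** A) ** \<rho> h ** adj2 A"
    by (simp add: matrix_mul_assoc)
  then show "conj_rep A \<rho> (g \<otimes> h) = conj_rep A \<rho> g \<otimes>\<^bsub>SL2C\<^esub> conj_rep A \<rho> h"
    using gh r Ai by (simp add: conj_rep_def rho_mult matrix_mul_assoc)
next
  fix g assume "g \<in> carrier G"
  then show "conj_rep A \<rho> g \<in> carrier SL2C"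
    using A rho_det[OF r] by (simp add: conj_rep_def det_mul det_adj2)
qed

lemma conj_rep_coords: "det A = 1 \<Longrightarrow> coords (conj_rep A \<rho>) = coords \<rho>"
  by (simp add: rep_coords_def conj_rep_def trace_conj)

lemma conj_rep_tau: "det A = 1 \<Longrightarrow> \<rho> \<in> tau_reps G a b \<tau> \<Longrightarrow> conj_rep A \<rho> \<in> tau_reps G a b \<tau>"
  unfolding tau_reps_iff by (simp add: conj_rep_hom conj_rep_coords) (simp add: conj_rep_def)

lemma cl_iff:
  assumes r: "\<rho> \<in> tau_reps G a b \<tau>"
  shows "\<sigma> \<in> cl \<tau> \<rho> \<longleftrightarrow> (\<exists>A. det A = 1 \<and> \<sigma> = conj_rep A \<rho>)"
proof
  assume "\<sigma> \<in> cl \<tau> \<rho>"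
  then obtain A where A: "A \<in> carrier SL2C"
      "\<forall>g\<in>carrier G. \<sigma> g = A \<otimes>\<^bsub>SL2C\<^esub> \<rho> g \<otimes>\<^bsub>SL2C\<^esub> inv\<^bsub>SL2C\<^esub> A"
    and "\<sigma> \<in> tau_reps G a b \<tau>"
    unfolding cl_def rep_conj_rel_def by blast
  then have s: "\<sigma> \<in> extensional (carrier G)" by (simp add: tau_reps_iff)
  have "\<sigma> = conj_rep A \<rho>"
    by (rule extensionalityI[OF s]) (use A in \<open>simp_all add: conj_rep_def\<close>)
  then show "\<exists>A. det A = 1 \<and> \<sigma> = conj_rep A \<rho>" using A by auto
next
  assume "\<exists>A. det A = 1 \<and> \<sigma> = conj_rep A \<rho>"
  then obtain A where A: "det A = 1" "\<sigma> = conj_rep A \<rho>" by blast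
  have "\<forall>g\<in>carrier G. \<sigma> g = A \<otimes>\<^bsub>SL2C\<^esub> \<rho> g \<otimes>\<^bsub>SL2C\<^esub> inv\<^bsub>SL2C\<^esub> A"
    using A by (simp add: conj_rep_def)
  moreover have "A \<in> carrier SL2C" using A by simp
  moreover have "\<sigma> \<in> tau_reps G a b \<tau>" unfolding A(2) by (rule conj_rep_tau[OF A(1) r])
  ultimately show "\<sigma> \<in> cl \<tau> \<rho>" using r unfolding cl_def rep_conj_rel_def by blast
qed

lemma cl_coords:
  assumes "\<rho> \<in> tau_reps G a b \<tau>" "\<sigma> \<in> cl \<tau> \<rho>"
  shows "\<sigma> \<in> tau_reps G a b \<tau>" "coords \<sigma> = coords \<rho>"
proof -
  obtain A where A: "det A = 1" "\<sigma> = conj_rep A \<rho>" using assms cl_iff by blast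
  show "\<sigma> \<in> tau_reps G a b \<tau>" unfolding A(2) by (rule conj_rep_tau[OF A(1) assms(1)])
  show "coords \<sigma> = coords \<rho>" unfolding A(2) by (rule conj_rep_coords[OF A(1)])
qed

lemma cl_self: "\<rho> \<in> tau_reps G a b \<tau> \<Longrightarrow> \<rho> \<in> cl \<tau> \<rho>"
proof -
  assume r: "\<rho> \<in> tau_reps G a b \<tau>"
  have "adj2 (mat 1) = mat 1" by (simp add: vec_eq_iff forall_2 adj2_def mat_def)
  then have "\<rho> = conj_rep (mat 1) \<rho>"
    using r by (intro extensionalityI[of _ "carrier G"]) (simp_all add: conj_rep_def tau_reps_def)
  moreover have "det (mat 1 :: complex^2^2) = 1" by simp
  ultimately show ?thesis using cl_iff[OF r] by blast
qed

lemma char_space_eq: "char_space G a b \<tau> = cl \<tau> ` tau_reps G a b \<tau>"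
  by (auto simp: char_space_def quotient_def cl_def)

lemma char_coords_cl:
  assumes "\<rho> \<in> tau_reps G a b \<tau>" shows "char_coords G a b (cl \<tau> \<rho>) = coords \<rho>"
proof -
  have "coords ` cl \<tau> \<rho> = {coords \<rho>}" using cl_coords(2)[OF assms] cl_self[OF assms] by blast
  then show ?thesis by (simp add: char_coords_def)
qed

lemma char_coords_surj:
  assumes "kappa p = \<tau> + 2" obtains c where "c \<in> char_space G a b \<tau>" "char_coords G a b c = p"
proof -
  have "rep_of p \<in> tau_reps G a b \<tau>" using rep_of assms by (simp add: tau_reps_iff)
  then show ?thesis using that[of "cl \<tau> (rep_of p)"] char_coords_cl[of "rep_of p" \<tau>] rep_of(3)
    unfolding char_space_eq by simp
qed

lemma char_coords_kappa: "c \<in> char_space G a b \<tau> \<Longrightarrow> kappa (char_coords G a b c) = \<tau> + 2"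
proof -
  assume "c \<in> char_space G a b \<tau>"
  then obtain \<rho> where "\<rho> \<in> tau_reps G a b \<tau>" "c = cl \<tau> \<rho>" unfolding char_space_eq by blast
  then show ?thesis using char_coords_cl[of \<rho> \<tau>] by (simp add: tau_reps_iff)
qed

subsection \<open>The BQ-conditions in terms of slopes\<close>

lemma equiv_curve_rel: "equiv (carrier G) (curve_rel G)"
proof (rule equivI)
  show "curve_rel G \<subseteq> carrier G \<times> carrier G" by (auto simp: curve_rel_def)
  show "refl_on (carrier G) (curve_rel G)"
    by (rule refl_onI) (auto simp: curve_rel_def intro!: bexI[of _ \<one>])
  show "sym (curve_rel G)"
  proof (rule symI)
    fix g h assume "(g, h) \<in> curve_rel G"
    then obtain k where k: "g \<in> carrier G" "h \<in> carrier G" "k \<in> carrier G"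
      "g = k \<otimes> h \<otimes> inv k \<or> g = k \<otimes> inv h \<otimes> inv k" by (auto simp: curve_rel_def)
    have "h = inv k \<otimes> g \<otimes> inv (inv k) \<or> h = inv k \<otimes> inv g \<otimes> inv (inv k)"
      using k(4) by (elim disjE) (use k(1-3) in \<open>simp_all add: group_cancel\<close>)
    then show "(h, g) \<in> curve_rel G" using k(1-3) inv_closed[OF k(3)] unfolding curve_rel_def by blast
  qed
  show "trans (curve_rel G)"
  proof (rule transI)
    fix f g h assume "(f, g) \<in> curve_rel G" "(g, h) \<in> curve_rel G"
    then obtain k l where k: "f \<in> carrier G" "g \<in> carrier G" "h \<in> carrier G" "k \<in> carrier G" "l \<in> carrier G"
      "f = k \<otimes> g \<otimes> inv k \<or> f = k \<otimes> inv g \<otimes> inv k" "g = l \<otimes> h \<otimes> inv l \<or> g = l \<otimes> inv h \<otimes> inv l"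
      by (auto simp: curve_rel_def)
    have "f = (k \<otimes> l) \<otimes> h \<otimes> inv (k \<otimes> l) \<or> f = (k \<otimes> l) \<otimes> inv h \<otimes> inv (k \<otimes> l)"
      using k(6,7) by (elim disjE) (use k(1-5) in \<open>simp_all add: group_cancel\<close>)
    then show "(f, h) \<in> curve_rel G" using k(1-5) m_closed[OF k(4,5)] unfolding curve_rel_def by blast
  qed
qed

lemma curve_rel_trace:
  assumes "(g, h) \<in> curve_rel G" and r: "\<rho> \<in> hom G SL2C"
  shows "trace (\<rho> g) = trace (\<rho> h)" and "ab g = ab h \<or> ab g = - ab h"
proof -
  obtain k where k: "g \<in> carrier G" "h \<in> carrier G" "k \<in> carrier G"
    "g = k \<otimes> h \<otimes> inv k \<or> g = k \<otimes> inv h \<otimes> inv k" using assms(1) by (auto simp: curve_rel_def)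
  from k(4) show "trace (\<rho> g) = trace (\<rho> h)"
    by (elim disjE) (simp_all add: tr_conj[OF r] tr_inv[OF r] k(1-3))
  from k(4) show "ab g = ab h \<or> ab g = - ab h"
    by (elim disjE) (simp_all add: k(1-3))
qed

definition curve :: "int \<times> int \<Rightarrow> 'g set" where "curve u = curve_rel G `` {slope_elt u}"

lemma slope_elt_closed: "prim u \<Longrightarrow> slope_elt u \<in> carrier G"
  using slope_elt by (auto simp: gens_def)

lemma curve_simple:
  assumes "prim u" shows "curve u \<in> simple_curves G" "slope_elt u \<in> curve u"
proof -
  have c: "slope_elt u \<in> carrier G" using slope_elt_closed[OF assms] .
  show 1: "slope_elt u \<in> curve u" unfolding curve_def using equiv_class_self[OF equiv_curve_rel c] .
  show "curve u \<in> simple_curves G"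
    using slope_elt[OF assms] 1 quotientI[OF c] unfolding simple_curves_def curve_def free_basis_iff_gens by blast
qed

lemma simple_curve_slope:
  assumes "C \<in> simple_curves G" obtains u where "prim u" "C = curve u"
proof -
  obtain g h where g: "C \<in> carrier G // curve_rel G" "g \<in> C" "gens g h"
    using assms by (auto simp: simple_curves_def free_basis_iff_gens)
  have u: "prim (ab g)" using gens_prim[OF g(3)] .
  obtain h' where h': "gens (slope_elt (ab g)) h'" "ab (slope_elt (ab g)) = ab g" using slope_elt[OF u] by blast
  obtain k where k: "k \<in> carrier G" "g = k \<otimes> slope_elt (ab g) \<otimes> inv k"
    using primitive_conj[OF h'(1) g(3) h'(2)] by blast
  have "(g, slope_elt (ab g)) \<in> curve_rel G"
    using k slope_elt_closed[OF u] g(3) unfolding curve_rel_def gens_def by blast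
  then have "curve_rel G `` {g} = curve (ab g)"
    unfolding curve_def by (rule equiv_class_eq[OF equiv_curve_rel])
  moreover have "C = curve_rel G `` {g}"
    using g(1,2) equiv_class_eq_iff[OF equiv_curve_rel] by (auto elim!: quotientE intro: equiv_class_eq[OF equiv_curve_rel])
  ultimately show ?thesis using that u by blast
qed

lemma curve_trace:
  assumes u: "prim u" and g: "g \<in> curve u" and r: "\<rho> \<in> hom G SL2C"
  shows "trace (\<rho> g) = Phi (coords \<rho>) u" and "ab g = u \<or> ab g = - u"
proof -
  have rel: "(slope_elt u, g) \<in> curve_rel G" using g by (simp add: curve_def)
  obtain h where h: "gens (slope_elt u) h" "ab (slope_elt u) = u" using slope_elt[OF u] by blast
  show "trace (\<rho> g) = Phi (coords \<rho>) u"
    using curve_rel_trace(1)[OF rel r] Phi_eq[OF r h(1)] h(2) by simp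
  show "ab g = u \<or> ab g = - u" using curve_rel_trace(2)[OF rel r] h(2) by auto
qed

lemma BQ_iff:
  assumes r: "\<rho> \<in> hom G SL2C"
  shows "BQ1 G \<rho> \<and> BQ2 G \<rho> \<longleftrightarrow> BQ (coords \<rho>)"
proof -
  have 1: "BQ1 G \<rho> \<longleftrightarrow> (\<forall>u. prim u \<longrightarrow> Phi (coords \<rho>) u \<notin> seg)"
    unfolding BQ1_def seg_def[symmetric] using curve_simple curve_trace(1)[OF _ _ r] simple_curve_slope by metis
  let ?S = "{C \<in> simple_curves G. \<exists>g\<in>C. cmod (trace (\<rho> g)) \<le> 2}"
  let ?U = "{u. prim u \<and> cmod (Phi (coords \<rho>) u) \<le> 2}"
  have S: "?S = curve ` ?U"
  proof (intro equalityI subsetI)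
    fix C assume C: "C \<in> ?S"
    then obtain u where u: "prim u" "C = curve u" using simple_curve_slope by blast
    then have "u \<in> ?U" using C curve_trace(1)[OF u(1) _ r] by auto
    then show "C \<in> curve ` ?U" using u by blast
  next
    fix C assume "C \<in> curve ` ?U"
    then obtain u where u: "u \<in> ?U" "C = curve u" by blast
    then have "cmod (trace (\<rho> (slope_elt u))) \<le> 2"
      using curve_trace(1)[OF _ curve_simple(2) r] by simp
    then show "C \<in> ?S" using u curve_simple by blast
  qed
  have "BQ2 G \<rho> \<longleftrightarrow> finite ?U"
  proof
    assume "BQ2 G \<rho>"
    then have fin: "finite (curve ` ?U)" unfolding BQ2_def S .
    \<comment> \<open>A curve determines its slope up to sign, so finitely many curves have finitely
      many slopes.\<close>
    have "?U \<subseteq> (\<Union>C\<in>curve ` ?U. ab ` C)"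
    proof
      fix u assume u: "u \<in> ?U"
      then have "u \<in> ab ` curve u" using curve_simple(2)[of u] slope_elt[of u] by force
      then show "u \<in> (\<Union>C\<in>curve ` ?U. ab ` C)" using u by blast
    qed
    moreover have "finite (ab ` C)" if C: "C \<in> curve ` ?U" for C
    proof -
      obtain u where u: "prim u" "C = curve u" using C by blast
      have "ab ` C \<subseteq> {u, - u}" using curve_trace(2)[OF u(1) _ r] u(2) by blast
      then show ?thesis by (rule finite_subset) simp
    qed
    ultimately show "finite ?U" using fin finite_UN_I finite_subset by (metis (no_types, lifting))
  next
    assume "finite ?U"
    then show "BQ2 G \<rho>" unfolding BQ2_def S by (rule finite_imageI)
  qed
  then show ?thesis using 1 by (simp add: BQ_def)
qed

lemma BQ_space_iff:
  assumes "c \<in> char_space G a b \<tau>"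
  shows "c \<in> BQ_space G a b \<tau> \<longleftrightarrow> BQ (char_coords G a b c)"
proof -
  obtain \<rho> where r: "\<rho> \<in> tau_reps G a b \<tau>" "c = cl \<tau> \<rho>" using assms by (auto simp: char_space_eq)
  have "BQ1 G \<sigma> \<and> BQ2 G \<sigma> \<longleftrightarrow> BQ (coords \<rho>)" if "\<sigma> \<in> c" for \<sigma>
    using BQ_iff[of \<sigma>] cl_coords[OF r(1), of \<sigma>] that r(2) by (simp add: tau_reps_iff)
  then show ?thesis using assms cl_self[OF r(1)] r by (auto simp: BQ_space_def char_coords_cl)
qed

end

section \<open>Compactness in the transported topology\<close>

context trace_family
begin

lemma compact_BQ_finite:
  assumes K: "compact K" and BQ: "\<And>q. q \<in> K \<Longrightarrow> BQ q \<and> kappa q \<noteq> 4"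
  shows "finite {u. prim u \<and> (\<exists>q\<in>K. cmod (\<Phi> q u) \<le> C)}"
proof -
  define \<N> where "\<N> = {N. open N \<and> finite {u. prim u \<and> (\<exists>q\<in>N. cmod (\<Phi> q u) \<le> C)}}"
  have "K \<subseteq> \<Union>\<N>"
  proof
    fix p assume "p \<in> K"
    then have p: "BQ p" "kappa p \<noteq> 4" using BQ by auto
    obtain N where N: "open N" "p \<in> N" "\<And>C. finite {u. prim u \<and> (\<exists>q\<in>N. cmod (\<Phi> q u) \<le> C)}"
      by (rule BQ_locally_uniform[OF p]) (rule that)
    have "N \<in> \<N>" unfolding \<N>_def mem_Collect_eq using N(1) N(3)[of C] by (rule conjI)
    then show "p \<in> \<Union>\<N>" using N(2) by (rule UnionI)
  qed
  moreover have "\<And>N. N \<in> \<N> \<Longrightarrow> open N" by (simp add: \<N>_def)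
  ultimately obtain F where F: "F \<subseteq> \<N>" "finite F" "K \<subseteq> \<Union>F" using compactE[OF K] by metis
  have "{u. prim u \<and> (\<exists>q\<in>K. cmod (\<Phi> q u) \<le> C)} \<subseteq> (\<Union>N\<in>F. {u. prim u \<and> (\<exists>q\<in>N. cmod (\<Phi> q u) \<le> C)})"
    using F(3) by blast
  moreover have "finite (\<Union>N\<in>F. {u. prim u \<and> (\<exists>q\<in>N. cmod (\<Phi> q u) \<le> C)})"
  proof (rule finite_UN_I[OF F(2)])
    fix N assume "N \<in> F"
    then have "N \<in> \<N>" using F(1) by blast
    then show "finite {u. prim u \<and> (\<exists>q\<in>N. cmod (\<Phi> q u) \<le> C)}" unfolding \<N>_def by blast
  qed
  ultimately show ?thesis by (rule finite_subset)
qed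

end

text \<open>Open sets of the pullback topology are full preimages, so a cover of the preimage of K
  comes from a cover of K as soon as K lies in the image of A.\<close>

lemma compactin_pullback:
  assumes "compact K" "K \<subseteq> f ` A"
  shows "compactin (pullback_topology A f euclidean) (f -` K \<inter> A)"
  unfolding compactin_def
proof (intro conjI allI impI)
  show "f -` K \<inter> A \<subseteq> topspace (pullback_topology A f euclidean)"
    by (simp add: topspace_pullback_topology)
  fix \<U> assume \<U>: "Ball \<U> (openin (pullback_topology A f euclidean)) \<and> f -` K \<inter> A \<subseteq> \<Union>\<U>"
  define \<V> where "\<V> = {V. open V \<and> f -` V \<inter> A \<in> \<U>}"
  have "K \<subseteq> \<Union>\<V>"
  proof
    fix y assume y: "y \<in> K"
    then obtain x where x: "x \<in> A" "y = f x" using assms(2) by blast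
    then have "x \<in> \<Union>\<U>" using \<U> y by blast
    then obtain U where U: "U \<in> \<U>" "x \<in> U" by blast
    then obtain V where "open V" "U = f -` V \<inter> A"
      using \<U> by (auto simp: openin_pullback_topology)
    then show "y \<in> \<Union>\<V>" using U x unfolding \<V>_def by blast
  qed
  moreover have "\<And>V. V \<in> \<V> \<Longrightarrow> open V" by (simp add: \<V>_def)
  ultimately obtain F where F: "F \<subseteq> \<V>" "finite F" "K \<subseteq> \<Union>F" using compactE[OF assms(1)] by metis
  show "\<exists>\<F>. finite \<F> \<and> \<F> \<subseteq> \<U> \<and> f -` K \<inter> A \<subseteq> \<Union>\<F>"
  proof (intro exI[of _ "(\<lambda>V. f -` V \<inter> A) ` F"] conjI)
    show "finite ((\<lambda>V. f -` V \<inter> A) ` F)" using F(2) by simp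
    show "(\<lambda>V. f -` V \<inter> A) ` F \<subseteq> \<U>" using F(1) unfolding \<V>_def by blast
    show "f -` K \<inter> A \<subseteq> \<Union>((\<lambda>V. f -` V \<inter> A) ` F)" using F(3) by blast
  qed
qed

lemma compact_image_pullback:
  assumes "compactin (pullback_topology A f euclidean) K"
  shows "compact (f ` K)"
proof -
  have "continuous_map (pullback_topology A f euclidean) euclidean (id \<circ> f)"
    by (rule continuous_map_pullback) (simp add: id_def)
  from image_compactin[OF assms this] show ?thesis by (simp add: compactin_euclidean_iff)
qed

context free2
begin

subsection \<open>The action of the mapping class group\<close>

definition inn :: "'g \<Rightarrow> 'g \<Rightarrow> 'g" where
  "inn k = (\<lambda>g\<in>carrier G. k \<otimes> g \<otimes> inv k)"

definition coset :: "('g \<Rightarrow> 'g) \<Rightarrow> ('g \<Rightarrow> 'g) set" where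
  "coset \<phi> = {compose (carrier G) (inn k) \<phi> | k. k \<in> carrier G}"

lemma inn_Bij: "k \<in> carrier G \<Longrightarrow> inn k \<in> Bij (carrier G)"
proof -
  assume k: "k \<in> carrier G"
  have "bij_betw (inn k) (carrier G) (carrier G)"
    by (rule bij_betw_byWitness[where f' = "inn (inv k)"])
      (use k in \<open>auto simp: inn_def group_cancel\<close>)
  then show ?thesis by (simp add: Bij_def inn_def)
qed

lemma auto_Bij: "\<phi> \<in> auto G \<Longrightarrow> \<phi> \<in> Bij (carrier G)"
  by (simp add: auto_def)

lemma orientation_auto: "\<phi> \<in> orientation_auts G a b \<Longrightarrow> \<phi> \<in> auto G"
  by (simp add: orientation_auts_def)

lemma MCG_carrier: "carrier (MCG G a b) = coset ` orientation_auts G a b"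
proof -
  have "inner_auts G #>\<^bsub>(AutoGroup G)\<lparr>carrier := orientation_auts G a b\<rparr>\<^esub> \<phi> = coset \<phi>"
    if \<phi>: "\<phi> \<in> orientation_auts G a b" for \<phi>
  proof -
    have B: "\<phi> \<in> Bij (carrier G)" using auto_Bij orientation_auto \<phi> by blast
    have i: "inner_auts G = inn ` carrier G" by (simp add: inner_auts_def inn_def)
    show ?thesis unfolding r_coset_def i coset_def
      using inn_Bij B by (auto simp: AutoGroup_def BijGroup_def)
  qed
  then show ?thesis by (auto simp: MCG_def FactGroup_def RCOSETS_def)
qed

lemma auto_closed: "\<phi> \<in> auto G \<Longrightarrow> g \<in> carrier G \<Longrightarrow> \<phi> g \<in> carrier G"
  by (auto simp: auto_def hom_def)

lemma auto_gens:
  assumes \<phi>: "\<phi> \<in> auto G" and g: "gens u v"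
  shows "gens (\<phi> u) (\<phi> v)"
  unfolding gens_def
proof (intro conjI ballI)
  have c: "u \<in> carrier G" "v \<in> carrier G" using g by (auto simp: gens_def)
  show "\<phi> u \<in> carrier G" "\<phi> v \<in> carrier G" using auto_closed[OF \<phi>] c by auto
  fix h assume "h \<in> carrier G"
  moreover have "\<phi> ` carrier G = carrier G" using auto_Bij[OF \<phi>] by (simp add: Bij_def bij_betw_def)
  ultimately obtain x where x: "x \<in> carrier G" "h = \<phi> x" by blast
  obtain w where "x = word_value G u v w" using g x(1) unfolding gens_def by blast
  then have "h = word_value G (\<phi> u) (\<phi> v) w"
    using hom_word_value[OF is_group _ c, of \<phi> w] \<phi> x(2) by (simp add: auto_def)
  then show "\<exists>w. h = word_value G (\<phi> u) (\<phi> v) w" by blast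
qed

lemma auto_ab:
  assumes \<phi>: "\<phi> \<in> auto G" and g: "g \<in> carrier G"
  shows "ab (\<phi> g) = lin (ab (\<phi> a)) (ab (\<phi> b)) (ab g)"
proof -
  have h: "\<phi> \<in> hom G G" using \<phi> by (simp add: auto_def)
  have c: "\<phi> a \<in> carrier G" "\<phi> b \<in> carrier G" using auto_closed[OF \<phi>] by auto
  have "\<phi> g = lift G (\<phi> a) (\<phi> b) g"
    using hom_word_value[OF is_group h a_closed b_closed, of "nf g"] g by (simp add: lift_def)
  then show ?thesis using ab_lift[OF c g] by simp
qed

definition pull :: "('g \<Rightarrow> 'g) \<Rightarrow> ('g \<Rightarrow> complex^2^2) \<Rightarrow> 'g \<Rightarrow> complex^2^2" where
  "pull \<phi> \<rho> = compose (carrier G) \<rho> \<phi>"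

lemma pull_hom: "\<phi> \<in> auto G \<Longrightarrow> \<rho> \<in> hom G SL2C \<Longrightarrow> pull \<phi> \<rho> \<in> hom G SL2C"
  by (auto simp: pull_def auto_def hom_def compose_def Pi_iff)

lemma pull_coords:
  assumes \<phi>: "\<phi> \<in> auto G" and r: "\<rho> \<in> hom G SL2C"
  shows "coords (pull \<phi> \<rho>) = act (ab (\<phi> a)) (ab (\<phi> b)) (coords \<rho>)"
proof -
  have h: "\<phi> (a \<otimes> b) = \<phi> a \<otimes> \<phi> b" using \<phi> by (simp add: auto_def hom_def)
  have c: "\<phi> a \<in> carrier G" "\<phi> b \<in> carrier G" using auto_closed[OF \<phi>] by auto
  note g = auto_gens[OF \<phi> gens_ab]
  have g': "gens (\<phi> a \<otimes> \<phi> b) (\<phi> a)" "gens (\<phi> b) (\<phi> a)"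
    using gens_moves(3)[OF gens_moves(1)[OF g]] gens_moves(3)[OF g] by auto
  show ?thesis
    using Phi_eq[OF r g] Phi_eq[OF r g'(1)] Phi_eq[OF r g'(2)] c h
    by (simp add: rep_coords_def pull_def compose_def act_def)
qed

lemma pull_tau:
  assumes \<phi>: "\<phi> \<in> orientation_auts G a b" and r: "\<rho> \<in> tau_reps G a b \<tau>"
  shows "pull \<phi> \<rho> \<in> tau_reps G a b \<tau>"
proof -
  obtain k where k: "k \<in> carrier G" "\<phi> (commutator G a b) = k \<otimes> commutator G a b \<otimes> inv k"
    using \<phi> by (auto simp: orientation_auts_def)
  have rh: "\<rho> \<in> hom G SL2C" using r by (simp add: tau_reps_def)
  have "trace (pull \<phi> \<rho> (commutator G a b)) = trace (\<rho> (commutator G a b))"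
    using k tr_conj[OF rh _ k(1), of "commutator G a b"] by (simp add: pull_def compose_def)
  then show ?thesis using r pull_hom[OF orientation_auto[OF \<phi>] rh]
    by (simp add: tau_reps_def) (simp add: pull_def)
qed

text \<open>Precomposing with conjugation by k is conjugating by the matrix of k, so the choices in
  the coset and in the class are absorbed alike.\<close>

lemma mcg_act_cl:
  assumes \<phi>: "\<phi> \<in> orientation_auts G a b" and r: "\<rho> \<in> tau_reps G a b \<tau>"
  shows "mcg_act G (coset \<phi>) (cl \<tau> \<rho>) = cl \<tau> (pull \<phi> \<rho>)"
proof (intro equalityI subsetI)
  note \<phi>a = orientation_auto[OF \<phi>]
  have rh: "\<rho> \<in> hom G SL2C" using r by (simp add: tau_reps_def)
  note pt = pull_tau[OF \<phi> r]
  have \<phi>c: "\<phi> g \<in> carrier G" if "g \<in> carrier G" for g using auto_closed[OF \<phi>a that] .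
  {
    fix \<theta> assume "\<theta> \<in> mcg_act G (coset \<phi>) (cl \<tau> \<rho>)"
    then obtain \<sigma> k where s: "\<sigma> \<in> cl \<tau> \<rho>" "k \<in> carrier G"
      "\<theta> = compose (carrier G) \<sigma> (compose (carrier G) (inn k) \<phi>)"
      by (auto simp: mcg_act_def coset_def)
    obtain A where A: "det A = 1" "\<sigma> = conj_rep A \<rho>" using s(1) cl_iff[OF r] by blast
    have Ak: "det (A ** \<rho> k) = 1" using A rho_det[OF rh s(2)] by (simp add: det_mul)
    have adj: "adj2 (A ** \<rho> k) = adj2 (\<rho> k) ** adj2 A"
      by (simp add: vec_eq_iff forall_2 adj2_def matrix_matrix_mult_def sum_2 algebra_simps)
    have "\<theta> = conj_rep (A ** \<rho> k) (pull \<phi> \<rho>)"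
    proof (rule extensionalityI[of _ "carrier G"])
      fix g assume g: "g \<in> carrier G"
      have "\<rho> (k \<otimes> \<phi> g \<otimes> inv k) = \<rho> k ** \<rho> (\<phi> g) ** adj2 (\<rho> k)"
        using rho_mult[OF rh _ inv_closed[OF s(2)], of "k \<otimes> \<phi> g"] rho_mult[OF rh s(2) \<phi>c[OF g]]
          rho_inv[OF rh s(2)] s(2) \<phi>c[OF g] by simp
      then show "\<theta> g = conj_rep (A ** \<rho> k) (pull \<phi> \<rho>) g"
        using g s(2) \<phi>c[OF g] unfolding s(3) A(2)
        by (simp add: compose_def inn_def conj_rep_def pull_def adj matrix_mul_assoc)
    qed (simp_all add: s(3) conj_rep_def)
    then show "\<theta> \<in> cl \<tau> (pull \<phi> \<rho>)" using cl_iff[OF pt] Ak by blast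
  next
    fix \<theta> assume "\<theta> \<in> cl \<tau> (pull \<phi> \<rho>)"
    then obtain A where A: "det A = 1" "\<theta> = conj_rep A (pull \<phi> \<rho>)" using cl_iff[OF pt] by blast
    have "\<theta> = compose (carrier G) (conj_rep A \<rho>) (compose (carrier G) (inn \<one>) \<phi>)"
    proof (rule extensionalityI[of _ "carrier G"])
      fix g assume g: "g \<in> carrier G"
      then show "\<theta> g = compose (carrier G) (conj_rep A \<rho>) (compose (carrier G) (inn \<one>) \<phi>) g"
        using \<phi>c[OF g] unfolding A(2) by (simp add: compose_def inn_def conj_rep_def pull_def)
    qed (simp_all add: A(2) conj_rep_def)
    moreover have "conj_rep A \<rho> \<in> cl \<tau> \<rho>" using cl_iff[OF r] A(1) by blast
    moreover have "compose (carrier G) (inn \<one>) \<phi> \<in> coset \<phi>" unfolding coset_def by blast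
    ultimately show "\<theta> \<in> mcg_act G (coset \<phi>) (cl \<tau> \<rho>)" unfolding mcg_act_def by blast
  }
qed

lemma mcg_act_coords:
  assumes \<phi>: "\<phi> \<in> orientation_auts G a b" and c: "c \<in> char_space G a b \<tau>"
  shows "mcg_act G (coset \<phi>) c \<in> char_space G a b \<tau>"
    and "char_coords G a b (mcg_act G (coset \<phi>) c) = act (ab (\<phi> a)) (ab (\<phi> b)) (char_coords G a b c)"
proof -
  obtain \<rho> where r: "\<rho> \<in> tau_reps G a b \<tau>" "c = cl \<tau> \<rho>" using c by (auto simp: char_space_eq)
  have rh: "\<rho> \<in> hom G SL2C" using r by (simp add: tau_reps_def)
  show "mcg_act G (coset \<phi>) c \<in> char_space G a b \<tau>"
    unfolding r(2) mcg_act_cl[OF \<phi> r(1)] char_space_eq using pull_tau[OF \<phi> r(1)] by blast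
  show "char_coords G a b (mcg_act G (coset \<phi>) c) = act (ab (\<phi> a)) (ab (\<phi> b)) (char_coords G a b c)"
    unfolding r(2) mcg_act_cl[OF \<phi> r(1)] char_coords_cl[OF r(1)] char_coords_cl[OF pull_tau[OF \<phi> r(1)]]
    by (rule pull_coords[OF orientation_auto[OF \<phi>] rh])
qed

text \<open>By \<open>same_ab_conj\<close> the matrix on the abelianization determines the mapping
  class; \<open>coset_ab\<close> is the converse, and \<open>orientation_aut_exists\<close> realizes
  every matrix of determinant 1.\<close>

lemma coset_eq:
  assumes \<phi>: "\<phi> \<in> auto G" and \<psi>: "\<psi> \<in> auto G"
    and eq: "ab (\<phi> a) = ab (\<psi> a)" "ab (\<phi> b) = ab (\<psi> b)"
  shows "coset \<phi> = coset \<psi>"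
proof -
  have sub: "coset \<phi> \<subseteq> coset \<psi>" if \<phi>: "\<phi> \<in> auto G" and \<psi>: "\<psi> \<in> auto G"
    and eq: "ab (\<phi> a) = ab (\<psi> a)" "ab (\<phi> b) = ab (\<psi> b)" for \<phi> \<psi>
  proof -
    obtain k where k: "k \<in> carrier G" "\<phi> a = k \<otimes> \<psi> a \<otimes> inv k" "\<phi> b = k \<otimes> \<psi> b \<otimes> inv k"
      using same_ab_conj[OF auto_gens[OF \<psi> gens_ab] auto_gens[OF \<phi> gens_ab] eq[symmetric]] by blast
    have \<psi>c: "\<psi> g \<in> carrier G" if "g \<in> carrier G" for g using auto_closed[OF \<psi> that] .
    have h: "\<phi> \<in> hom G G" "\<psi> \<in> hom G G" using \<phi> \<psi> by (auto simp: auto_def)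
    have h': "(\<lambda>g. k \<otimes> \<psi> g \<otimes> inv k) \<in> hom G G"
      by (rule homI) (use k \<psi>c hom_mult[OF h(2)] in \<open>simp_all add: group_cancel\<close>)
    have eq: "\<phi> g = k \<otimes> \<psi> g \<otimes> inv k" if "g \<in> carrier G" for g
      by (rule hom_eqI[OF is_group h(1) h' k(2,3) that])
    show ?thesis
    proof
      fix f assume "f \<in> coset \<phi>"
      then obtain l where l: "l \<in> carrier G" "f = compose (carrier G) (inn l) \<phi>" by (auto simp: coset_def)
      have "f = compose (carrier G) (inn (l \<otimes> k)) \<psi>"
      proof (rule extensionalityI[of _ "carrier G"])
        fix g assume g: "g \<in> carrier G"
        then show "f g = compose (carrier G) (inn (l \<otimes> k)) \<psi> g"
          unfolding l(2) using eq[OF g] l(1) k(1) \<psi>c[OF g]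
          by (simp add: compose_def inn_def group_cancel)
      qed (simp_all add: l(2))
      then show "f \<in> coset \<psi>" using m_closed[OF l(1) k(1)] unfolding coset_def by blast
    qed
  qed
  show ?thesis using sub[OF \<phi> \<psi> eq] sub[OF \<psi> \<phi> eq[symmetric]] by blast
qed

lemma coset_ab:
  assumes \<phi>: "\<phi> \<in> auto G" and \<psi>: "\<psi> \<in> auto G" and eq: "coset \<phi> = coset \<psi>"
  shows "ab (\<phi> g) = ab (\<psi> g) \<or> g \<notin> carrier G"
proof (cases "g \<in> carrier G")
  case True
  have "compose (carrier G) (inn \<one>) \<phi> \<in> coset \<phi>" unfolding coset_def by blast
  then have "compose (carrier G) (inn \<one>) \<phi> \<in> coset \<psi>" unfolding eq .
  then obtain k where k: "k \<in> carrier G" "compose (carrier G) (inn \<one>) \<phi> = compose (carrier G) (inn k) \<psi>"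
    by (auto simp: coset_def)
  have "compose (carrier G) (inn \<one>) \<phi> g = compose (carrier G) (inn k) \<psi> g" unfolding k(2) ..
  then have "\<phi> g = k \<otimes> \<psi> g \<otimes> inv k"
    using True auto_closed[OF \<phi> True] auto_closed[OF \<psi> True] k(1) by (simp add: compose_def inn_def)
  then show ?thesis using k(1) auto_closed[OF \<psi> True] by simp
qed simp

lemma orientation_aut_exists:
  assumes "det2 u v = 1"
  shows "\<exists>\<phi>. \<phi> \<in> orientation_auts G a b \<and> ab (\<phi> a) = u \<and> ab (\<phi> b) = v"
proof -
  obtain g h where gh: "oriented g h" "ab g = u" "ab h = v" using oriented_basis_exists[OF assms] by blast
  then have gens: "gens g h" by (simp add: oriented_def)
  then have c: "g \<in> carrier G" "h \<in> carrier G" by (auto simp: gens_def)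
  let ?\<phi> = "lift G g h"
  have ab: "?\<phi> a = g" "?\<phi> b = h" using c by (simp_all add: lift_a lift_b is_group)
  interpret f: group_hom G G ?\<phi> by unfold_locales (use lift_hom[OF is_group c] in simp)
  have "?\<phi> (commutator G a b) = commutator G g h"
    by (simp add: commutator_def ab)
  then have "?\<phi> \<in> orientation_auts G a b"
    using gens_lift_auto[OF gens] gh(1) by (simp add: orientation_auts_def oriented_def)
  then show ?thesis using ab gh by auto
qed

text \<open>Pulling back composes the trace function with the linear map of \<phi> on slopes, which
  permutes the primitive vectors.\<close>

lemma pull_BQ:
  assumes \<phi>: "\<phi> \<in> auto G" and r: "\<rho> \<in> hom G SL2C" and BQ: "BQ (coords \<rho>)"
  shows "BQ (coords (pull \<phi> \<rho>))"
proof -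
  define u v where "u = ab (\<phi> a)" and "v = ab (\<phi> b)"
  have det: "\<bar>det2 u v\<bar> = 1" unfolding u_def v_def by (rule gens_det[OF auto_gens[OF \<phi> gens_ab]])
  have eq: "Phi (coords (pull \<phi> \<rho>)) w = Phi (coords \<rho>) (lin u v w)" if "prim w" for w
  proof -
    obtain g h where g: "gens g h" "ab g = w" using prim_gens[OF \<open>prim w\<close>] by blast
    have c: "g \<in> carrier G" using g by (simp add: gens_def)
    have "trace (pull \<phi> \<rho> g) = trace (\<rho> (\<phi> g))" using c by (simp add: pull_def compose_def)
    then show ?thesis
      using Phi_eq[OF pull_hom[OF \<phi> r] g(1)] Phi_eq[OF r auto_gens[OF \<phi> g(1)]] auto_ab[OF \<phi> c] g(2)
      by (simp add: u_def v_def)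
  qed
  have "inj (lin u v)" using lin_inject[of u v] det by (intro injI) auto
  moreover have "{w. prim w \<and> cmod (Phi (coords (pull \<phi> \<rho>)) w) \<le> 2} \<subseteq>
      lin u v -` {w. prim w \<and> cmod (Phi (coords \<rho>) w) \<le> 2}"
    using prim_lin[OF det] eq by auto
  ultimately have "finite {w. prim w \<and> cmod (Phi (coords (pull \<phi> \<rho>)) w) \<le> 2}"
    using BQ finite_vimageI finite_subset unfolding BQ_def by blast
  moreover have "Phi (coords (pull \<phi> \<rho>)) w \<notin> seg" if "prim w" for w
    unfolding eq[OF that] using BQ prim_lin[OF det that] unfolding BQ_def by blast
  ultimately show ?thesis unfolding BQ_def by blast
qed

section \<open>Invariance, openness, discontinuity and maximality\<close>

lemma BQ_space_invariant: "mcg_invariant G a b (BQ_space G a b \<tau>)"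
  unfolding mcg_invariant_def
proof (intro ballI image_subsetI)
  fix H c assume "H \<in> carrier (MCG G a b)" and c: "c \<in> BQ_space G a b \<tau>"
  then obtain \<phi> where \<phi>: "\<phi> \<in> orientation_auts G a b" "H = coset \<phi>" by (auto simp: MCG_carrier)
  have cs: "c \<in> char_space G a b \<tau>" using c by (simp add: BQ_space_def)
  then obtain \<rho> where r: "\<rho> \<in> tau_reps G a b \<tau>" "c = cl \<tau> \<rho>" by (auto simp: char_space_eq)
  have rh: "\<rho> \<in> hom G SL2C" using r by (simp add: tau_reps_def)
  have "BQ (coords \<rho>)" using c BQ_space_iff[OF cs] char_coords_cl[OF r(1)] r(2) by simp
  then have "BQ (coords (pull \<phi> \<rho>))" by (rule pull_BQ[OF orientation_auto[OF \<phi>(1)] rh])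
  then have "BQ (char_coords G a b (mcg_act G H c))"
    unfolding \<phi>(2) r(2) mcg_act_cl[OF \<phi>(1) r(1)] char_coords_cl[OF pull_tau[OF \<phi>(1) r(1)]] .
  then show "mcg_act G H c \<in> BQ_space G a b \<tau>"
    using BQ_space_iff mcg_act_coords(1)[OF \<phi>(1) cs] \<phi>(2) by blast
qed

lemma tau_plus_2: "\<tau> \<noteq> 2 \<Longrightarrow> \<tau> + 2 \<noteq> (4 :: complex)"
proof
  assume "\<tau> \<noteq> 2" "\<tau> + 2 = 4"
  then have "\<tau> = 4 - 2" by (simp only: eq_diff_eq)
  then show False using \<open>\<tau> \<noteq> 2\<close> by simp
qed

lemma BQ_space_open:
  assumes "\<tau> \<noteq> 2" shows "openin (char_topology G a b \<tau>) (BQ_space G a b \<tau>)"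
  unfolding char_topology_def openin_pullback_topology
proof (intro exI[of _ "interior {q. BQ q}"] conjI)
  show "BQ_space G a b \<tau> = char_coords G a b -` interior {q. BQ q} \<inter> char_space G a b \<tau>"
  proof (intro equalityI subsetI)
    fix c assume c: "c \<in> BQ_space G a b \<tau>"
    then have cs: "c \<in> char_space G a b \<tau>" by (simp add: BQ_space_def)
    have "BQ (char_coords G a b c)" using BQ_space_iff[OF cs] c by simp
    moreover have "kappa (char_coords G a b c) \<noteq> 4"
      using char_coords_kappa[OF cs] tau_plus_2[OF assms] by simp
    ultimately obtain N where N: "open N" "char_coords G a b c \<in> N" "\<And>q. q \<in> N \<Longrightarrow> BQ q"
      by (rule BQ_locally_uniform) (rule that)
    have "N \<subseteq> {q. BQ q}" using N(3) by (intro subsetI CollectI)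
    then have "char_coords G a b c \<in> interior {q. BQ q}" by (rule interiorI[OF N(1,2)])
    then show "c \<in> char_coords G a b -` interior {q. BQ q} \<inter> char_space G a b \<tau>" using cs by simp
  next
    fix c assume c: "c \<in> char_coords G a b -` interior {q. BQ q} \<inter> char_space G a b \<tau>"
    then have "BQ (char_coords G a b c)" using interior_subset by blast
    then show "c \<in> BQ_space G a b \<tau>" using BQ_space_iff c by blast
  qed
qed simp

lemma BQ_space_discontinuous:
  assumes "\<tau> \<noteq> 2" shows "acts_properly_discontinuously G a b \<tau> (BQ_space G a b \<tau>)"
  unfolding acts_properly_discontinuously_def
proof (intro allI impI, elim conjE)
  fix K assume K: "compactin (char_topology G a b \<tau>) K" "K \<subseteq> BQ_space G a b \<tau>"
  have Ks: "c \<in> char_space G a b \<tau>" if "c \<in> K" for c using K(2) that by (auto simp: BQ_space_def)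
  let ?K = "char_coords G a b ` K"
  have comp: "compact ?K" using K(1) unfolding char_topology_def by (rule compact_image_pullback)
  have BQK: "BQ q \<and> kappa q \<noteq> 4" if q: "q \<in> ?K" for q
  proof -
    obtain c where c: "c \<in> K" "q = char_coords G a b c" using q by blast
    then show ?thesis
      using K(2) BQ_space_iff[OF Ks[OF c(1)]] char_coords_kappa[OF Ks[OF c(1)]] tau_plus_2[OF assms] by auto
  qed
  obtain C where C: "\<And>q. q \<in> ?K \<Longrightarrow> norm q \<le> C" using compact_imp_bounded[OF comp] unfolding bounded_iff by blast
  \<comment> \<open>If a class of K is moved into K, the slopes of \<phi> a and \<phi> b lie in F,
    and these two slopes determine the mapping class.\<close>
  define F where "F = {u. prim u \<and> (\<exists>q\<in>?K. cmod (Phi q u) \<le> C)}"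
  have fin: "finite F" unfolding F_def by (rule compact_BQ_finite[OF comp BQK])
  define \<H> where "\<H> = {H \<in> carrier (MCG G a b). mcg_act G H ` K \<inter> K \<noteq> {}}"
  have ex: "\<exists>\<phi>. \<phi> \<in> orientation_auts G a b \<and> H = coset \<phi> \<and> ab (\<phi> a) \<in> F \<and> ab (\<phi> b) \<in> F" if "H \<in> \<H>" for H
  proof -
    obtain \<phi> c where \<phi>: "\<phi> \<in> orientation_auts G a b" "H = coset \<phi>" and c: "c \<in> K" "mcg_act G H c \<in> K"
      using \<open>H \<in> \<H>\<close> by (auto simp: \<H>_def MCG_carrier)
    let ?u = "ab (\<phi> a)" and ?v = "ab (\<phi> b)" and ?q = "char_coords G a b c"
    have "act ?u ?v ?q \<in> ?K" using mcg_act_coords(2)[OF \<phi>(1) Ks[OF c(1)]] c(2) \<phi>(2) by force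
    then have n: "norm (act ?u ?v ?q) \<le> C" by (rule C)
    have "cmod (Phi ?q ?u) \<le> norm (act ?u ?v ?q)"
      unfolding act_def by (rule norm_fst_le)
    moreover have "cmod (Phi ?q ?v) \<le> norm (act ?u ?v ?q)"
      unfolding act_def using norm_fst_le norm_snd_le order_trans by metis
    moreover have "prim ?u" "prim ?v"
      using det2_prim gens_det[OF auto_gens[OF orientation_auto[OF \<phi>(1)] gens_ab]] by blast+
    ultimately have "?u \<in> F \<and> ?v \<in> F" unfolding F_def using n c(1) by force
    then show ?thesis using \<phi> by blast
  qed
  then obtain f where f: "\<And>H. H \<in> \<H> \<Longrightarrow> f H \<in> orientation_auts G a b \<and> H = coset (f H) \<and> ab (f H a) \<in> F \<and> ab (f H b) \<in> F"
    by metis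
  have "inj_on (\<lambda>H. (ab (f H a), ab (f H b))) \<H>"
  proof (rule inj_onI)
    fix H H' assume H: "H \<in> \<H>" "H' \<in> \<H>" "(ab (f H a), ab (f H b)) = (ab (f H' a), ab (f H' b))"
    then have "coset (f H) = coset (f H')" using f orientation_auto by (intro coset_eq) auto
    then show "H = H'" using f H by metis
  qed
  moreover have "(\<lambda>H. (ab (f H a), ab (f H b))) ` \<H> \<subseteq> F \<times> F" using f by blast
  ultimately have "finite \<H>" using fin by (meson finite_SigmaI finite_imageD finite_subset)
  then show "finite {H \<in> carrier (MCG G a b). mcg_act G H ` K \<inter> K \<noteq> {}}" by (simp add: \<H>_def)
qed

text \<open>U is cut out by an open set S of the ambient space, and
  \<open>discontinuity_domain\<close> holds for S and \<tau> + 2. Compact sets of the surface pull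
  back to compact sets of classes, and bases inject into mapping classes through chosen
  automorphisms, so finiteness passes to bases.\<close>

lemma BQ_space_maximal:
  assumes \<tau>: "\<tau> \<noteq> 2" and U: "openin (char_topology G a b \<tau>) U" "mcg_invariant G a b U"
    "acts_properly_discontinuously G a b \<tau> U"
  shows "U \<subseteq> BQ_space G a b \<tau>"
proof -
  obtain S where S: "open S" "U = char_coords G a b -` S \<inter> char_space G a b \<tau>"
    using U(1) unfolding char_topology_def openin_pullback_topology by auto
  define aut where "aut u v = (SOME \<phi>. \<phi> \<in> orientation_auts G a b \<and> ab (\<phi> a) = u \<and> ab (\<phi> b) = v)" for u v
  have aut: "aut u v \<in> orientation_auts G a b \<and> ab (aut u v a) = u \<and> ab (aut u v b) = v"
    if "det2 u v = 1" for u v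
    unfolding aut_def by (rule someI_ex[OF orientation_aut_exists[OF that]])
  have MCG: "coset (aut u v) \<in> carrier (MCG G a b)" if "det2 u v = 1" for u v
    using aut[OF that] by (simp add: MCG_carrier)
  have dd: "discontinuity_domain Phi S (\<tau> + 2)"
  proof (rule discontinuity_domain.intro[OF trace_family_Phi discontinuity_domain_axioms.intro])
    show "open S" by fact
    show "\<tau> + 2 \<noteq> 4" by (rule tau_plus_2[OF \<tau>])
  next
    fix u v p assume det: "det2 u v = 1" and p: "p \<in> S" "kappa p = \<tau> + 2"
    obtain c where c: "c \<in> char_space G a b \<tau>" "char_coords G a b c = p" using char_coords_surj[OF p(2)] by blast
    then have "c \<in> U" using S p by simp
    then have "mcg_act G (coset (aut u v)) c \<in> U" using U(2) MCG[OF det] unfolding mcg_invariant_def by blast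
    then have "char_coords G a b (mcg_act G (coset (aut u v)) c) \<in> S" using S by simp
    then show "act u v p \<in> S" using mcg_act_coords(2)[of "aut u v", OF _ c(1)] aut[OF det] c(2) by simp
  next
    fix K assume K: "compact K" "K \<subseteq> {p \<in> S. kappa p = \<tau> + 2}"
    define K' where "K' = char_coords G a b -` K \<inter> char_space G a b \<tau>"
    have "K \<subseteq> char_coords G a b ` char_space G a b \<tau>"
    proof
      fix p assume "p \<in> K"
      then have "kappa p = \<tau> + 2" using K(2) by blast
      from char_coords_surj[OF this] show "p \<in> char_coords G a b ` char_space G a b \<tau>" by blast
    qed
    then have "compactin (char_topology G a b \<tau>) K'"
      unfolding char_topology_def K'_def by (rule compactin_pullback[OF K(1)])
    moreover have "K' \<subseteq> U" using K(2) unfolding K'_def S(2) by blast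
    ultimately have fin: "finite {H \<in> carrier (MCG G a b). mcg_act G H ` K' \<inter> K' \<noteq> {}}"
      using U(3) unfolding acts_properly_discontinuously_def by blast
    let ?T = "{(u, v). det2 u v = 1 \<and> act u v ` K \<inter> K \<noteq> {}}"
    have "(\<lambda>(u, v). coset (aut u v)) ` ?T \<subseteq> {H \<in> carrier (MCG G a b). mcg_act G H ` K' \<inter> K' \<noteq> {}}"
    proof (rule image_subsetI)
      fix w assume "w \<in> ?T"
      then obtain u v where uv: "w = (u, v)" "det2 u v = 1" "act u v ` K \<inter> K \<noteq> {}" by (cases w) simp
      then obtain p where "p \<in> K" "act u v p \<in> K" by blast
      note w = uv(1,2) this
      have "kappa p = \<tau> + 2" using K(2) w(3) by blast
      then obtain c where c: "c \<in> char_space G a b \<tau>" "char_coords G a b c = p" using char_coords_surj by blast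
      have "c \<in> K'" using c w(3) by (simp add: K'_def)
      moreover have "mcg_act G (coset (aut u v)) c \<in> K'"
        using mcg_act_coords[of "aut u v", OF _ c(1)] aut[OF w(2)] c(2) w(4) by (simp add: K'_def)
      ultimately show "(case w of (u, v) \<Rightarrow> coset (aut u v)) \<in> {H \<in> carrier (MCG G a b). mcg_act G H ` K' \<inter> K' \<noteq> {}}"
        using MCG[OF w(2)] w(1) by auto
    qed
    moreover have "inj_on (\<lambda>(u, v). coset (aut u v)) ?T"
    proof (rule inj_onI)
      fix w w' assume "w \<in> ?T" and w': "w' \<in> ?T" and eq: "(case w of (u, v) \<Rightarrow> coset (aut u v)) = (case w' of (u, v) \<Rightarrow> coset (aut u v))"
      from \<open>w \<in> ?T\<close> obtain u v where uv: "w = (u, v)" "det2 u v = 1" by (cases w) simp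
      obtain u' v' where uv': "w' = (u', v')" "det2 u' v' = 1" using w' by (cases w') simp
      note w = uv(1) uv'(1) uv(2) uv'(2)
      have "coset (aut u v) = coset (aut u' v')" using eq w by simp
      from coset_ab[OF _ _ this, of a] coset_ab[OF _ _ this, of b] show "w = w'"
        using aut[OF w(3)] aut[OF w(4)] orientation_auto w(1,2) by auto
    qed
    ultimately show "finite ?T" using fin by (meson finite_imageD finite_subset)
  qed
  show ?thesis
  proof
    fix c assume c: "c \<in> U"
    then have cs: "c \<in> char_space G a b \<tau>" and "char_coords G a b c \<in> S" using S by auto
    then have "char_coords G a b c \<in> discontinuity_domain.D S (\<tau> + 2)"
      using char_coords_kappa[OF cs] by (simp add: discontinuity_domain.D_def[OF dd])
    then have "BQ (char_coords G a b c)" by (rule discontinuity_domain.D_BQ[OF dd])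
    then show "c \<in> BQ_space G a b \<tau>" using BQ_space_iff[OF cs] by simp
  qed
qed

end

theorem mainTheorem4:
  fixes \<Gamma> :: "('g, 'm) monoid_scheme" and a b :: 'g and \<tau> :: complex
  assumes "group \<Gamma>" and "free_basis \<Gamma> a b" and "\<tau> \<noteq> 2"
  shows "openin (char_topology \<Gamma> a b \<tau>) (BQ_space \<Gamma> a b \<tau>)
    \<and> mcg_invariant \<Gamma> a b (BQ_space \<Gamma> a b \<tau>)
    \<and> acts_properly_discontinuously \<Gamma> a b \<tau> (BQ_space \<Gamma> a b \<tau>)
    \<and> (\<forall>U. openin (char_topology \<Gamma> a b \<tau>) U \<and> mcg_invariant \<Gamma> a b U
          \<and> acts_properly_discontinuously \<Gamma> a b \<tau> U
        \<longrightarrow> U \<subseteq> BQ_space \<Gamma> a b \<tau>)"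
proof -
  interpret free2 \<Gamma> a b
    using assms(1,2) by (simp add: free2_def free2_axioms_def)
  show ?thesis
    using BQ_space_open[OF assms(3)] BQ_space_invariant BQ_space_discontinuous[OF assms(3)]
      BQ_space_maximal[OF assms(3)] by blast
qed

end
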